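(* Let $m\ge 1$ and let $\beta=\sigma_{i_1}\sigma_{i_2}\cdots\sigma_{i_n}$ (with $1\le i_j\le m-1$) be a positive braid word on $m$ strands with $n$ crossings, and suppose its closure is a knot $K$. Let $N\geq 2$ be an integer and put $L_N=(N-1)(n-m+1)/2$. Then $$J'_K(N)=\sum_{i=1}^N a_{N,i}\, q^{L_N+i-1} + \text{(higher terms)},$$ where $a_{N,1}=1$ and $a_{N,i}=0$ for $2\le i\le N$, and "higher terms" denotes a $\mathbb{Z}$-linear combination of powers $q^d$ with $d\ge L_N+N$.
   Context: $B_m$ is the braid group on $m$ strands with standard generators $\sigma_1,\dots,\sigma_{m-1}$. The product $\beta_1\beta_2$ is formed by putting $\beta_1$ on top of $\beta_2$. The closure of a braid is the link obtained by attaching the top of each strand position to the bottom of the same position. All strands are oriented in parallel, and $\sigma_i$ is the positive crossing of the strands in positions $i,i+1$: reading upwards, the over-strand goes from position $i$ to position $i+1$. A positive braid is one presented by a word in the $\sigma_i$ with no inverse generators. $J'_K(N)\in\mathbb{Z}[q,q^{-1}]$ is the normalized colored Jones polynomial of the knot $K$ (with zero framing), corresponding to the $N$-dimensional irreducible representation of quantum $\mathfrak{sl}_2$. It is normalized so that $J'_U(N)=1$ for the unknot $U$, and $J'_K(2)$ is the ordinary Jones polynomial. The convention is that the closure of $\sigma_1^3\in B_2$ has $J'(2)=q+q^3-q^4$. Concretely, let $\langle\cdot\rangle$ be the Kauffman bracket with variable $A$, with $\langle \text{empty diagram}\rangle=1$, with each disjoint circle contributing a factor $-A^2-A^{-2}$,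 and with a positive kink multiplying by $-A^3$. Put $S_0=1$, $S_1=z$, $S_{k+1}=zS_k-S_{k-1}$. For a diagram $D$ of $K$ with writhe $w$, let $\langle S_{k}(D)\rangle$ be obtained by replacing $z^l$ by the bracket of the blackboard $l$-parallel of $D$. Then $$J'_K(N)=\left((-1)^{N-1}A^{N^2-1}\right)^{-w}\,\frac{\langle S_{N-1}(D)\rangle}{\langle S_{N-1}(\bigcirc)\rangle}\Big|_{A^{-4}=q},$$ where $\bigcirc$ is the crossingless unknot diagram. *)

theory Defs
  imports "HOL-Computational_Algebra.Computational_Algebra"
begin

text \<open>
  A braid word is read from top to bottom, so the product of two braids (the first one on top) is
  given by appending words. \<open>GenInv i\<close> is the inverse of the standard generator \<open>Gen i\<close>.
\<close>

datatype generator = Gen nat | GenInv nat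

fun strand :: "generator \<Rightarrow> nat" where
  "strand (Gen i) = i"
| "strand (GenInv i) = i"

fun crossing_sign :: "generator \<Rightarrow> int" where
  "crossing_sign (Gen i) = 1"
| "crossing_sign (GenInv i) = -1"

definition writhe :: "generator list \<Rightarrow> int" where
  "writhe w = sum_list (map crossing_sign w)"

text \<open>
  A point \<open>(p, t)\<close> is strand position \<open>p\<close> (counted from 1) at height level \<open>t\<close>; the letter
  \<open>w ! t\<close> lies between level \<open>t\<close> (above it) and level \<open>t + 1\<close> (below it).  A one-dimensional
  picture is given by the set of arcs between such points.  The arcs away from the crossings
  include those which close up the braid.
\<close>

type_synonym point = "nat \<times> nat"

definition points :: "nat \<Rightarrow> generator list \<Rightarrow> point set" where
  "points m w = {1..m} \<times> {0..length w}"

definition outer_arcs :: "nat \<Rightarrow> generator list \<Rightarrow> (point \<times> point) set" where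
  "outer_arcs m w =
     {((p, t), (p, Suc t)) | p t. t < length w \<and> p \<in> {1..m} - {strand (w ! t), Suc (strand (w ! t))}}
   \<union> {((p, length w), (p, 0)) | p. p \<in> {1..m}}"

definition crossed_arcs :: "nat \<Rightarrow> nat \<Rightarrow> (point \<times> point) set" where
  "crossed_arcs i t = {((i, t), (Suc i, Suc t)), ((Suc i, t), (i, Suc t))}"

definition vertical_arcs :: "nat \<Rightarrow> nat \<Rightarrow> (point \<times> point) set" where
  "vertical_arcs i t = {((i, t), (i, Suc t)), ((Suc i, t), (Suc i, Suc t))}"

definition horizontal_arcs :: "nat \<Rightarrow> nat \<Rightarrow> (point \<times> point) set" where
  "horizontal_arcs i t = {((i, t), (Suc i, t)), ((i, Suc t), (Suc i, Suc t))}"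

definition num_components :: "point set \<Rightarrow> (point \<times> point) set \<Rightarrow> nat" where
  "num_components V E = card (V // (E \<union> E\<inverse>)\<^sup>*)"

definition closure_arcs :: "nat \<Rightarrow> generator list \<Rightarrow> (point \<times> point) set" where
  "closure_arcs m w = outer_arcs m w \<union> (\<Union>t<length w. crossed_arcs (strand (w ! t)) t)"

definition closure_is_knot :: "nat \<Rightarrow> generator list \<Rightarrow> bool" where
  "closure_is_knot m w \<longleftrightarrow> num_components (points m w) (closure_arcs m w) = 1"

text \<open>
  A state is the set \<open>S\<close> of (indices of) crossings that receive the \<open>A\<close>-smoothing, the other
  ones receiving the \<open>A\<inverse>\<close>-smoothing.  At a positive crossing the \<open>A\<close>-smoothing is the oriented
  (vertical) one: this is what gives a positive kink the factor
  \<open>A (- A\<^sup>2 - A\<^sup>-\<^sup>2) + A\<inverse> = - A\<^sup>3\<close>.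
\<close>

definition smoothing_arcs :: "generator list \<Rightarrow> nat set \<Rightarrow> nat \<Rightarrow> (point \<times> point) set" where
  "smoothing_arcs w S t =
     (if t \<in> S \<longleftrightarrow> crossing_sign (w ! t) = 1
      then vertical_arcs (strand (w ! t)) t
      else horizontal_arcs (strand (w ! t)) t)"

definition state_circles :: "nat \<Rightarrow> generator list \<Rightarrow> nat set \<Rightarrow> nat" where
  "state_circles m w S =
     num_components (points m w) (outer_arcs m w \<union> (\<Union>t<length w. smoothing_arcs w S t))"

definition kauffman_bracket :: "'a::field \<Rightarrow> nat \<Rightarrow> generator list \<Rightarrow> 'a" where
  "kauffman_bracket A m w =
     (\<Sum>S\<in>Pow {..<length w}.
        A powi (int (card S) - int (length w - card S))
        * (- (A powi 2) - A powi (-2)) ^ state_circles m w S)"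

text \<open>
  The blackboard \<open>l\<close>-parallel of a closed braid diagram on \<open>m\<close> strands is the closure of a braid
  word on \<open>l * m\<close> strands: strand position \<open>p\<close> becomes the positions \<open>(p - 1) * l + 1, \<dots>, p * l\<close>,
  and \<open>Gen i\<close> becomes the grid of \<open>l\<^sup>2\<close> positive crossings which exchanges two adjacent bands.
\<close>

definition band_crossing :: "nat \<Rightarrow> nat \<Rightarrow> nat list" where
  "band_crossing l i = concat (map (\<lambda>a. map (\<lambda>b. i * l + a - b) [0..<l]) [0..<l])"

fun parallel_generator :: "nat \<Rightarrow> generator \<Rightarrow> generator list" where
  "parallel_generator l (Gen i) = map Gen (band_crossing l i)"
| "parallel_generator l (GenInv i) = map GenInv (rev (band_crossing l i))"

definition parallel_word :: "nat \<Rightarrow> generator list \<Rightarrow> generator list" where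
  "parallel_word l w = concat (map (parallel_generator l) w)"

fun chebyshev_S :: "nat \<Rightarrow> int poly" where
  "chebyshev_S 0 = 1"
| "chebyshev_S (Suc 0) = [:0, 1:]"
| "chebyshev_S (Suc (Suc k)) = [:0, 1:] * chebyshev_S (Suc k) - chebyshev_S k"

definition chebyshev_bracket :: "'a::field \<Rightarrow> nat \<Rightarrow> nat \<Rightarrow> generator list \<Rightarrow> 'a" where
  "chebyshev_bracket A k m w =
     (\<Sum>l\<le>degree (chebyshev_S k).
        of_int (coeff (chebyshev_S k) l) * kauffman_bracket A (l * m) (parallel_word l w))"

text \<open>
  The colored Jones polynomial lives in the field of rational functions in \<open>A\<close>.  The crossingless
  unknot diagram is the closure of the empty word on one strand.
\<close>

definition A_var :: "int poly fract" where
  "A_var = Fract [:0, 1:] 1"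

definition q_var :: "int poly fract" where
  "q_var = A_var powi (-4)"

definition colored_jones :: "nat \<Rightarrow> generator list \<Rightarrow> nat \<Rightarrow> int poly fract" where
  "colored_jones m w N =
     ((-1) ^ (N - 1) * A_var ^ (N\<^sup>2 - 1)) powi (- writhe w)
     * (chebyshev_bracket A_var (N - 1) m w / chebyshev_bracket A_var (N - 1) 1 [])"

end

theory Submission
  imports Defs "HOL-Combinatorics.Cycles"
begin

text \<open>
  Resolving all crossings turns the bracket into the trace of a product of operators
  \<open>A + A\<inverse> E\<^sub>i\<close>, where the Temperley-Lieb generators \<open>E\<^sub>i\<close> act on functions of particle
  configurations (a \<open>q\<close>-deformed vertex model). That the trace of a word in the \<open>E\<^sub>i\<close> is the right
  power of the loop value follows because a Markov trace is determined by the Temperley-Lieb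
  relations, which the number of circles inherits from the model that counts two-colourings.

  Sliding cups once around the knot turns the Chebyshev polynomial of the diagram into the
  \<open>k\<close>-cable, \<open>k = N - 1\<close>, with one Jones-Wenzl projector. Partial traces then split off the quantum
  integer, and what remains is the sum over the closed particle histories of the cable in which the
  first band is empty at the top. The weight of a history with \<open>j\<close> particles and \<open>c\<close> moves to the right
  is divisible by \<open>q\<^sup>j\<^sup>+\<^sup>c\<close>. If \<open>j + c \<le> k\<close>, no particle can pass from a band to the next one on
  its right; so in a closed history all particles stay in the first band, and there are none.
\<close>

section \<open>Linear operators on functions of particle configurations\<close>

text \<open>The circles of a state are components of a graph, and no isotopy of diagrams is at hand.
  So every topological step is an identity between operators: cups and caps obey the zigzag
  relations in any \<open>tl_rep\<close>, and one theory serves both for loop value 2, where traces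
  count colourings, and for the Kauffman weights. The closed projector may be replaced by an empty
  first band because hooks annihilate both the projector and the vacuum: two Markov traces that
  agree on \<open>k\<close> strands agree on all larger numbers of strands. In the particle model a
  crossing, divided by \<open>A\<close>, has weight 1 on equal neighbours and a square root of
  \<open>q\<close> on every move; a particle may stay next to an empty place on its right, with
  weight \<open>1 - q\<close>, but not next to one on its left. In a closed history the moves in the
  two directions balance, so that counting the moves to the right suffices, with one
  \<open>q\<close> for each. That the closure is a knot has three consequences: a travelling cup
  meets every band exactly once, every generator occurs in the word, and the parity of the length
  makes \<open>L_N\<close> an integer and cancels the signs.\<close>

type_synonym config = "nat \<Rightarrow> bool"

text \<open>Configurations have infinitely many positions, so that cups and caps, which change the
  number of strands, lie in the same ring as the crossings and can be multiplied with them
  freely.\<close>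

typedef (overloaded) 'a::comm_ring_1 linop =
  "{T :: (config \<Rightarrow> 'a) \<Rightarrow> config \<Rightarrow> 'a.
      (\<forall>\<phi> \<psi>. T (\<lambda>s. \<phi> s + \<psi> s) = (\<lambda>s. T \<phi> s + T \<psi> s)) \<and> (\<forall>c \<phi>. T (\<lambda>s. c * \<phi> s) = (\<lambda>s. c * T \<phi> s))}"
  morphisms app Abs_linop
  by (rule exI[of _ "\<lambda>\<phi> s. 0"]) auto

setup_lifting type_definition_linop

lemma linop_eqI: "(\<And>\<phi> s. app S \<phi> s = app T \<phi> s) \<Longrightarrow> S = T"
  by (metis app_inject ext)

lemma app_add: "app T (\<lambda>s. \<phi> s + \<psi> s) s = app T \<phi> s + app T \<psi> s"
  and app_mult: "app T (\<lambda>s. c * \<phi> s) s = c * app T \<phi> s"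
  using app[of T] by (simp_all add: fun_eq_iff)

instantiation linop :: (comm_ring_1) ring_1
begin

lift_definition zero_linop :: "'a linop" is "\<lambda>\<phi> s. 0" by simp
lift_definition one_linop :: "'a linop" is "\<lambda>\<phi>. \<phi>" by simp
lift_definition plus_linop :: "'a linop \<Rightarrow> 'a linop \<Rightarrow> 'a linop" is "\<lambda>S T \<phi> s. S \<phi> s + T \<phi> s"
  by (auto simp: algebra_simps)
lift_definition minus_linop :: "'a linop \<Rightarrow> 'a linop \<Rightarrow> 'a linop" is "\<lambda>S T \<phi> s. S \<phi> s - T \<phi> s"
  by (intro conjI allI ext; elim conjE; simp add: right_diff_distrib)
lift_definition uminus_linop :: "'a linop \<Rightarrow> 'a linop" is "\<lambda>T \<phi> s. - T \<phi> s"
  by simp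
lift_definition times_linop :: "'a linop \<Rightarrow> 'a linop \<Rightarrow> 'a linop" is "\<lambda>S T \<phi>. S (T \<phi>)"
  by simp

lemmas app_linop_simps = zero_linop.rep_eq one_linop.rep_eq plus_linop.rep_eq minus_linop.rep_eq
  uminus_linop.rep_eq times_linop.rep_eq

instance
proof
  fix a b c :: "'a linop"
  show "(0::'a linop) \<noteq> 1"
  proof
    assume "(0::'a linop) = 1"
    then have "app (0::'a linop) (\<lambda>s. 1) (\<lambda>p. True) = app 1 (\<lambda>s. 1) (\<lambda>p. True)" by simp
    then show False by (simp add: app_linop_simps)
  qed
  show "a * (b + c) = a * b + a * c"
    by (rule linop_eqI) (simp add: app_linop_simps app_add)
qed (rule linop_eqI, simp add: app_linop_simps)+

end

lift_definition scalar :: "'a::comm_ring_1 \<Rightarrow> 'a linop" is "\<lambda>c \<phi> s. c * \<phi> s"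
  by (auto simp: algebra_simps)

lemma app_simps [simp]:
  "app 0 \<phi> s = 0" "app 1 \<phi> = \<phi>" "app (S + T) \<phi> s = app S \<phi> s + app T \<phi> s"
  "app (S - T) \<phi> s = app S \<phi> s - app T \<phi> s" "app (- T) \<phi> s = - app T \<phi> s"
  "app (S * T) \<phi> = app S (app T \<phi>)" "app (scalar c) \<phi> s = c * \<phi> s"
  by (simp_all add: app_linop_simps scalar.rep_eq)

lemma app_zero: "app T (\<lambda>s. 0) s = 0"
  using app_mult[of T 0 "\<lambda>s. 0" s] by simp

lemma app_sum: "app T (\<lambda>s. \<Sum>i\<in>I. \<phi> i s) s = (\<Sum>i\<in>I. app T (\<phi> i) s)"
  by (induction I rule: infinite_finite_induct) (auto simp: app_zero app_add)

lemma scalar_simps: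
  "scalar 0 = 0" "scalar 1 = 1" "scalar (a + b) = scalar a + scalar b"
  "scalar (a - b) = scalar a - scalar b" "scalar (- a) = - scalar a" "scalar (a * b) = scalar a * scalar b"
  by (auto intro!: linop_eqI simp: algebra_simps)

lemma scalar_commute: "T * scalar c = scalar c * T"
proof (rule linop_eqI)
  fix \<phi> s
  have "app (scalar c) \<phi> = (\<lambda>s. c * \<phi> s)" by (rule ext) simp
  then show "app (T * scalar c) \<phi> s = app (scalar c * T) \<phi> s" by (simp add: app_mult)
qed

lemma scalar_left_commute: "T * (scalar c * S) = scalar c * (T * S)"
  by (metis mult.assoc scalar_commute)

definition insert_pair :: "nat \<Rightarrow> bool \<Rightarrow> bool \<Rightarrow> config \<Rightarrow> config" where
  "insert_pair i b c s = (\<lambda>p. if p < i then s p else if p = i then b else if p = Suc i then c else s (p - 2))"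

definition delete_pair :: "nat \<Rightarrow> config \<Rightarrow> config" where
  "delete_pair i s = (\<lambda>p. if p < i then s p else s (p + 2))"

definition delta :: "config \<Rightarrow> config \<Rightarrow> 'a::comm_ring_1" where
  "delta s t = (if t = s then 1 else 0)"

definition subst_op :: "nat \<Rightarrow> bool \<Rightarrow> 'a::comm_ring_1 linop" where
  "subst_op p b = Abs_linop (\<lambda>\<phi> s. \<phi> (s(p := b)))"

definition proj_op :: "nat \<Rightarrow> bool \<Rightarrow> 'a::comm_ring_1 linop" where
  "proj_op p b = Abs_linop (\<lambda>\<phi> s. if s p = b then \<phi> s else 0)"

lemma app_subst_op [simp]: "app (subst_op p b) \<phi> s = \<phi> (s(p := b))"
  unfolding subst_op_def by (subst Abs_linop_inverse) auto

lemma app_proj_op [simp]: "app (proj_op p b) \<phi> s = (if s p = b then \<phi> s else 0)"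
  unfolding proj_op_def by (subst Abs_linop_inverse) auto

text \<open>
  Commuting with substitutions and projections says that the operator neither depends on the
  positions beyond \<open>M\<close> nor changes them.
\<close>

definition local_op :: "nat \<Rightarrow> 'a::comm_ring_1 linop \<Rightarrow> bool" where
  "local_op M T \<longleftrightarrow> (\<forall>p>M. \<forall>b. T * subst_op p b = subst_op p b * T \<and> T * proj_op p b = proj_op p b * T)"

lemma local_op_mono: "local_op M T \<Longrightarrow> M \<le> M' \<Longrightarrow> local_op M' T"
  by (auto simp: local_op_def)

lemma local_op_one: "local_op M 1"
  and local_op_scalar: "local_op M (scalar c)"
  by (simp_all add: local_op_def scalar_commute)

lemma local_op_mult: "local_op M S \<Longrightarrow> local_op M T \<Longrightarrow> local_op M (S * T)"
  unfolding local_op_def by (simp add: mult.assoc) (simp add: mult.assoc[symmetric])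

lemma local_op_diff: "local_op M S \<Longrightarrow> local_op M T \<Longrightarrow> local_op M (S - T)"
  unfolding local_op_def
  by (simp only: left_diff_distrib right_diff_distrib) simp

definition configs :: "nat \<Rightarrow> nat \<Rightarrow> config set" where
  "configs k M = {s. \<forall>p. s p \<longrightarrow> k < p \<and> p \<le> M}"

lemma finite_configs: "finite (configs k M)"
proof -
  have "configs k M \<subseteq> (\<lambda>S p. p \<in> S) ` Pow {..M}"
  proof
    fix s assume "s \<in> configs k M"
    then have "Collect s \<in> Pow {..M}" "s = (\<lambda>p. p \<in> Collect s)" by (auto simp: configs_def)
    then show "s \<in> (\<lambda>S p. p \<in> S) ` Pow {..M}" by blast
  qed
  then show ?thesis by (rule finite_subset) auto
qed

lemma configs_self: "configs k k = {\<lambda>p. False}"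
  by (auto simp: configs_def fun_eq_iff) (meson leD)

lemma sum_configs_Suc:
  assumes "k \<le> M"
  shows "(\<Sum>s\<in>configs k (Suc M). F s) = (\<Sum>s\<in>configs k M. \<Sum>b\<in>UNIV. F (s(Suc M := b)))"
proof -
  have eq: "s(Suc M := False, Suc M := b) = s(Suc M := b)" for s :: config and b by simp
  have s0: "s (Suc M) = False" if "s \<in> configs k M" for s using that by (auto simp: configs_def)
  have "(\<Sum>s\<in>configs k (Suc M). F s) = (\<Sum>(s,b)\<in>configs k M \<times> UNIV. F (s(Suc M := b)))"
  proof (rule sum.reindex_bij_witness[where i = "\<lambda>(s,b). s(Suc M := b)" and j = "\<lambda>s. (s(Suc M := False), s (Suc M))"])
    show "\<And>b. b \<in> configs k M \<times> UNIV \<Longrightarrow>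
         (((case b of (s, b) \<Rightarrow> s(Suc M := b))(Suc M := False)), (case b of (s, b) \<Rightarrow> s(Suc M := b)) (Suc M)) = b"
      by (auto simp: fun_eq_iff dest: s0)
    show "\<And>b. b \<in> configs k M \<times> UNIV \<Longrightarrow> (case b of (s, b) \<Rightarrow> s(Suc M := b)) \<in> configs k (Suc M)"
      using assms by (force simp: configs_def)
    show "\<And>a. a \<in> configs k (Suc M) \<Longrightarrow> (a(Suc M := False), a (Suc M)) \<in> configs k M \<times> UNIV"
      by (auto simp: configs_def le_Suc_eq)
  qed (auto simp: fun_eq_iff)
  then show ?thesis by (simp add: sum.cartesian_product)
qed

lemma sum_bool: "(\<Sum>b\<in>UNIV. F b) = F False + (F True :: 'b::comm_monoid_add)"
  by (simp add: UNIV_bool)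

section \<open>Temperley-Lieb relations and traces\<close>

lemma insert_pair_simps [simp]:
  "insert_pair i b c s i = b" "insert_pair i b c s (Suc i) = c"
  "p < i \<Longrightarrow> insert_pair i b c s p = s p"
  "i \<le> p \<Longrightarrow> insert_pair i b c s (Suc (Suc p)) = s p"
  "delete_pair i (insert_pair i b c s) = s"
  "delete_pair (Suc i) (insert_pair i b c s) = s(i := b)"
  "delete_pair i (insert_pair (Suc i) b c s) = s(i := c)"
  "insert_pair i b c (delete_pair i s) = s(i := b, Suc i := c)"
proof -
  show "delete_pair i (insert_pair i b c s) = s"
    by (rule ext) (simp add: insert_pair_def delete_pair_def)
  show "delete_pair (Suc i) (insert_pair i b c s) = s(i := b)"
    by (rule ext) (simp add: insert_pair_def delete_pair_def)
  show "delete_pair i (insert_pair (Suc i) b c s) = s(i := c)"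
    by (rule ext) (simp add: insert_pair_def delete_pair_def)
  show "insert_pair i b c (delete_pair i s) = s(i := b, Suc i := c)"
  proof (rule ext)
    fix p
    have "Suc (Suc (p - 2)) = p" "\<not> p - 2 < i" if "\<not> p < i" "p \<noteq> i" "p \<noteq> Suc i"
      using that by linarith+
    then show "insert_pair i b c (delete_pair i s) p = (s(i := b, Suc i := c)) p"
      by (simp add: insert_pair_def delete_pair_def)
  qed
qed (simp_all add: insert_pair_def)

lemma delete_pair_simps [simp]:
  "p < i \<Longrightarrow> delete_pair i s p = s p"
  "i \<le> p \<Longrightarrow> delete_pair i s p = s (Suc (Suc p))"
  by (auto simp: delete_pair_def)

lemma pair_position_cases:
  obtains "p < i" | "p = i" | "p = Suc i" | q where "p = Suc (Suc q)" "i \<le> q"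
proof (cases "Suc (Suc i) \<le> p")
  case True
  then obtain q where "p = Suc (Suc i) + q" using le_Suc_ex by blast
  then have "p = Suc (Suc (i + q))" "i \<le> i + q" by simp_all
  then show ?thesis using that(4) by blast
next
  case False
  then have "p < i \<or> p = i \<or> p = Suc i" by arith
  then show ?thesis using that(1-3) by blast
qed

text \<open>The exchange relations between distant cups and caps all rest on these four identities;
  the index moves by two because a pair to its left has been inserted or deleted.\<close>

lemma pair_commute:
  assumes "i \<le> j"
  shows "delete_pair i (delete_pair (Suc (Suc j)) s) = delete_pair j (delete_pair i s)" (is ?A)
    and "delete_pair i (insert_pair (Suc (Suc j)) b c s) = insert_pair j b c (delete_pair i s)" (is ?B)
    and "delete_pair (Suc (Suc j)) (insert_pair i b c s) = insert_pair i b c (delete_pair j s)" (is ?C)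
    and "insert_pair (Suc (Suc j)) b c (insert_pair i b' c' s) = insert_pair i b' c' (insert_pair j b c s)" (is ?D)
proof -
  show ?A using assms by (auto simp: delete_pair_def fun_eq_iff)
  show ?B
  proof (rule ext)
    fix p
    show "delete_pair i (insert_pair (Suc (Suc j)) b c s) p = insert_pair j b c (delete_pair i s) p"
      using assms by (cases "p < i"; cases rule: pair_position_cases[of p j]; simp)
  qed
  show ?C
  proof (rule ext)
    fix p
    show "delete_pair (Suc (Suc j)) (insert_pair i b c s) p = insert_pair i b c (delete_pair j s) p"
    proof (cases rule: pair_position_cases[of p i])
      case (4 q)
      with assms show ?thesis by (cases "q < j") simp_all
    qed (use assms in simp_all)
  qed
  show ?D
  proof (rule ext)
    fix p
    show "insert_pair (Suc (Suc j)) b c (insert_pair i b' c' s) p = insert_pair i b' c' (insert_pair j b c s) p"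
    proof (cases rule: pair_position_cases[of p i])
      case (4 q)
      with assms show ?thesis by (cases rule: pair_position_cases[of q j]) simp_all
    qed (use assms in simp_all)
  qed
qed

text \<open>\<open>f\<close> and \<open>g\<close> weigh cups and caps, \<open>\<mu>\<close> the arcs
  that close a strand. The zigzags straighten a strand, \<open>partial\<close> straightens one that
  runs through the closure, and \<open>balanced\<close> lets the two feet of a cup pass through the
  closure at no cost.\<close>

locale tl_rep =
  fixes f g :: "bool \<Rightarrow> bool \<Rightarrow> 'a::comm_ring_1" and \<mu> :: "bool \<Rightarrow> 'a" and d :: 'a
  assumes loop: "(\<Sum>b\<in>UNIV. \<Sum>c\<in>UNIV. g b c * f b c) = d"
    and zigzag1: "(\<Sum>c\<in>UNIV. g b c * f c t) = (if b = t then 1 else 0)"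
    and zigzag2: "(\<Sum>b\<in>UNIV. f t b * g b c) = (if c = t then 1 else 0)"
    and sum_\<mu>: "(\<Sum>b\<in>UNIV. \<mu> b) = d"
    and partial: "(\<Sum>b\<in>UNIV. \<mu> b * f t b * g c b) = (if c = t then 1 else 0)"
    and balanced: "\<mu> b * \<mu> c * f b c = f b c"
begin

definition cup :: "nat \<Rightarrow> 'a linop" where
  "cup i = Abs_linop (\<lambda>\<phi> s. f (s i) (s (Suc i)) * \<phi> (delete_pair i s))"

definition cap :: "nat \<Rightarrow> 'a linop" where
  "cap i = Abs_linop (\<lambda>\<phi> s. \<Sum>b\<in>UNIV. \<Sum>c\<in>UNIV. g b c * \<phi> (insert_pair i b c s))"

lemma app_cup: "app (cup i) \<phi> s = f (s i) (s (Suc i)) * \<phi> (delete_pair i s)"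
  unfolding cup_def by (subst Abs_linop_inverse) (auto simp: algebra_simps)

lemma app_cap: "app (cap i) \<phi> s = (\<Sum>b\<in>UNIV. \<Sum>c\<in>UNIV. g b c * \<phi> (insert_pair i b c s))"
  unfolding cap_def
  by (subst Abs_linop_inverse) (auto simp: algebra_simps sum.distrib sum_distrib_left)

definition hook :: "nat \<Rightarrow> 'a linop" where
  "hook i = cup i * cap i"

lemma app_hook:
  "app (hook i) \<phi> s = f (s i) (s (Suc i)) * (\<Sum>b\<in>UNIV. \<Sum>c\<in>UNIV. g b c * \<phi> (s(i := b, Suc i := c)))"
  by (simp add: hook_def app_cup app_cap)

lemma cap_cup: "cap i * cup i = scalar d"
  by (rule linop_eqI) (simp add: app_cup app_cap loop[symmetric] sum_distrib_right mult.assoc)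

lemma cap_cup_Suc: "cap i * cup (Suc i) = 1"
proof (rule linop_eqI)
  fix \<phi> s
  have "app (cap i * cup (Suc i)) \<phi> s
      = (\<Sum>b\<in>UNIV. (\<Sum>c\<in>UNIV. g b c * f c (s i)) * \<phi> (s(i := b)))"
    by (simp add: app_cup app_cap sum_distrib_right mult.assoc)
  also have "\<dots> = \<phi> s"
    by (cases "s i") (simp_all add: zigzag1 sum_bool fun_upd_idem)
  finally show "app (cap i * cup (Suc i)) \<phi> s = app 1 \<phi> s" by simp
qed

lemma cap_Suc_cup: "cap (Suc i) * cup i = 1"
proof (rule linop_eqI)
  fix \<phi> s
  have "app (cap (Suc i) * cup i) \<phi> s
      = (\<Sum>b\<in>UNIV. \<Sum>c\<in>UNIV. f (s i) b * g b c * \<phi> (s(i := c)))"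
    by (simp add: app_cup app_cap algebra_simps)
  also have "\<dots> = (\<Sum>c\<in>UNIV. (\<Sum>b\<in>UNIV. f (s i) b * g b c) * \<phi> (s(i := c)))"
    by (subst sum.swap) (simp add: sum_distrib_right)
  also have "\<dots> = \<phi> s"
    by (cases "s i") (simp_all add: zigzag2 sum_bool fun_upd_idem)
  finally show "app (cap (Suc i) * cup i) \<phi> s = app 1 \<phi> s" by simp
qed

lemma cup_cup: "i \<le> j \<Longrightarrow> cup i * cup j = cup (Suc (Suc j)) * cup i"
  by (rule linop_eqI) (simp add: app_cup pair_commute ac_simps)

lemma cap_cap: "i \<le> j \<Longrightarrow> cap i * cap (Suc (Suc j)) = cap j * cap i"
proof (rule linop_eqI)
  fix \<phi> s assume "i \<le> j"
  then show "app (cap i * cap (Suc (Suc j))) \<phi> s = app (cap j * cap i) \<phi> s"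
    by (simp add: app_cap pair_commute sum_bool algebra_simps)
qed

lemma cap_cup_right: "i \<le> j \<Longrightarrow> cap (Suc (Suc j)) * cup i = cup i * cap j"
  by (rule linop_eqI) (simp add: app_cup app_cap pair_commute sum_distrib_left ac_simps)

lemma cap_cup_left: "i \<le> j \<Longrightarrow> cap i * cup (Suc (Suc j)) = cup j * cap i"
  by (rule linop_eqI) (simp add: app_cup app_cap pair_commute sum_distrib_left ac_simps)

lemma cap_cup_assoc:
  "cap i * (cup i * T) = scalar d * T" "cap i * (cup (Suc i) * T) = T" "cap (Suc i) * (cup i * T) = T"
  by (simp_all add: mult.assoc[symmetric] cap_cup cap_cup_Suc cap_Suc_cup)

lemma hook_hook: "hook i * hook i = scalar d * hook i"
  by (simp add: hook_def mult.assoc cap_cup_assoc scalar_left_commute)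

lemma hook_snake: "hook i * (hook (Suc i) * hook i) = hook i" "hook (Suc i) * (hook i * hook (Suc i)) = hook (Suc i)"
  by (simp_all add: hook_def mult.assoc cap_cup_assoc)

lemma hook_commute:
  assumes "i + 2 \<le> j"
  shows "hook i * hook j = hook j * hook i"
proof -
  obtain j' where j: "j = Suc (Suc j')" "i \<le> j'"
    using assms by (metis add_2_eq_Suc' le_Suc_ex add_Suc add_Suc_right le_add1)
  have "hook i * hook j = cup i * (cap i * cup j) * cap j" by (simp add: hook_def mult.assoc)
  also have "\<dots> = cup i * (cup j' * cap i) * cap j" by (simp only: j cap_cup_left[OF j(2)])
  also have "\<dots> = (cup i * cup j') * (cap i * cap j)" by (simp add: mult.assoc)
  also have "\<dots> = (cup j * cup i) * (cap j' * cap i)"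
    by (simp only: j(1) cup_cup[OF j(2)] cap_cap[OF j(2)])
  also have "\<dots> = cup j * (cup i * cap j') * cap i" by (simp add: mult.assoc)
  also have "\<dots> = cup j * (cap j * cup i) * cap i" by (simp only: j cap_cup_right[OF j(2)])
  also have "\<dots> = hook j * hook i" by (simp add: hook_def mult.assoc)
  finally show ?thesis .
qed

lemma local_op_hook: "local_op (Suc i) (hook i)"
  unfolding local_op_def
proof (intro allI impI conjI; rule linop_eqI)
  fix p :: nat and b :: bool and \<phi> s assume p: "p > Suc i"
  then have "s(p := b, i := b1, Suc i := c1) = s(i := b1, Suc i := c1, p := b)" for b1 c1
    by (auto simp: fun_eq_iff)
  with p show "app (hook i * subst_op p b) \<phi> s = app (subst_op p b * hook i) \<phi> s"
    by (simp add: app_hook)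
  from p show "app (hook i * proj_op p b) \<phi> s = app (proj_op p b * hook i) \<phi> s"
    by (simp add: app_hook)
qed

text \<open>\<open>app T (delta s) s\<close> is a diagonal entry of the matrix of \<open>T\<close>.
  Only the strands beyond \<open>k\<close> are closed; the first \<open>k\<close> are cut open, with
  empty places at both ends.\<close>

definition trace :: "nat \<Rightarrow> nat \<Rightarrow> 'a linop \<Rightarrow> 'a" where
  "trace k M T = (\<Sum>s\<in>configs k M. (\<Prod>p\<in>{k<..M}. \<mu> (s p)) * app T (delta s) s)"

lemma trace_add: "trace k M (S + T) = trace k M S + trace k M T"
  and trace_diff: "trace k M (S - T) = trace k M S - trace k M T"
  and trace_scalar: "trace k M (scalar c * S) = c * trace k M S"
  and trace_zero: "trace k M 0 = 0"
  by (simp_all add: trace_def algebra_simps sum.distrib sum_subtractf sum_distrib_left)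

text \<open>The restriction of \<open>T\<close> to the value \<open>b\<close> of the last strand is
  itself written as a product of operators, so that locality can be used as a commutation
  rule.\<close>

lemma trace_Suc:
  assumes "k \<le> M"
  shows "trace k (Suc M) T = (\<Sum>s\<in>configs k M. (\<Prod>p\<in>{k<..M}. \<mu> (s p)) *
      (\<Sum>b\<in>UNIV. \<mu> b * app (subst_op (Suc M) b * T * (proj_op (Suc M) b * subst_op (Suc M) False)) (delta s) s))"
proof -
  have iv: "{k<..Suc M} = insert (Suc M) {k<..M}" using assms by auto
  have d: "app (proj_op (Suc M) b) (app (subst_op (Suc M) False) (delta s)) = (delta (s(Suc M := b)) :: _ \<Rightarrow> 'a)"
    if "s \<in> configs k M" for s b
  proof -
    have s: "s(Suc M := False) = s" using that by (auto simp: configs_def fun_eq_iff)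
    have "t = s(Suc M := b) \<longleftrightarrow> t (Suc M) = b \<and> t(Suc M := False) = s" for t
    proof
      assume "t = s(Suc M := b)"
      then show "t (Suc M) = b \<and> t(Suc M := False) = s" using s by simp
    next
      assume "t (Suc M) = b \<and> t(Suc M := False) = s"
      then have "s(Suc M := b) = t(Suc M := False, Suc M := t (Suc M))" by simp
      then show "t = s(Suc M := b)" by simp
    qed
    then show ?thesis by (intro ext) (simp add: delta_def)
  qed
  show ?thesis
    unfolding trace_def sum_configs_Suc[OF assms]
    by (intro sum.cong refl) (simp add: iv d sum_distrib_left mult.assoc mult.left_commute)
qed

lemma trace_free:
  assumes "k \<le> M" "local_op M T"
  shows "trace k (Suc M) T = d * trace k M T"
proof -
  have "subst_op (Suc M) b * (T * (proj_op (Suc M) b * subst_op (Suc M) False)) = subst_op (Suc M) False * T" for b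
  proof -
    have "subst_op (Suc M) b * (proj_op (Suc M) b * subst_op (Suc M) False) = (subst_op (Suc M) False :: 'a linop)"
      by (rule linop_eqI) simp
    then have "T * (subst_op (Suc M) b * (proj_op (Suc M) b * subst_op (Suc M) False)) = T * subst_op (Suc M) False" by simp
    then show ?thesis using assms(2) unfolding local_op_def
      by (metis lessI mult.assoc)
  qed
  then have "trace k (Suc M) T = (\<Sum>s\<in>configs k M. (\<Prod>p\<in>{k<..M}. \<mu> (s p)) *
      (\<Sum>b\<in>UNIV. \<mu> b * app T (delta s) (s(Suc M := False))))"
    unfolding trace_Suc[OF assms(1)] mult.assoc by (simp del: app_simps(6)) (simp add: app_simps)
  also have "\<dots> = (\<Sum>s\<in>configs k M. d * ((\<Prod>p\<in>{k<..M}. \<mu> (s p)) * app T (delta s) s))"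
  proof (intro sum.cong refl)
    fix s assume "s \<in> configs k M"
    then have "s(Suc M := False) = s" by (auto simp: configs_def fun_eq_iff)
    then show "(\<Prod>p\<in>{k<..M}. \<mu> (s p)) * (\<Sum>b\<in>UNIV. \<mu> b * app T (delta s) (s(Suc M := False)))
        = d * ((\<Prod>p\<in>{k<..M}. \<mu> (s p)) * app T (delta s) s)"
      by (simp add: sum_distrib_right[symmetric] sum_\<mu> ac_simps)
  qed
  finally show ?thesis by (simp add: trace_def sum_distrib_left)
qed

text \<open>The outer factors do not touch the last strand and leave the sum over its value. What
  remains is the hook with its right strand closed, which \<open>partial\<close> turns into a
  straight strand.\<close>

lemma trace_markov:
  assumes "k \<le> M" "local_op M S" "local_op M T"
  shows "trace k (Suc M) (S * hook M * T) = trace k M (S * T)"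
proof -
  define X where "X b = subst_op (Suc M) b * hook M * (proj_op (Suc M) b * subst_op (Suc M) False)" for b
  have "scalar (\<mu> False) * X False + scalar (\<mu> True) * X True = subst_op (Suc M) False"
  proof (rule linop_eqI)
    fix \<phi> s
    have X: "app (X b) \<phi> s = (\<Sum>c\<in>UNIV. f (s M) b * g c b * \<phi> (s(M := c, Suc M := False)))" for b
      by (cases b) (simp_all add: X_def app_hook sum_bool algebra_simps)
    have "app (scalar (\<mu> False) * X False + scalar (\<mu> True) * X True) \<phi> s
        = (\<Sum>c\<in>UNIV. (\<Sum>b\<in>UNIV. \<mu> b * f (s M) b * g c b) * \<phi> (s(M := c, Suc M := False)))"
      by (simp add: X sum_bool algebra_simps)
    also have "\<dots> = app (subst_op (Suc M) False) \<phi> s"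
      by (cases "s M") (simp_all add: partial sum_bool fun_upd_idem)
    finally show "app (scalar (\<mu> False) * X False + scalar (\<mu> True) * X True) \<phi> s
        = app (subst_op (Suc M) False) \<phi> s" .
  qed
  then have "S * (scalar (\<mu> False) * X False + scalar (\<mu> True) * X True) * T = subst_op (Suc M) False * (S * T)"
    using assms(2,3) by (simp add: local_op_def mult.assoc[symmetric])
  then have X: "scalar (\<mu> False) * (S * X False * T) + scalar (\<mu> True) * (S * X True * T)
      = subst_op (Suc M) False * (S * T)"
    by (simp add: distrib_left distrib_right mult.assoc scalar_left_commute)
  have comm: "subst_op (Suc M) b * (S * hook M * T) * (proj_op (Suc M) b * subst_op (Suc M) False) = S * X b * T" for b
  proof -
    have c: "subst_op (Suc M) b * S = S * subst_op (Suc M) b" "T * proj_op (Suc M) b = proj_op (Suc M) b * T"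
      "T * subst_op (Suc M) False = subst_op (Suc M) False * T"
      using assms(2,3) by (simp_all add: local_op_def)
    have "subst_op (Suc M) b * (S * hook M * T) * (proj_op (Suc M) b * subst_op (Suc M) False)
        = (subst_op (Suc M) b * S) * hook M * (T * proj_op (Suc M) b) * subst_op (Suc M) False"
      by (simp only: mult.assoc)
    also have "\<dots> = S * subst_op (Suc M) b * hook M * proj_op (Suc M) b * (T * subst_op (Suc M) False)"
      unfolding c(1,2) by (simp only: mult.assoc)
    also have "\<dots> = S * X b * T"
      unfolding c(3) X_def by (simp only: mult.assoc)
    finally show ?thesis .
  qed
  have "(\<Sum>b\<in>UNIV. \<mu> b * app (S * X b * T) \<phi> s) = app (S * T) \<phi> (s(Suc M := False))" for \<phi> s
  proof -
    have "(\<Sum>b\<in>UNIV. \<mu> b * app (S * X b * T) \<phi> s)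
        = app (scalar (\<mu> False) * (S * X False * T) + scalar (\<mu> True) * (S * X True * T)) \<phi> s"
      by (simp add: sum_bool)
    then show ?thesis unfolding X by simp
  qed
  then have "trace k (Suc M) (S * hook M * T) = (\<Sum>s\<in>configs k M. (\<Prod>p\<in>{k<..M}. \<mu> (s p)) *
      app (S * T) (delta s) (s(Suc M := False)))"
    by (simp only: trace_Suc[OF assms(1)] comm)
  also have "\<dots> = trace k M (S * T)"
    unfolding trace_def
  proof (intro sum.cong refl)
    fix s assume "s \<in> configs k M"
    then have "s(Suc M := False) = s" by (auto simp: configs_def fun_eq_iff)
    then show "(\<Prod>p\<in>{k<..M}. \<mu> (s p)) * app (S * T) (delta s) (s(Suc M := False))
        = (\<Prod>p\<in>{k<..M}. \<mu> (s p)) * app (S * T) (delta s) s" by simp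
  qed
  finally show ?thesis .
qed

lemma prod_insert_pair:
  assumes "1 \<le> i" "i \<le> Suc M"
  shows "(\<Prod>p\<in>{0<..Suc (Suc M)}. \<mu> (insert_pair i b c s p)) = \<mu> b * \<mu> c * (\<Prod>p\<in>{0<..M}. \<mu> (s p))"
proof -
  have "(\<Prod>p\<in>{0<..Suc (Suc M)}. \<mu> (insert_pair i b c s p))
      = (\<Prod>p\<in>{i, Suc i} \<union> ({0<..Suc (Suc M)} - {i, Suc i}). \<mu> (insert_pair i b c s p))"
    using assms by (intro prod.cong) auto
  also have "\<dots> = \<mu> b * \<mu> c * (\<Prod>p\<in>{0<..Suc (Suc M)} - {i, Suc i}. \<mu> (insert_pair i b c s p))"
    by (subst prod.union_disjoint) auto
  also have "(\<Prod>p\<in>{0<..Suc (Suc M)} - {i, Suc i}. \<mu> (insert_pair i b c s p)) = (\<Prod>p\<in>{0<..M}. \<mu> (s p))"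
  proof (rule prod.reindex_bij_witness[where i = "\<lambda>p. if p < i then p else Suc (Suc p)" and j = "\<lambda>p. if p < i then p else p - 2"])
    fix p assume "p \<in> {0<..Suc (Suc M)} - {i, Suc i}"
    then consider "0 < p" "p < i" | q where "p = Suc (Suc q)" "i \<le> q" "q \<le> M"
      by (cases rule: pair_position_cases[of p i]) auto
    note cs = this
    from cs show "(if (if p < i then p else p - 2) < i then if p < i then p else p - 2
         else Suc (Suc (if p < i then p else p - 2))) = p" by cases auto
    from cs assms show "(if p < i then p else p - 2) \<in> {0<..M}" by cases auto
    from cs show "\<mu> (s (if p < i then p else p - 2)) = \<mu> (insert_pair i b c s p)" by cases auto
  next
    fix p assume "p \<in> {0<..M}"
    then show "(if p < i then p else Suc (Suc p)) \<in> {0<..Suc (Suc M)} - {i, Suc i}"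
      using assms by auto
  qed auto
  finally show ?thesis .
qed

lemma insert_pair_eq_iff:
  "t = insert_pair i b c s \<longleftrightarrow> delete_pair i t = s \<and> t i = b \<and> t (Suc i) = c"
proof
  assume "delete_pair i t = s \<and> t i = b \<and> t (Suc i) = c"
  then have "insert_pair i b c s = insert_pair i (t i) (t (Suc i)) (delete_pair i t)" by simp
  also have "\<dots> = t" by (simp only: insert_pair_simps(8) fun_upd_triv)
  finally show "t = insert_pair i b c s" by simp
qed auto

lemma cup_delta: "app (cup i) (delta s) = (\<lambda>t. \<Sum>b\<in>UNIV. \<Sum>c\<in>UNIV. f b c * delta (insert_pair i b c s) t)"
proof
  fix t
  show "app (cup i) (delta s) t = (\<Sum>b\<in>UNIV. \<Sum>c\<in>UNIV. f b c * delta (insert_pair i b c s) t)"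
    unfolding app_cup delta_def insert_pair_eq_iff
    by (cases "t i"; cases "t (Suc i)") (simp_all add: sum_bool)
qed

lemma sum_configs_insert_pair:
  assumes "1 \<le> i" "i \<le> Suc M"
  shows "(\<Sum>s\<in>configs 0 (Suc (Suc M)). F s) = (\<Sum>s\<in>configs 0 M. \<Sum>b\<in>UNIV. \<Sum>c\<in>UNIV. F (insert_pair i b c s))"
proof -
  have "(\<Sum>s\<in>configs 0 (Suc (Suc M)). F s) = (\<Sum>(s, b, c)\<in>configs 0 M \<times> UNIV \<times> UNIV. F (insert_pair i b c s))"
  proof (rule sum.reindex_bij_witness[where i = "\<lambda>(s, b, c). insert_pair i b c s" and j = "\<lambda>s. (delete_pair i s, s i, s (Suc i))"])
    fix s assume s: "s \<in> configs 0 (Suc (Suc M))"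
    then show "(delete_pair i s, s i, s (Suc i)) \<in> configs 0 M \<times> UNIV \<times> UNIV"
      using assms by (fastforce simp: configs_def delete_pair_def split: if_splits)
  next
    fix x :: "config \<times> bool \<times> bool" assume "x \<in> configs 0 M \<times> UNIV \<times> UNIV"
    then obtain s b c where x: "x = (s, b, c)" "s \<in> configs 0 M" by auto
    have "0 < p \<and> p \<le> Suc (Suc M)" if "insert_pair i b c s p" for p
      using that assms x(2) by (cases rule: pair_position_cases[of p i]) (auto simp: configs_def)
    then show "(case x of (s, b, c) \<Rightarrow> insert_pair i b c s) \<in> configs 0 (Suc (Suc M))"
      by (simp add: x configs_def)
  qed auto
  then show ?thesis by (simp add: sum.cartesian_product)
qed

text \<open>A trace property between different numbers of strands: a cup leaves at the top and
  returns at the bottom. The closure weights of its two feet disappear by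
  \<open>balanced\<close>.\<close>

lemma trace_cup:
  assumes "1 \<le> i" "i \<le> Suc M"
  shows "trace 0 (Suc (Suc M)) (cup i * T) = trace 0 M (T * cup i)"
proof -
  define W where "W s = (\<Prod>p\<in>{0<..M}. \<mu> (s p))" for s
  have "trace 0 (Suc (Suc M)) (cup i * T) = (\<Sum>s\<in>configs 0 M. \<Sum>b\<in>UNIV. \<Sum>c\<in>UNIV.
      \<mu> b * \<mu> c * W s * (f b c * app T (delta (insert_pair i b c s)) s))"
    unfolding trace_def sum_configs_insert_pair[OF assms] prod_insert_pair[OF assms]
    by (simp add: app_cup W_def)
  also have "\<dots> = (\<Sum>s\<in>configs 0 M. \<Sum>b\<in>UNIV. \<Sum>c\<in>UNIV.
      W s * (f b c * app T (delta (insert_pair i b c s)) s))"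
  proof (intro sum.cong refl)
    fix s b c
    have "\<mu> b * \<mu> c * W s * (f b c * app T (delta (insert_pair i b c s)) s)
        = W s * ((\<mu> b * \<mu> c * f b c) * app T (delta (insert_pair i b c s)) s)"
      by (simp add: ac_simps)
    then show "\<mu> b * \<mu> c * W s * (f b c * app T (delta (insert_pair i b c s)) s)
        = W s * (f b c * app T (delta (insert_pair i b c s)) s)"
      by (simp only: balanced)
  qed
  also have "\<dots> = (\<Sum>s\<in>configs 0 M. W s * app T (app (cup i) (delta s)) s)"
    by (simp add: cup_delta app_sum app_mult sum_distrib_left)
  finally show ?thesis by (simp add: trace_def W_def)
qed

end

section \<open>Uniqueness of Markov traces on Temperley-Lieb words\<close>

text \<open>The scalars in the Temperley-Lieb relations are dropped: a step only records that a
  Markov trace of the left word is determined by that of the right word.\<close>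

inductive tl_step :: "nat list \<Rightarrow> nat list \<Rightarrow> bool" where
  idem: "tl_step (u @ [i, i] @ v) (u @ [i] @ v)"
| snake: "i = Suc j \<or> j = Suc i \<Longrightarrow> tl_step (u @ [i, j, i] @ v) (u @ [i] @ v)"
| comm: "i + 2 \<le> j \<or> j + 2 \<le> i \<Longrightarrow> tl_step (u @ [i, j] @ v) (u @ [j, i] @ v)"

abbreviation tl_steps :: "nat list \<Rightarrow> nat list \<Rightarrow> bool" where
  "tl_steps \<equiv> tl_step\<^sup>*\<^sup>*"

lemma tl_step_context: "tl_step u v \<Longrightarrow> tl_step (a @ u @ b) (a @ v @ b)"
proof (induction rule: tl_step.induct)
  case (idem u i v)
  then show ?case using tl_step.idem[of "a @ u" i "v @ b"] by simp
next
  case (snake i j u v)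
  then show ?case using tl_step.snake[of i j "a @ u" "v @ b"] by simp
next
  case (comm i j u v)
  then show ?case using tl_step.comm[of i j "a @ u" "v @ b"] by simp
qed

lemma tl_steps_context: "tl_steps u v \<Longrightarrow> tl_steps (a @ u @ b) (a @ v @ b)"
  by (induction rule: rtranclp_induct) (auto intro: rtranclp.rtrancl_into_rtrancl tl_step_context)

lemma tl_steps_set: "tl_steps u v \<Longrightarrow> set v \<subseteq> set u"
  by (induction rule: rtranclp_induct) (auto elim!: tl_step.cases)

lemma tl_steps_commute:
  assumes "\<forall>i\<in>set b. i + 2 \<le> p"
  shows "tl_steps (p # b) (b @ [p]) \<and> tl_steps (b @ [p]) (p # b)"
  using assms
proof (induction b)
  case (Cons i b)
  have "tl_steps (p # i # b) (i # p # b)"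
    using tl_step.comm[of p i "[]" b] Cons.prems by auto
  moreover have "tl_steps (i # p # b) (i # b @ [p])"
    using tl_steps_context[of "p # b" "b @ [p]" "[i]" "[]"] Cons.IH Cons.prems by simp
  ultimately have 1: "tl_steps (p # i # b) ((i # b) @ [p])" by simp
  have "tl_steps (i # p # b) (p # i # b)"
    using tl_step.comm[of i p "[]" b] Cons.prems by auto
  moreover have "tl_steps (i # b @ [p]) (i # p # b)"
    using tl_steps_context[of "b @ [p]" "p # b" "[i]" "[]"] Cons.IH Cons.prems by simp
  ultimately have "tl_steps ((i # b) @ [p]) (p # i # b)" by simp
  with 1 show ?case by blast
qed simp_all

text \<open>The reduction behind Jones' normal form. Between two consecutive letters
  \<open>Suc p\<close> the outer induction leaves at most one \<open>p\<close>, and all smaller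
  letters commute with \<open>Suc p\<close>; hence \<open>idem\<close> or \<open>snake\<close>
  removes one of the two. The bound on the length keeps the inner induction, on the length of the
  word, alive.\<close>

lemma tl_steps_collapse:
  "set u \<subseteq> {..p} \<Longrightarrow> \<exists>v. tl_steps u v \<and> length v \<le> length u \<and> count_list v p \<le> 1"
proof (induction p arbitrary: u)
  case 0
  have "\<exists>v. tl_steps u v \<and> length v \<le> length u \<and> count_list v 0 \<le> 1" if "set u \<subseteq> {0}" for u
    using that
  proof (induction u rule: length_induct)
    case (1 u)
    show ?case
    proof (cases "length u \<le> 1")
      case True
      then show ?thesis using count_le_length[of u 0] by (intro exI[of _ u]) auto
    next
      case False
      then obtain x y w where u: "u = x # y # w"
        by (cases u; cases "List.tl u") auto
      with 1(2) have "x = 0" "y = 0" by auto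
      with u have "tl_step u (0 # w)" using tl_step.idem[of "[]" 0 w] by simp
      moreover obtain v where "tl_steps (0 # w) v" "length v \<le> length (0 # w)" "count_list v 0 \<le> 1"
        using 1(1)[rule_format, of "0 # w"] 1(2) u by auto
      ultimately show ?thesis using u
        by (intro exI[of _ v]) (auto intro: converse_rtranclp_into_rtranclp)
    qed
  qed
  then show ?case using 0 by auto
next
  case (Suc p)
  show ?case using Suc.prems
  proof (induction u rule: length_induct)
    case (1 u)
    show ?case
    proof (cases "count_list u (Suc p) \<le> 1")
      case True
      then show ?thesis by blast
    next
      case False
      then have "Suc p \<in> set u" by (metis count_list_0_iff le_numeral_extra(3) nle_le zero_le)
      then obtain a u' where u: "u = a @ Suc p # u'" "Suc p \<notin> set a" by (meson split_list_first)
      then have "count_list u' (Suc p) \<noteq> 0" using False by (auto simp: count_list_0_iff)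
      then have "Suc p \<in> set u'" by (metis count_list_0_iff)
      then obtain b c where u': "u' = b @ Suc p # c" "Suc p \<notin> set b" by (meson split_list_first)
      have b: "set b \<subseteq> {..p}"
        using 1(2) u'(2) unfolding u u' by (auto simp: le_Suc_eq)
      then obtain b' where b': "tl_steps b b'" "length b' \<le> length b" "count_list b' p \<le> 1"
        using Suc.IH by blast
      have sb': "set b' \<subseteq> {..p}" using tl_steps_set[OF b'(1)] b by blast
      have "tl_steps ([Suc p] @ b @ [Suc p]) ([Suc p] @ b' @ [Suc p])"
        by (rule tl_steps_context[OF b'(1)])
      moreover have "\<exists>w. tl_steps ([Suc p] @ b' @ [Suc p]) w \<and> length w < length b' + 2"
      proof (cases "p \<in> set b'")
        case False
        then have "\<forall>i\<in>set b'. i + 2 \<le> Suc p" using sb' by (force simp: le_less)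
        from tl_steps_commute[OF this]
        have "tl_steps ([Suc p] @ b' @ [Suc p]) (b' @ [Suc p, Suc p])"
          using tl_steps_context[of "Suc p # b'" "b' @ [Suc p]" "[]" "[Suc p]"] by simp
        moreover have "tl_step (b' @ [Suc p, Suc p]) (b' @ [Suc p])"
          using tl_step.idem[of b' "Suc p" "[]"] by simp
        ultimately have "tl_steps ([Suc p] @ b' @ [Suc p]) (b' @ [Suc p])" by simp
        then show ?thesis by (intro exI[of _ "b' @ [Suc p]"]) simp
      next
        case True
        then obtain b1 b2 where b12: "b' = b1 @ p # b2" by (meson split_list)
        with b'(3) have "p \<notin> set b1" "p \<notin> set b2" by (auto simp: count_list_0_iff[symmetric])
        then have c: "\<forall>i\<in>set b1. i + 2 \<le> Suc p" "\<forall>i\<in>set b2. i + 2 \<le> Suc p"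
          using sb' b12 by (force simp: le_less)+
        have "tl_steps ([Suc p] @ b' @ [Suc p]) (b1 @ [Suc p, p] @ b2 @ [Suc p])"
          using tl_steps_context[OF tl_steps_commute[OF c(1), THEN conjunct1], of "[]" "p # b2 @ [Suc p]"] b12 by simp
        also have "tl_steps \<dots> (b1 @ [Suc p, p, Suc p] @ b2)"
          using tl_steps_context[OF tl_steps_commute[OF c(2), THEN conjunct2], of "b1 @ [Suc p, p]" "[]"] by simp
        also have "tl_step \<dots> (b1 @ [Suc p] @ b2)"
          using tl_step.snake[of "Suc p" p b1 b2] by simp
        finally show ?thesis using b12 by (intro exI[of _ "b1 @ [Suc p] @ b2"]) simp
      qed
      ultimately obtain w where w: "tl_steps ([Suc p] @ b @ [Suc p]) w" "length w < length b + 2"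
        using b'(2) by (meson le_trans less_le_trans add_le_mono1 rtranclp_trans)
      have st: "tl_steps u (a @ w @ c)"
        using tl_steps_context[OF w(1), of a c] by (simp add: u u')
      have len: "length (a @ w @ c) < length u" using w(2) by (simp add: u u')
      then obtain v where "tl_steps (a @ w @ c) v" "length v \<le> length (a @ w @ c)" "count_list v (Suc p) \<le> 1"
        using 1(1)[rule_format, OF len] subset_trans[OF tl_steps_set[OF st] 1(2)] by auto
      then show ?thesis using st len by (intro exI[of _ v]) (auto intro: rtranclp_trans)
    qed
  qed
qed

text \<open>
  The trace property is required from \<open>k\<close> strands on only, so that \<open>F\<close> may involve a fixed operator
  on the first \<open>k\<close> strands.
\<close>

definition markov_trace :: "nat \<Rightarrow> 'a::comm_ring_1 \<Rightarrow> (nat \<Rightarrow> nat list \<Rightarrow> 'a) \<Rightarrow> bool" where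
  "markov_trace k d F \<longleftrightarrow>
     (\<forall>M u. k \<le> M \<longrightarrow> set u \<subseteq> {1..<M} \<longrightarrow> F (Suc M) u = d * F M u) \<and>
     (\<forall>M u v. k \<le> M \<longrightarrow> 1 \<le> M \<longrightarrow> set (u @ v) \<subseteq> {1..<M} \<longrightarrow> F (Suc M) (u @ [M] @ v) = F M (u @ v)) \<and>
     (\<forall>M u v i. set (u @ [i] @ v) \<subseteq> {1..<M} \<longrightarrow> F M (u @ [i, i] @ v) = d * F M (u @ [i] @ v)) \<and>
     (\<forall>M u v i j. i = Suc j \<or> j = Suc i \<longrightarrow> set (u @ [i, j] @ v) \<subseteq> {1..<M} \<longrightarrow>
        F M (u @ [i, j, i] @ v) = F M (u @ [i] @ v)) \<and>
     (\<forall>M u v i j. i + 2 \<le> j \<or> j + 2 \<le> i \<longrightarrow> set (u @ [i, j] @ v) \<subseteq> {1..<M} \<longrightarrow>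
        F M (u @ [i, j] @ v) = F M (u @ [j, i] @ v))"

lemma markov_trace_step:
  assumes "markov_trace k d F" "markov_trace k d G" "tl_step u v" "set u \<subseteq> {1..<M}" "F M v = G M v"
  shows "F M u = G M u"
  using assms(3,4,5)
proof (induction rule: tl_step.induct)
  case (idem u i v)
  then have "set (u @ [i] @ v) \<subseteq> {1..<M}" by simp
  then show ?case using assms(1,2) idem unfolding markov_trace_def by metis
next
  case (snake i j u v)
  then have "set (u @ [i, j] @ v) \<subseteq> {1..<M}" by auto
  then show ?case using assms(1,2) snake unfolding markov_trace_def by metis
next
  case (comm i j u v)
  then have "set (u @ [i, j] @ v) \<subseteq> {1..<M}" by auto
  then show ?case using assms(1,2) comm unfolding markov_trace_def by metis
qed

lemma markov_trace_steps:
  assumes "markov_trace k d F" "markov_trace k d G" "tl_steps u v" "set u \<subseteq> {1..<M}" "F M v = G M v"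
  shows "F M u = G M u"
  using assms(3,4)
proof (induction rule: converse_rtranclp_induct)
  case base
  then show ?case using assms(5) by simp
next
  case (step y z)
  then have "set z \<subseteq> {1..<M}" using tl_steps_set[of y z] by blast
  with step show ?case using markov_trace_step[OF assms(1,2)] by blast
qed

text \<open>Once the last letter occurs at most once, the last strand can be removed: as a free loop
  if the letter is absent, by the Markov property otherwise. The descent stops at \<open>k\<close>
  strands, where agreement is an assumption.\<close>

theorem markov_trace_unique:
  assumes F: "markov_trace k d F" and G: "markov_trace k d G"
    and base: "\<And>u. set u \<subseteq> {1..<k} \<Longrightarrow> F k u = G k u"
    and "k \<le> M" "set u \<subseteq> {1..<M}"
  shows "F M u = G M u"
  using assms(4,5)
proof (induction M arbitrary: u rule: dec_induct)
  case base
  then show ?case using assms(3) by blast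
next
  case (step M)
  have "set u \<subseteq> {..M}" using step.prems by auto
  then obtain v where v: "tl_steps u v" "count_list v M \<le> 1" using tl_steps_collapse by blast
  have sv: "set v \<subseteq> {1..<Suc M}" using tl_steps_set[OF v(1)] step.prems by blast
  have "F (Suc M) v = G (Suc M) v"
  proof (cases "M \<in> set v")
    case False
    then have "set v \<subseteq> {1..<M}" using sv by (auto simp: less_Suc_eq)
    then show ?thesis using F G step.IH step.hyps(1) unfolding markov_trace_def by metis
  next
    case True
    then obtain a b where ab: "v = a @ [M] @ b" by (metis append_Cons append_Nil split_list)
    with v(2) have "M \<notin> set a" "M \<notin> set b" by (auto simp: count_list_0_iff[symmetric])
    then have "set (a @ b) \<subseteq> {1..<M}" using sv ab by (auto simp: less_Suc_eq)
    moreover have "1 \<le> M" using True sv by auto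
    ultimately show ?thesis using F G step.IH step.hyps(1) unfolding markov_trace_def ab by metis
  qed
  then show ?case using markov_trace_steps[OF F G v(1) step.prems] by blast
qed

context tl_rep
begin

definition hook_word :: "nat list \<Rightarrow> 'a linop" where
  "hook_word u = prod_list (map hook u)"

lemma hook_word_simps [simp]:
  "hook_word [] = 1" "hook_word (i # u) = hook i * hook_word u"
  "hook_word (u @ v) = hook_word u * hook_word v"
  by (simp_all add: hook_word_def)

lemma local_op_hook_less: "i < M \<Longrightarrow> local_op M (hook i)"
  using local_op_hook local_op_mono by (metis Suc_leI)

lemma local_op_hook_word: "set u \<subseteq> {1..<M} \<Longrightarrow> local_op M (hook_word u)"
  by (induction u) (auto intro: local_op_one local_op_mult local_op_hook_less)

text \<open>Besides the plain trace there are two uses: \<open>l = 0\<close> with \<open>T\<close> a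
  projector on \<open>k\<close> strands, and \<open>l = k\<close> with \<open>T = 1\<close>, the
  trace that is cut open.\<close>

lemma markov_trace_hooks:
  assumes "local_op k T" "l \<le> k"
  shows "markov_trace k d (\<lambda>M u. trace l M (hook_word u * T))"
  unfolding markov_trace_def
proof (intro conjI allI impI)
  fix M u assume "k \<le> M" "set u \<subseteq> {1..<M}"
  then have "local_op M (hook_word u * T)"
    using assms local_op_mono local_op_hook_word by (intro local_op_mult) auto
  then show "trace l (Suc M) (hook_word u * T) = d * trace l M (hook_word u * T)"
    using assms \<open>k \<le> M\<close> by (intro trace_free) auto
next
  fix M u v assume M: "k \<le> M" "1 \<le> M" "set (u @ v) \<subseteq> {1..<M}"
  have "local_op M (hook_word u)" "local_op M (hook_word v * T)"
    using assms local_op_mono M by (auto intro!: local_op_mult local_op_hook_word)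
  then have "trace l (Suc M) (hook_word u * hook M * (hook_word v * T)) = trace l M (hook_word u * (hook_word v * T))"
    using assms M by (intro trace_markov) auto
  then show "trace l (Suc M) (hook_word (u @ [M] @ v) * T) = trace l M (hook_word (u @ v) * T)"
    by (simp add: mult.assoc)
next
  fix M u v i
  have "hook_word (u @ [i, i] @ v) * T = hook_word u * (hook i * hook i) * hook_word v * T" by (simp add: mult.assoc)
  also have "\<dots> = scalar d * (hook_word (u @ [i] @ v) * T)"
    by (simp add: hook_hook mult.assoc scalar_left_commute)
  finally show "trace l M (hook_word (u @ [i, i] @ v) * T) = d * trace l M (hook_word (u @ [i] @ v) * T)"
    by (simp only: trace_scalar)
next
  fix M u v and i j :: nat assume "i = Suc j \<or> j = Suc i"
  then have "hook i * (hook j * hook i) = hook i" using hook_snake by blast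
  then have "hook_word u * (hook i * (hook j * hook i)) * hook_word v * T = hook_word u * hook i * hook_word v * T" by simp
  then show "trace l M (hook_word (u @ [i, j, i] @ v) * T) = trace l M (hook_word (u @ [i] @ v) * T)"
    by (simp add: mult.assoc)
next
  fix M u v and i j :: nat assume "i + 2 \<le> j \<or> j + 2 \<le> i"
  then have "hook i * hook j = hook j * hook i" using hook_commute by metis
  then have "hook_word u * (hook i * hook j) * hook_word v * T = hook_word u * (hook j * hook i) * hook_word v * T" by simp
  then show "trace l M (hook_word (u @ [i, j] @ v) * T) = trace l M (hook_word (u @ [j, i] @ v) * T)"
    by (simp add: mult.assoc)
qed

lemma trace_self: "trace k k T = app T (delta (\<lambda>p. False)) (\<lambda>p. False)"
  by (simp add: trace_def configs_self)

end

section \<open>Counting circles by two-colourings\<close>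

text \<open>A colouring that is constant along arcs is a choice of a set of components. This makes
  the number of components visible to linear algebra, as an exponent of 2.\<close>

lemma card_two_colourings:
  assumes "finite V" "E \<subseteq> V \<times> V"
  shows "card {l :: point \<Rightarrow> bool. (\<forall>x. l x \<longrightarrow> x \<in> V) \<and> (\<forall>(a, b)\<in>E. l a = l b)} = 2 ^ num_components V E"
    (is "card ?L = _")
proof -
  define R where "R = (E \<union> E\<inverse>)\<^sup>*"
  have equiv: "equiv UNIV R"
    unfolding R_def by (intro equivI refl_rtrancl sym_rtrancl trans_rtrancl sym_Un_converse) auto
  have RV: "y \<in> V" if "(x, y) \<in> R" "x \<in> V" for x y
    using that unfolding R_def by (induction rule: rtrancl_induct) (use assms(2) in auto)
  have cls: "c = R `` {x}" if "c \<in> V // R" "x \<in> c" for c x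
  proof -
    obtain y where "c = R `` {y}" using \<open>c \<in> V // R\<close> by (rule quotientE)
    then show ?thesis using equiv_class_eq[OF equiv, of y x] that(2) by blast
  qed
  have fin: "finite (V // R)" using assms(1) unfolding quotient_def by simp
  have "bij_betw (\<lambda>Q x. x \<in> \<Union> Q) (Pow (V // R)) ?L"
  proof (rule bij_betw_imageI)
    show "inj_on (\<lambda>Q x. x \<in> \<Union> Q) (Pow (V // R))"
    proof (rule inj_onI)
      fix Q Q' assume Q: "Q \<in> Pow (V // R)" "Q' \<in> Pow (V // R)" and eq: "(\<lambda>x. x \<in> \<Union> Q) = (\<lambda>x. x \<in> \<Union> Q')"
      have "A \<subseteq> B" if AB: "A \<in> Pow (V // R)" "B \<in> Pow (V // R)" "(\<lambda>x. x \<in> \<Union> A) = (\<lambda>x. x \<in> \<Union> B)" for A B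
      proof
        fix c assume c: "c \<in> A"
        then obtain x where x: "x \<in> V" "c = R `` {x}" using AB(1) by (auto elim!: quotientE)
        then have "x \<in> c" using equiv_class_self[OF equiv, of x] by simp
        then have "x \<in> \<Union> B" using c AB(3) by (metis UnionI)
        then obtain c' where "c' \<in> B" "x \<in> c'" by blast
        then have "c' = c" using cls x AB(2) by blast
        then show "c \<in> B" using \<open>c' \<in> B\<close> by simp
      qed
      then show "Q = Q'" using Q eq by (metis subset_antisym)
    qed
    show "(\<lambda>Q x. x \<in> \<Union> Q) ` Pow (V // R) = ?L"
    proof (intro subset_antisym subsetI)
      fix l assume "l \<in> (\<lambda>Q x. x \<in> \<Union> Q) ` Pow (V // R)"
      then obtain Q where Q: "Q \<subseteq> V // R" "l = (\<lambda>x. x \<in> \<Union> Q)" by auto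
      have 1: "x \<in> V" if "l x" for x
      proof -
        from that obtain c where c: "c \<in> V // R" "x \<in> c" using Q by auto
        from c(1) obtain y where "y \<in> V" "c = R `` {y}" by (rule quotientE)
        then show ?thesis using c(2) RV by blast
      qed
      have imp: "l y" if "l x" "(x, y) \<in> R" for x y
      proof -
        from that(1) obtain c where "c \<in> Q" "x \<in> c" using Q by auto
        then have "c = R `` {x}" using cls Q by blast
        then show ?thesis using that(2) \<open>c \<in> Q\<close> Q(2) by auto
      qed
      have "l a = l b" if "(a, b) \<in> E" for a b
        using imp[of a b] imp[of b a] that by (auto simp: R_def)
      then show "l \<in> ?L" using 1 by auto
    next
      fix l assume l: "l \<in> ?L"
      have imp: "l x = l y" if "(x, y) \<in> R" for x y
        using that unfolding R_def by (induction rule: rtrancl_induct) (use l in auto)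
      have "l = (\<lambda>x. x \<in> \<Union> ((\<lambda>x. R `` {x}) ` {x. l x}))"
      proof
        fix x
        have "x \<in> R `` {x}" using equiv_class_self[OF equiv, of x] by simp
        then show "l x = (x \<in> \<Union> ((\<lambda>x. R `` {x}) ` {x. l x}))" using imp by blast
      qed
      moreover have "(\<lambda>x. R `` {x}) ` {x. l x} \<in> Pow (V // R)"
        using l by (auto intro: quotientI)
      ultimately show "l \<in> (\<lambda>Q x. x \<in> \<Union> Q) ` Pow (V // R)" by blast
    qed
  qed
  then have "card ?L = card (Pow (V // R))" by (simp add: bij_betw_same_card)
  then show ?thesis using fin by (simp add: card_Pow num_components_def R_def)
qed

abbreviation same :: "bool \<Rightarrow> bool \<Rightarrow> int" where
  "same b c \<equiv> (if b = c then 1 else 0)"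

text \<open>Strands carry colours, which cups and caps must match. The traces turn out to be powers
  of 2 in the integers and so determine their exponents: relations between traces become statements
  about numbers of circles.\<close>

interpretation colour: tl_rep same same "\<lambda>b. 1" 2
  by unfold_locales (auto simp: sum_bool)

definition compatible :: "nat list \<Rightarrow> nat set \<Rightarrow> nat \<Rightarrow> config \<Rightarrow> config \<Rightarrow> bool" where
  "compatible w S t s s' \<longleftrightarrow> (if t \<in> S then s = s' else
     s (w ! t) = s (Suc (w ! t)) \<and> s' (w ! t) = s' (Suc (w ! t)) \<and> (\<forall>p. p \<notin> {w ! t, Suc (w ! t)} \<longrightarrow> s p = s' p))"

definition state_op :: "(nat \<Rightarrow> 'a::comm_ring_1 linop) \<Rightarrow> nat list \<Rightarrow> nat set \<Rightarrow> nat \<Rightarrow> 'a linop" where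
  "state_op h w S n = prod_list (map (\<lambda>t. if t \<in> S then 1 else h (w ! t)) [0..<n])"

lemma state_op_simps [simp]:
  "state_op h w S 0 = 1" "state_op h w S (Suc n) = state_op h w S n * (if n \<in> S then 1 else h (w ! n))"
  by (simp_all add: state_op_def)

text \<open>The closure is cut open: the rows at levels 0 and \<open>n\<close> are prescribed
  separately, and only the trace identifies them.\<close>

definition colourings :: "nat \<Rightarrow> nat list \<Rightarrow> nat set \<Rightarrow> nat \<Rightarrow> config \<Rightarrow> config \<Rightarrow> (point \<Rightarrow> bool) set" where
  "colourings M w S n s s' = {l. (\<forall>p t. l (p, t) \<longrightarrow> p \<in> {1..M} \<and> t \<le> n) \<and> (\<lambda>p. l (p, 0)) = s \<and> (\<lambda>p. l (p, n)) = s' \<and>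
     (\<forall>t<n. compatible w S t (\<lambda>p. l (p, t)) (\<lambda>p. l (p, Suc t)))}"

lemma finite_colourings: "finite (colourings M w S n s s')"
proof -
  have "colourings M w S n s s' \<subseteq> (\<lambda>A x. x \<in> A) ` Pow ({1..M} \<times> {..n})"
  proof
    fix l assume "l \<in> colourings M w S n s s'"
    then have "Collect l \<in> Pow ({1..M} \<times> {..n})" "l = (\<lambda>x. x \<in> Collect l)" by (auto simp: colourings_def)
    then show "l \<in> (\<lambda>A x. x \<in> A) ` Pow ({1..M} \<times> {..n})" by blast
  qed
  then show ?thesis by (rule finite_subset) auto
qed

lemma compatible_configs:
  assumes "compatible w S t s s'" "s' \<in> configs 0 M" "w ! t \<in> {1..<M}"
  shows "s \<in> configs 0 M"
  unfolding configs_def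
proof (intro CollectI allI impI)
  fix p assume "s p"
  then show "0 < p \<and> p \<le> M" using assms
    by (cases "p \<in> {w ! t, Suc (w ! t)}") (auto simp: compatible_def configs_def split: if_splits)
qed

lemma app_hook_delta:
  "app (if t \<in> S then 1 else colour.hook (w ! t)) (delta s') s = (if compatible w S t s s' then 1 else 0)"
proof (cases "t \<in> S")
  case True
  then show ?thesis by (simp add: compatible_def delta_def)
next
  case False
  have "(\<exists>b. s(w ! t := b, Suc (w ! t) := b) = s') \<longleftrightarrow>
      s' (w ! t) = s' (Suc (w ! t)) \<and> (\<forall>p. p \<notin> {w ! t, Suc (w ! t)} \<longrightarrow> s p = s' p)" (is "?l = ?r")
  proof
    assume ?r
    then have "s(w ! t := s' (w ! t), Suc (w ! t) := s' (w ! t)) = s'" by (auto simp: fun_eq_iff)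
    then show ?l by blast
  qed auto
  then have "compatible w S t s s' \<longleftrightarrow> s (w ! t) = s (Suc (w ! t)) \<and> (\<exists>b. s(w ! t := b, Suc (w ! t) := b) = s')"
    using False by (auto simp: compatible_def)
  moreover have "s(w ! t := True, Suc (w ! t) := True) \<noteq> s(w ! t := False, Suc (w ! t) := False)"
    by (metis fun_upd_same)
  ultimately show ?thesis
    using False by (auto simp: colour.app_hook sum_bool delta_def ex_bool_eq)
qed

lemma card_colourings_Suc:
  assumes "s' \<in> configs 0 M" "w ! n \<in> {1..<M}"
  shows "card (colourings M w S (Suc n) s s') =
    (\<Sum>s1\<in>{s1 \<in> configs 0 M. compatible w S n s1 s'}. card (colourings M w S n s s1))"
proof -
  define ext where "ext l = (\<lambda>(p, t). if t = Suc n then s' p else l (p, t))" for l :: "point \<Rightarrow> bool"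
  define C where "C = {s1 \<in> configs 0 M. compatible w S n s1 s'}"
  have "colourings M w S (Suc n) s s' = (\<Union>s1\<in>C. ext ` colourings M w S n s s1)"
  proof (intro subset_antisym subsetI)
    fix l assume l: "l \<in> colourings M w S (Suc n) s s'"
    define l0 where "l0 = (\<lambda>(p, t). t \<noteq> Suc n \<and> l (p, t))"
    define s1 where "s1 = (\<lambda>p. l (p, n))"
    have "compatible w S n s1 s'" using l by (auto simp: colourings_def s1_def)
    then have "s1 \<in> C" using compatible_configs assms by (auto simp: C_def)
    moreover have "l0 \<in> colourings M w S n s s1"
      using l by (auto simp: colourings_def l0_def s1_def le_Suc_eq)
    moreover have "ext l0 = l"
      using l by (auto simp: fun_eq_iff ext_def l0_def colourings_def)
    ultimately show "l \<in> (\<Union>s1\<in>C. ext ` colourings M w S n s s1)" by blast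
  next
    fix l assume "l \<in> (\<Union>s1\<in>C. ext ` colourings M w S n s s1)"
    then obtain s1 l0 where l: "s1 \<in> C" "l0 \<in> colourings M w S n s s1" "l = ext l0" by blast
    have "compatible w S t (\<lambda>p. l (p, t)) (\<lambda>p. l (p, Suc t))" if "t < Suc n" for t
      using that l by (cases "t = n") (auto simp: colourings_def ext_def C_def)
    then show "l \<in> colourings M w S (Suc n) s s'"
      using l assms by (auto simp: colourings_def ext_def configs_def le_SucI split: if_splits)
  qed
  moreover have "inj_on ext (colourings M w S n s s1)" for s1
  proof (rule inj_onI, rule ext)
    fix l l' x assume "l \<in> colourings M w S n s s1" "l' \<in> colourings M w S n s s1" and eq: "ext l = ext l'"
    then have "\<forall>p t. l (p, t) \<longrightarrow> t \<le> n" "\<forall>p t. l' (p, t) \<longrightarrow> t \<le> n"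
      by (simp_all add: colourings_def)
    then have "\<not> l (p, Suc n)" "\<not> l' (p, Suc n)" for p
      by (metis Suc_n_not_le_n)+
    then show "l x = l' x" using fun_cong[OF eq, of x] by (cases x) (auto simp: ext_def split: if_splits)
  qed
  moreover have "ext ` colourings M w S n s s1 \<inter> ext ` colourings M w S n s s2 = {}" if "s1 \<noteq> s2" for s1 s2
  proof -
    have row: "(\<lambda>p. ext l (p, n)) = s1" if "l \<in> colourings M w S n s s1" for l s1
      using that by (auto simp: colourings_def ext_def)
    have "ext l1 \<noteq> ext l2" if "l1 \<in> colourings M w S n s s1" "l2 \<in> colourings M w S n s s2" for l1 l2
      using row[OF that(1)] row[OF that(2)] \<open>s1 \<noteq> s2\<close> by metis
    then show ?thesis by (auto simp: image_iff)
  qed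
  moreover have "finite C" using finite_configs[of 0 M] by (simp add: C_def)
  ultimately show ?thesis
    unfolding C_def[symmetric]
    by (simp add: card_UN_disjoint finite_colourings card_image)
qed

text \<open>A transfer matrix: composing with one more level sums over the row in between, which is
  the recursion for colourings with prescribed ends.\<close>

lemma app_state_op:
  assumes "set w \<subseteq> {1..<M}" "n \<le> length w" "s' \<in> configs 0 M" "s \<in> configs 0 M"
  shows "app (state_op colour.hook w S n) (delta s') s = of_nat (card (colourings M w S n s s'))"
  using assms(2,3)
proof (induction n arbitrary: s')
  case 0
  have "l = (\<lambda>(p, t). t = 0 \<and> s p)" if "l \<in> colourings M w S 0 s s'" for l
  proof
    fix x
    show "l x = (case x of (p, t) \<Rightarrow> t = 0 \<and> s p)"
      using that by (cases x; cases "snd x = 0") (auto simp: colourings_def)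
  qed
  moreover have "s = s'" if "l \<in> colourings M w S 0 s s'" for l
    using that by (auto simp: colourings_def)
  moreover have "(\<lambda>(p, t). t = 0 \<and> s p) \<in> colourings M w S 0 s s"
    using assms(4) by (auto simp: colourings_def configs_def Suc_le_eq)
  ultimately have "colourings M w S 0 s s' = (if s = s' then {\<lambda>(p, t). t = 0 \<and> s p} else {})"
    unfolding if_split by blast
  then show ?case by (simp add: delta_def)
next
  case (Suc n)
  have wn: "w ! n \<in> {1..<M}" using assms(1) Suc.prems(1) by (metis Suc_le_lessD nth_mem subsetD)
  define C where "C = {s1 \<in> configs 0 M. compatible w S n s1 s'}"
  have fC: "finite C" using finite_configs[of 0 M] by (simp add: C_def)
  have "app (if n \<in> S then 1 else colour.hook (w ! n)) (delta s') = (\<lambda>t. \<Sum>s1\<in>C. delta s1 t)"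
  proof
    fix t
    have "(\<Sum>s1\<in>C. delta s1 t) = (if t \<in> C then 1 else (0::int))"
      using fC by (simp add: delta_def sum.delta)
    also have "t \<in> C \<longleftrightarrow> compatible w S n t s'"
      using compatible_configs[OF _ Suc.prems(2) wn] by (auto simp: C_def)
    finally show "app (if n \<in> S then 1 else colour.hook (w ! n)) (delta s') t = (\<Sum>s1\<in>C. delta s1 t)"
      by (simp only: app_hook_delta)
  qed
  then have "app (state_op colour.hook w S (Suc n)) (delta s') s
      = (\<Sum>s1\<in>C. app (state_op colour.hook w S n) (delta s1) s)"
    by (simp only: state_op_simps app_simps(6) app_sum)
  also have "\<dots> = (\<Sum>s1\<in>C. of_nat (card (colourings M w S n s s1)))"
    using Suc by (intro sum.cong) (auto simp: C_def)
  finally show ?case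
    using card_colourings_Suc[OF Suc.prems(2) wn, of S s] by (simp add: C_def)
qed

text \<open>Diagonal entries count the colourings with equal end rows, and equality of the end rows
  is the condition imposed by the closing arcs.\<close>

lemma colour_trace:
  assumes "set w \<subseteq> {1..<M}"
  shows "colour.trace 0 M (state_op colour.hook w S (length w)) = 2 ^ state_circles M (map Gen w) S"
proof -
  define n where "n = length w"
  define E where "E = outer_arcs M (map Gen w) \<union> (\<Union>t<n. smoothing_arcs (map Gen w) S t)"
  define L where "L = {l :: point \<Rightarrow> bool. (\<forall>x. l x \<longrightarrow> x \<in> points M (map Gen w)) \<and> (\<forall>(a, b)\<in>E. l a = l b)}"
  have wt: "1 \<le> w ! t" "Suc (w ! t) \<le> M" if "t < n" for t
    using that assms unfolding n_def by (metis atLeastLessThan_iff nth_mem subsetD, metis Suc_leI atLeastLessThan_iff nth_mem subsetD)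
  have "E \<subseteq> points M (map Gen w) \<times> points M (map Gen w)"
    unfolding E_def using wt
    by (auto simp: outer_arcs_def smoothing_arcs_def vertical_arcs_def horizontal_arcs_def points_def n_def split: if_splits)
       (use Suc_leD in blast)+
  then have card: "card L = 2 ^ state_circles M (map Gen w) S"
    unfolding L_def state_circles_def E_def n_def
    by (subst card_two_colourings) (auto simp: points_def)
  \<comment> \<open>The arcs of one level, those beside the crossing included, amount to
    \<open>compatible\<close>; positions outside \<open>{1..M}\<close> do not matter because
    \<open>l\<close> is false there.\<close>
  have L_iff: "l \<in> L \<longleftrightarrow> (\<forall>p t. l (p, t) \<longrightarrow> p \<in> {1..M} \<and> t \<le> n) \<and> (\<lambda>p. l (p, 0)) = (\<lambda>p. l (p, n)) \<and>
     (\<forall>t<n. compatible w S t (\<lambda>p. l (p, t)) (\<lambda>p. l (p, Suc t)))" for l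
  proof -
    have 1: "(\<forall>x. l x \<longrightarrow> x \<in> points M (map Gen w)) \<longleftrightarrow> (\<forall>p t. l (p, t) \<longrightarrow> p \<in> {1..M} \<and> t \<le> n)"
      by (auto simp: points_def n_def)
    have 2: "(\<forall>(a, b)\<in>E. l a = l b) \<longleftrightarrow> (\<lambda>p. l (p, 0)) = (\<lambda>p. l (p, n)) \<and>
        (\<forall>t<n. compatible w S t (\<lambda>p. l (p, t)) (\<lambda>p. l (p, Suc t)))"
      if l: "\<forall>p t. l (p, t) \<longrightarrow> p \<in> {1..M} \<and> t \<le> n"
    proof -
      have E: "(\<forall>(a, b)\<in>E. l a = l b) \<longleftrightarrow> (\<forall>p\<in>{1..M}. l (p, n) = l (p, 0)) \<and>
         (\<forall>t<n. (\<forall>p\<in>{1..M} - {w ! t, Suc (w ! t)}. l (p, t) = l (p, Suc t)) \<and>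
           (\<forall>(a, b)\<in>smoothing_arcs (map Gen w) S t. l a = l b))"
      proof -
        have o: "outer_arcs M (map Gen w) = {((p, t), (p, Suc t)) | p t. t < n \<and> p \<in> {1..M} - {w ! t, Suc (w ! t)}}
            \<union> {((p, n), (p, 0)) | p. p \<in> {1..M}}"
          by (auto simp: outer_arcs_def n_def)
        show ?thesis unfolding E_def o ball_Un by blast
      qed
      have "(\<forall>p\<in>{1..M} - {w ! t, Suc (w ! t)}. l (p, t) = l (p, Suc t)) \<and>
           (\<forall>(a, b)\<in>smoothing_arcs (map Gen w) S t. l a = l b) \<longleftrightarrow>
          compatible w S t (\<lambda>p. l (p, t)) (\<lambda>p. l (p, Suc t))" if t: "t < n" for t
      proof -
        have "(\<forall>p\<in>{1..M} - {w ! t, Suc (w ! t)}. l (p, t) = l (p, Suc t)) \<longleftrightarrow>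
          (\<forall>p. p \<notin> {w ! t, Suc (w ! t)} \<longrightarrow> l (p, t) = l (p, Suc t))" using l by blast
        moreover have "(\<forall>(a, b)\<in>smoothing_arcs (map Gen w) S t. l a = l b) \<longleftrightarrow>
          (if t \<in> S then l (w ! t, t) = l (w ! t, Suc t) \<and> l (Suc (w ! t), t) = l (Suc (w ! t), Suc t)
           else l (w ! t, t) = l (Suc (w ! t), t) \<and> l (w ! t, Suc t) = l (Suc (w ! t), Suc t))"
          using t by (simp add: smoothing_arcs_def vertical_arcs_def horizontal_arcs_def n_def)
        moreover have "(\<forall>p. p \<notin> {w ! t, Suc (w ! t)} \<longrightarrow> l (p, t) = l (p, Suc t)) \<and>
            l (w ! t, t) = l (w ! t, Suc t) \<and> l (Suc (w ! t), t) = l (Suc (w ! t), Suc t) \<longleftrightarrow>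
            (\<forall>p. l (p, t) = l (p, Suc t))"
          by (metis insertE singletonD)
        ultimately show ?thesis unfolding compatible_def fun_eq_iff by (cases "t \<in> S") auto
      qed
      moreover have "(\<forall>p\<in>{1..M}. l (p, n) = l (p, 0)) \<longleftrightarrow> (\<lambda>p. l (p, 0)) = (\<lambda>p. l (p, n))"
        unfolding fun_eq_iff using l by blast
      ultimately show ?thesis unfolding E by auto
    qed
    show ?thesis unfolding L_def mem_Collect_eq 1 using 2 by blast
  qed
  have "L = (\<Union>s\<in>configs 0 M. colourings M w S n s s)"
  proof (intro subset_antisym subsetI)
    fix l assume "l \<in> L"
    then have "l \<in> colourings M w S n (\<lambda>p. l (p, 0)) (\<lambda>p. l (p, 0))" "(\<lambda>p. l (p, 0)) \<in> configs 0 M"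
      unfolding L_iff by (auto simp: colourings_def configs_def Suc_le_eq)
    then show "l \<in> (\<Union>s\<in>configs 0 M. colourings M w S n s s)" by blast
  qed (auto simp: L_iff colourings_def)
  moreover have "colourings M w S n s s \<inter> colourings M w S n s' s' = {}" if "s \<noteq> s'" for s s'
    using that by (auto simp: colourings_def)
  ultimately have "card L = (\<Sum>s\<in>configs 0 M. card (colourings M w S n s s))"
    by (simp add: card_UN_disjoint finite_configs finite_colourings)
  moreover have "colour.trace 0 M (state_op colour.hook w S n) = (\<Sum>s\<in>configs 0 M. of_nat (card (colourings M w S n s s)))"
    unfolding colour.trace_def using app_state_op[OF assms] by (intro sum.cong) (auto simp: n_def)
  ultimately have "colour.trace 0 M (state_op colour.hook w S n) = int (card L)" by simp
  then show ?thesis unfolding card n_def by simp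
qed

section \<open>The Kauffman bracket as a trace\<close>

locale kauffman =
  fixes A :: "'a::field"
  assumes A_nz: "A \<noteq> 0"
begin

text \<open>This is the usual model for quantum sl(2), with entries \<open>i A\<close> and
  \<open>- i A^(-1)\<close> for cups and caps alike, rescaled by mutually inverse factors so that no
  square root of -1 is needed. Equal values have weight 0, so that hooks preserve the number of
  particles.\<close>

definition cup_weight :: "bool \<Rightarrow> bool \<Rightarrow> 'a" where
  "cup_weight b c = (if b = c then 0 else if b then (inverse A)\<^sup>2 else -1)"

definition cap_weight :: "bool \<Rightarrow> bool \<Rightarrow> 'a" where
  "cap_weight b c = (if b = c then 0 else if b then -1 else A\<^sup>2)"

text \<open>The ratio of the two weights is \<open>A^(-4)\<close>: closing an occupied strand
  instead of an empty one costs a factor \<open>q\<close>.\<close>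

definition closure_weight :: "bool \<Rightarrow> 'a" where
  "closure_weight b = (if b then - (inverse A)\<^sup>2 else - A\<^sup>2)"

definition loop_value :: 'a where
  "loop_value = - A\<^sup>2 - (inverse A)\<^sup>2"

lemma A_inverse_powers: "A\<^sup>2 * (inverse A)\<^sup>2 = 1" "(inverse A)\<^sup>2 * A\<^sup>2 = 1"
  using A_nz by (simp_all add: field_simps)

end

sublocale kauffman \<subseteq> tl_rep cup_weight cap_weight closure_weight loop_value
  by unfold_locales
    (auto simp: cup_weight_def cap_weight_def closure_weight_def loop_value_def sum_bool A_inverse_powers)

text \<open>In the empty state every letter \<open>Gen i\<close> is smoothed horizontally, that is,
  read as a Temperley-Lieb generator.\<close>

definition circles :: "nat \<Rightarrow> nat list \<Rightarrow> nat" where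
  "circles M u = state_circles M (map Gen u) {}"

definition subword :: "nat list \<Rightarrow> nat set \<Rightarrow> nat \<Rightarrow> nat list" where
  "subword w S n = map ((!) w) (filter (\<lambda>t. t \<notin> S) [0..<n])"

lemma state_op_subword: "state_op h w S n = prod_list (map h (subword w S n))"
  by (induction n) (auto simp: subword_def)

lemma state_op_empty: "state_op h w {} (length w) = prod_list (map h w)"
  by (simp add: state_op_subword subword_def map_nth)

lemma set_subword: "n \<le> length w \<Longrightarrow> set (subword w S n) \<subseteq> set w"
  by (auto simp: subword_def)

lemma colour_trace_word:
  "set u \<subseteq> {1..<M} \<Longrightarrow> colour.trace 0 M (colour.hook_word u) = 2 ^ circles M u"
  using colour_trace[of u M "{}"] by (simp add: state_op_empty circles_def colour.hook_word_def)

lemma state_circles_subword: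
  assumes "set w \<subseteq> {1..<M}"
  shows "state_circles M (map Gen w) S = circles M (subword w S (length w))"
proof -
  have "set (subword w S (length w)) \<subseteq> {1..<M}" using assms set_subword by blast
  then have "(2::int) ^ state_circles M (map Gen w) S = 2 ^ circles M (subword w S (length w))"
    using colour_trace[OF assms, of S] colour_trace_word
    by (simp add: state_op_subword colour.hook_word_def)
  then show ?thesis by simp
qed

text \<open>The relations for the colouring trace are equations between powers of 2, hence between
  numbers of circles, and therefore persist for any loop value.\<close>

lemma markov_trace_circles: "markov_trace 0 d (\<lambda>M u. d ^ circles M u)"
proof -
  have C: "markov_trace 0 2 (\<lambda>M u. colour.trace 0 M (colour.hook_word u))"
    using colour.markov_trace_hooks[of 0 1 0] by (simp add: local_op_one)
  have eq: "circles M u = circles M' v"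
    if "colour.trace 0 M (colour.hook_word u) = colour.trace 0 M' (colour.hook_word v)"
      "set u \<subseteq> {1..<M}" "set v \<subseteq> {1..<M'}" for M M' u v
  proof -
    have "(2::int) ^ circles M u = 2 ^ circles M' v" using that by (simp add: colour_trace_word)
    then show ?thesis by simp
  qed
  have Suc: "circles M u = Suc (circles M' v)"
    if "colour.trace 0 M (colour.hook_word u) = 2 * colour.trace 0 M' (colour.hook_word v)"
      "set u \<subseteq> {1..<M}" "set v \<subseteq> {1..<M'}" for M M' u v
  proof -
    have "(2::int) ^ circles M u = 2 ^ Suc (circles M' v)" using that by (simp add: colour_trace_word)
    then show ?thesis by (simp only: power_inject_exp)
  qed
  show ?thesis
    unfolding markov_trace_def
  proof (intro conjI allI impI)
    fix M :: nat and u assume "set u \<subseteq> {1..<M}"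
    then have "circles (Suc M) u = Suc (circles M u)"
      using C unfolding markov_trace_def by (intro Suc) auto
    then show "d ^ circles (Suc M) u = d * d ^ circles M u" by simp
  next
    fix M :: nat and u v assume "1 \<le> M" "set (u @ v) \<subseteq> {1..<M}"
    then have "circles (Suc M) (u @ [M] @ v) = circles M (u @ v)"
      using C unfolding markov_trace_def by (intro eq) auto
    then show "d ^ circles (Suc M) (u @ [M] @ v) = d ^ circles M (u @ v)" by simp
  next
    fix M i :: nat and u v assume "set (u @ [i] @ v) \<subseteq> {1..<M}"
    then have "circles M (u @ [i, i] @ v) = Suc (circles M (u @ [i] @ v))"
      using C unfolding markov_trace_def by (intro Suc) auto
    then show "d ^ circles M (u @ [i, i] @ v) = d * d ^ circles M (u @ [i] @ v)" by simp
  next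
    fix M i j :: nat and u v assume "i = Suc j \<or> j = Suc i" "set (u @ [i, j] @ v) \<subseteq> {1..<M}"
    then have "circles M (u @ [i, j, i] @ v) = circles M (u @ [i] @ v)"
      using C unfolding markov_trace_def by (intro eq) auto
    then show "d ^ circles M (u @ [i, j, i] @ v) = d ^ circles M (u @ [i] @ v)" by simp
  next
    fix M i j :: nat and u v assume ij: "i + 2 \<le> j \<or> j + 2 \<le> i" "set (u @ [i, j] @ v) \<subseteq> {1..<M}"
    have "colour.trace 0 M (colour.hook_word (u @ [i, j] @ v)) = colour.trace 0 M (colour.hook_word (u @ [j, i] @ v))"
      using C ij unfolding markov_trace_def by metis
    then have "circles M (u @ [i, j] @ v) = circles M (u @ [j, i] @ v)"
      using ij(2) by (intro eq) auto
    then show "d ^ circles M (u @ [i, j] @ v) = d ^ circles M (u @ [j, i] @ v)" by simp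
  qed
qed

context kauffman
begin

definition cross :: "nat \<Rightarrow> 'a linop" where
  "cross i = scalar A + scalar (inverse A) * hook i"

definition cross_word :: "nat list \<Rightarrow> 'a linop" where
  "cross_word w = prod_list (map cross w)"

lemma cross_word_simps [simp]:
  "cross_word [] = 1" "cross_word (i # u) = cross i * cross_word u"
  "cross_word (u @ v) = cross_word u * cross_word v"
  by (simp_all add: cross_word_def)

lemma scalar_collect:
  "scalar a * X * (scalar b * Y) = scalar (b * a) * (X * Y)" "scalar a * X * scalar b = scalar (b * a) * X"
proof -
  have X: "X * scalar b = scalar b * X" by (rule scalar_commute)
  have ab: "scalar (b * a) = scalar a * scalar b" by (simp only: scalar_simps(6)[symmetric] mult.commute)
  have "scalar a * X * (scalar b * Y) = scalar a * (X * scalar b) * Y" by (simp only: mult.assoc)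
  then show "scalar a * X * (scalar b * Y) = scalar (b * a) * (X * Y)"
    unfolding X ab by (simp only: mult.assoc)
  show "scalar a * X * scalar b = scalar (b * a) * X"
    unfolding mult.assoc X ab ..
qed

lemma trace_sum: "trace k M (\<Sum>i\<in>I. T i) = (\<Sum>i\<in>I. trace k M (T i))"
  by (induction I rule: infinite_finite_induct) (auto simp: trace_zero trace_add)

text \<open>Both sides are Markov traces with the same loop value, and on zero strands both are 1;
  uniqueness does the rest.\<close>

lemma trace_hook_word:
  assumes "set u \<subseteq> {1..<M}"
  shows "trace 0 M (hook_word u) = loop_value ^ circles M u"
proof (rule markov_trace_unique[where k = 0 and d = loop_value and F = "\<lambda>M u. trace 0 M (hook_word u)" and G = "\<lambda>M u. loop_value ^ circles M u"])
  show "markov_trace 0 loop_value (\<lambda>M u. trace 0 M (hook_word u))"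
    using markov_trace_hooks[of 0 1 0] by (simp add: local_op_one)
  show "markov_trace 0 loop_value (\<lambda>M u. loop_value ^ circles M u)"
    by (rule markov_trace_circles)
  fix v :: "nat list" assume "set v \<subseteq> {1..<0}"
  then have v: "v = []" by simp
  have "(2::int) ^ circles 0 [] = 2 ^ 0"
    using colour_trace_word[of "[]" 0] by (simp add: colour.trace_self delta_def)
  then have "circles 0 [] = 0" by simp
  then show "trace 0 0 (hook_word v) = loop_value ^ circles 0 v"
    by (simp add: v trace_self delta_def)
qed (use assms in auto)

lemma Pow_lessThan_Suc: "Pow {..<Suc n} = Pow {..<n} \<union> insert n ` Pow {..<n}"
  by (simp add: lessThan_Suc Pow_insert)

text \<open>Multiplying out the crossings gives the state sum; the sets of crossings are split
  according to whether they contain the last one.\<close>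

lemma cross_word_states:
  "n \<le> length w \<Longrightarrow> cross_word (take n w) =
     (\<Sum>S\<in>Pow {..<n}. scalar (A ^ card S * inverse A ^ (n - card S)) * state_op hook w S n)"
proof (induction n)
  case (Suc n)
  define c where "c S = A ^ card S * inverse A ^ (n - card S)" for S :: "nat set"
  have S: "finite S" "card S \<le> n" "n \<notin> S" if "S \<in> Pow {..<n}" for S :: "nat set"
    using that card_mono[of "{..<n}" S] by (auto intro: finite_subset)
  have state: "state_op hook w (insert n S) n = state_op hook w S n" if "S \<in> Pow {..<n}" for S
    unfolding state_op_def using S[OF that] by (intro arg_cong[where f = prod_list] map_cong) auto
  have inj: "inj_on (insert n) (Pow {..<n})"
    using S(3) by (meson inj_onI insert_ident)
  have "(\<Sum>S\<in>Pow {..<Suc n}. scalar (A ^ card S * inverse A ^ (Suc n - card S)) * state_op hook w S (Suc n))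
      = (\<Sum>S\<in>Pow {..<n}. scalar (A ^ card S * inverse A ^ (Suc n - card S)) * state_op hook w S (Suc n))
      + (\<Sum>S\<in>insert n ` Pow {..<n}. scalar (A ^ card S * inverse A ^ (Suc n - card S)) * state_op hook w S (Suc n))"
    unfolding Pow_lessThan_Suc by (intro sum.union_disjoint) auto
  also have "\<dots> = (\<Sum>S\<in>Pow {..<n}. scalar (c S) * state_op hook w S n * (scalar (inverse A) * hook (w ! n)))
      + (\<Sum>S\<in>Pow {..<n}. scalar (c S) * state_op hook w S n * scalar A)"
  proof (intro arg_cong2[where f = "(+)"])
    show "(\<Sum>S\<in>Pow {..<n}. scalar (A ^ card S * inverse A ^ (Suc n - card S)) * state_op hook w S (Suc n))
        = (\<Sum>S\<in>Pow {..<n}. scalar (c S) * state_op hook w S n * (scalar (inverse A) * hook (w ! n)))"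
    proof (rule sum.cong[OF refl])
      fix S assume "S \<in> Pow {..<n}"
      then have "A ^ card S * inverse A ^ (Suc n - card S) = inverse A * c S"
        using S by (simp add: c_def Suc_diff_le)
      then show "scalar (A ^ card S * inverse A ^ (Suc n - card S)) * state_op hook w S (Suc n)
        = scalar (c S) * state_op hook w S n * (scalar (inverse A) * hook (w ! n))"
        using S[OF \<open>S \<in> _\<close>] by (simp add: scalar_collect)
    qed
    show "(\<Sum>S\<in>insert n ` Pow {..<n}. scalar (A ^ card S * inverse A ^ (Suc n - card S)) * state_op hook w S (Suc n))
        = (\<Sum>S\<in>Pow {..<n}. scalar (c S) * state_op hook w S n * scalar A)"
    proof (subst sum.reindex[OF inj], rule sum.cong[OF refl])
      fix S assume "S \<in> Pow {..<n}"
      note S = S[OF this] state[OF this]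
      then have "A ^ card (insert n S) * inverse A ^ (Suc n - card (insert n S)) = A * c S"
        by (simp add: c_def mult.assoc)
      then have "((\<lambda>S. scalar (A ^ card S * inverse A ^ (Suc n - card S)) * state_op hook w S (Suc n)) \<circ> insert n) S
        = scalar (A * c S) * state_op hook w S n"
        using S by (simp del: card_insert_disjoint)
      then show "((\<lambda>S. scalar (A ^ card S * inverse A ^ (Suc n - card S)) * state_op hook w S (Suc n)) \<circ> insert n) S
        = scalar (c S) * state_op hook w S n * scalar A" by (simp only: scalar_collect)
    qed
  qed
  also have "\<dots> = (\<Sum>S\<in>Pow {..<n}. scalar (c S) * state_op hook w S n) * cross (w ! n)"
    by (simp add: cross_def distrib_left sum_distrib_right)
  also have "\<dots> = cross_word (take (Suc n) w)"
    using Suc by (simp add: take_Suc_conv_app_nth c_def)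
  finally show ?case ..
qed (simp add: scalar_simps)

theorem kauffman_bracket_trace:
  assumes "set w \<subseteq> {1..<M}"
  shows "kauffman_bracket A M (map Gen w) = trace 0 M (cross_word w)"
proof -
  define n where "n = length w"
  have "trace 0 M (state_op hook w S n) = loop_value ^ state_circles M (map Gen w) S" for S
  proof -
    have "set (subword w S n) \<subseteq> {1..<M}" using assms set_subword n_def by blast
    then show ?thesis
      using trace_hook_word state_circles_subword[OF assms]
      by (simp add: state_op_subword hook_word_def n_def)
  qed
  then have "trace 0 M (cross_word (take n w)) = (\<Sum>S\<in>Pow {..<n}. (A ^ card S * inverse A ^ (n - card S)) *
      loop_value ^ state_circles M (map Gen w) S)"
    by (subst cross_word_states) (simp_all add: n_def trace_sum trace_scalar)
  also have "\<dots> = kauffman_bracket A M (map Gen w)"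
    unfolding kauffman_bracket_def
  proof (intro sum.cong)
    fix S assume "S \<in> Pow {..<length (map Gen w)}"
    have "A powi (int (card S) - int (n - card S)) = A ^ card S * inverse A ^ (n - card S)"
      using A_nz by (simp add: power_int_diff divide_inverse power_inverse)
    moreover have "- (A powi 2) - A powi (-2) = loop_value"
      by (simp add: loop_value_def power_int_minus power_inverse)
    ultimately show "A ^ card S * inverse A ^ (n - card S) * loop_value ^ state_circles M (map Gen w) S
        = A powi (int (card S) - int (length (map Gen w) - card S)) * (- (A powi 2) - A powi (-2)) ^ state_circles M (map Gen w) S"
      by (simp add: n_def)
  qed (simp add: n_def)
  finally show ?thesis by (simp add: n_def)
qed

end

section \<open>Sliding a cup through a cabled braid\<close>

text \<open>Read from the top, these letters carry the strand at position \<open>a + p + 1\<close>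
  to position \<open>a + 1\<close>, across \<open>p\<close> others.\<close>

primrec band_row :: "nat \<Rightarrow> nat \<Rightarrow> nat list" where
  "band_row a 0 = []"
| "band_row a (Suc p) = (a + Suc p) # band_row a p"

text \<open>
  The crossing of a band of \<open>p\<close> strands, which starts to the right of position \<open>a\<close>, over the
  next band of \<open>q\<close> strands; each row moves one strand of the second band to the left.
\<close>

fun grid :: "nat \<Rightarrow> nat \<Rightarrow> nat \<Rightarrow> nat list" where
  "grid a p 0 = []"
| "grid a p (Suc q) = band_row a p @ grid (Suc a) p q"

text \<open>The bands have individual sizes because a cup that travels around the knot has already
  shortened some of them and not yet the others.\<close>

definition offset :: "(nat \<Rightarrow> nat) \<Rightarrow> nat \<Rightarrow> nat" where
  "offset ns j = (\<Sum>i\<in>{1..<j}. ns i)"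

text \<open>The cable of a braid word whose bands have, at the top, the sizes \<open>ns 1, ns 2, \<dots>\<close>\<close>

fun cable :: "(nat \<Rightarrow> nat) \<Rightarrow> nat list \<Rightarrow> nat list" where
  "cable ns [] = []"
| "cable ns (j # js) = grid (offset ns j) (ns j) (ns (Suc j)) @ cable (ns \<circ> transpose j (Suc j)) js"

text \<open>The permutation maps the bottom position of a strand to its top position.\<close>

fun perm :: "nat list \<Rightarrow> nat \<Rightarrow> nat" where
  "perm [] = id"
| "perm (j # js) = transpose j (Suc j) \<circ> perm js"

lemma set_band_row: "set (band_row a p) = {a<..a + p}"
  by (induction p) auto

lemma set_grid: "set (grid a p q) \<subseteq> {a<..<a + p + q}"
proof (induction q arbitrary: a)
  case (Suc q)
  have "set (grid (Suc a) p q) \<subseteq> {a<..<a + p + Suc q}" using Suc[of "Suc a"] by force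
  then show ?case by (auto simp: set_band_row)
qed simp

lemma band_row_shift: "band_row (Suc (Suc a)) p = map (\<lambda>j. Suc (Suc j)) (band_row a p)"
  by (induction p) auto

lemma grid_shift: "grid (Suc (Suc a)) p q = map (\<lambda>j. Suc (Suc j)) (grid a p q)"
  by (induction q arbitrary: a) (auto simp: band_row_shift)

lemma offset_1 [simp]: "offset ns (Suc 0) = 0"
  by (simp add: offset_def)

lemma offset_Suc: "1 \<le> j \<Longrightarrow> offset ns (Suc j) = offset ns j + ns j"
  by (simp add: offset_def)

lemma offset_less: "1 \<le> c \<Longrightarrow> c < j \<Longrightarrow> offset ns c + ns c \<le> offset ns j"
  unfolding offset_Suc[symmetric, of c ns] unfolding offset_def by (intro sum_mono2) auto

lemma offset_cong: "(\<And>i. 1 \<le> i \<Longrightarrow> i < j \<Longrightarrow> ns i = ns' i) \<Longrightarrow> offset ns j = offset ns' j"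
  unfolding offset_def by (intro sum.cong) auto

lemma offset_update_above: "j \<le> c \<Longrightarrow> offset (ns(c := v)) j = offset ns j"
  by (rule offset_cong) auto

lemma offset_update_below:
  assumes "1 \<le> c" "c < j" "2 \<le> ns c"
  shows "Suc (Suc (offset (ns(c := ns c - 2)) j)) = offset ns j"
proof -
  have "{1..<j} = insert c ({1..<j} - {c})" using assms by auto
  then have "offset ns' j = ns' c + (\<Sum>i\<in>{1..<j} - {c}. ns' i)" for ns'
    unfolding offset_def by (metis sum.insert Diff_iff finite_Diff finite_atLeastLessThan insertI1)
  moreover have "(\<Sum>i\<in>{1..<j} - {c}. (ns(c := ns c - 2)) i) = (\<Sum>i\<in>{1..<j} - {c}. ns i)"
    by (intro sum.cong) auto
  ultimately show ?thesis using assms(3) by simp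
qed

text \<open>Exchanging two neighbouring bands moves only the border between them.\<close>

lemma offset_transpose:
  assumes "1 \<le> j" "c \<noteq> Suc j"
  shows "offset (ns \<circ> transpose j (Suc j)) c = offset ns c"
proof (cases "c \<le> j")
  case True
  then show ?thesis by (intro offset_cong) (auto simp: transpose_def)
next
  case False
  then obtain e where "c = Suc (Suc j) + e" using assms(2) by (metis less_iff_Suc_add not_less Suc_leI le_less le_Suc_ex)
  moreover have "offset (ns \<circ> transpose j (Suc j)) (Suc (Suc j) + e) = offset ns (Suc (Suc j) + e)"
  proof (induction e)
    case 0
    have "offset (ns \<circ> transpose j (Suc j)) j = offset ns j"
      by (intro offset_cong) (auto simp: transpose_def)
    then show ?case using assms(1) by (simp add: offset_Suc comp_def)
  next
    case (Suc e)
    then show ?case by (simp add: offset_Suc transpose_def)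
  qed
  ultimately show ?thesis by simp
qed

lemma perm_permutes: "set js \<subseteq> {1..<m} \<Longrightarrow> perm js permutes {1..m}"
proof (induction js)
  case (Cons j js)
  then have "transpose j (Suc j) permutes {1..m}" by (intro permutes_swap_id) auto
  then show ?case using Cons by (simp add: permutes_compose del: o_apply)
qed (simp add: permutes_id)

lemma cable_cong:
  "set js \<subseteq> {1..<m} \<Longrightarrow> (\<And>b. b \<in> {1..m} \<Longrightarrow> ns b = ns' b) \<Longrightarrow> cable ns js = cable ns' js"
proof (induction js arbitrary: ns ns')
  case (Cons j js)
  have "offset ns j = offset ns' j" using Cons.prems by (intro offset_cong) auto
  moreover have "cable (ns \<circ> transpose j (Suc j)) js = cable (ns' \<circ> transpose j (Suc j)) js"
  proof (rule Cons.IH)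
    fix b assume "b \<in> {1..m}"
    then have "transpose j (Suc j) b \<in> {1..m}" using Cons.prems(1) by (auto simp: transpose_def)
    then show "(ns \<circ> transpose j (Suc j)) b = (ns' \<circ> transpose j (Suc j)) b" using Cons.prems(2) by simp
  qed (use Cons.prems(1) in auto)
  ultimately show ?case using Cons.prems by simp
qed simp

section \<open>Cups pass single crossings, rows, grids and cables\<close>

context kauffman
begin

lemma hook_cup:
  "hook i * cup i = scalar loop_value * cup i" "hook i * cup (Suc i) = cup i" "hook (Suc i) * cup i = cup (Suc i)"
  by (simp_all add: hook_def mult.assoc cap_cup cap_cup_Suc cap_Suc_cup scalar_commute)

lemma hook_cup_right: "i \<le> j \<Longrightarrow> hook (Suc (Suc j)) * cup i = cup i * hook j"
proof -
  assume ij: "i \<le> j"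
  have "hook (Suc (Suc j)) * cup i = cup (Suc (Suc j)) * (cap (Suc (Suc j)) * cup i)"
    by (simp add: hook_def mult.assoc)
  also have "\<dots> = (cup (Suc (Suc j)) * cup i) * cap j" by (simp add: cap_cup_right[OF ij] mult.assoc)
  also have "\<dots> = cup i * hook j" by (simp add: cup_cup[OF ij, symmetric] hook_def mult.assoc)
  finally show ?thesis .
qed

lemma hook_cup_left: "j \<le> i \<Longrightarrow> hook j * cup (Suc (Suc i)) = cup (Suc (Suc i)) * hook j"
proof -
  assume ij: "j \<le> i"
  have "hook j * cup (Suc (Suc i)) = cup j * (cap j * cup (Suc (Suc i)))"
    by (simp add: hook_def mult.assoc)
  also have "\<dots> = (cup j * cup i) * cap j" by (simp add: cap_cup_left[OF ij] mult.assoc)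
  also have "\<dots> = cup (Suc (Suc i)) * hook j" by (simp add: cup_cup[OF ij] hook_def mult.assoc)
  finally show ?thesis .
qed

lemma cross_cup_right: "i \<le> j \<Longrightarrow> cross (Suc (Suc j)) * cup i = cup i * cross j"
  by (simp add: cross_def distrib_left distrib_right mult.assoc hook_cup_right scalar_commute scalar_left_commute)

lemma cross_cup_left: "j + 2 \<le> i \<Longrightarrow> cross j * cup i = cup i * cross j"
proof -
  assume "j + 2 \<le> i"
  then obtain i' where i: "i = Suc (Suc i')" "j \<le> i'" by (cases i rule: nat.exhaust; cases "i - 1"; force)
  then have "hook j * cup i = cup i * hook j" using hook_cup_left by simp
  then show ?thesis
    by (simp add: cross_def distrib_left distrib_right mult.assoc scalar_commute scalar_left_commute)
qed

text \<open>Common expansion for both cup slides and for the commutation of distant crossings; the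
  mixed terms have coefficient \<open>A * inverse A = 1\<close>.\<close>

lemma cross_cross_aux:
  fixes X Y C :: "'a linop"
  shows "(scalar A + scalar (inverse A) * X) * ((scalar A + scalar (inverse A) * Y) * C)
    = scalar (A\<^sup>2) * C + (Y * C + X * C) + scalar ((inverse A)\<^sup>2) * (X * (Y * C))"
proof (rule linop_eqI)
  fix \<phi> s
  have 1: "app X (app (T + scalar c * S) \<phi>) s = app X (app T \<phi>) s + c * app X (app S \<phi>) s" for T S :: "'a linop" and c
  proof -
    have "app (T + scalar c * S) \<phi> = (\<lambda>s. app T \<phi> s + c * app S \<phi> s)" by (rule ext) simp
    then show ?thesis by (simp add: app_add app_mult)
  qed
  have 2: "app X (app (scalar A * C + scalar (inverse A) * (Y * C)) \<phi>) s = A * app X (app C \<phi>) s + inverse A * app X (app (Y * C) \<phi>) s"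
  proof -
    have "app (0 :: 'a linop) \<phi> = (\<lambda>s. 0)" by (rule ext) simp
    then show ?thesis unfolding 1 using 1[of 0 A C] by (simp add: app_zero)
  qed
  have "app ((scalar A + scalar (inverse A) * X) * ((scalar A + scalar (inverse A) * Y) * C)) \<phi> s
     = app (scalar A * (scalar A * C + scalar (inverse A) * (Y * C))) \<phi> s
       + inverse A * app X (app (scalar A * C + scalar (inverse A) * (Y * C)) \<phi>) s"
    by (simp add: distrib_right mult.assoc)
  also have "\<dots> = app (scalar (A\<^sup>2) * C + (Y * C + X * C) + scalar ((inverse A)\<^sup>2) * (X * (Y * C))) \<phi> s"
    unfolding 2 using A_nz by (simp add: field_simps power2_eq_square)
  finally show "app ((scalar A + scalar (inverse A) * X) * ((scalar A + scalar (inverse A) * Y) * C)) \<phi> s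
    = app (scalar (A\<^sup>2) * C + (Y * C + X * C) + scalar ((inverse A)\<^sup>2) * (X * (Y * C))) \<phi> s" .
qed

lemma loop_value_cancel: "scalar (A\<^sup>2) * C + (D + scalar loop_value * C) + scalar ((inverse A)\<^sup>2) * C = D"
  by (rule linop_eqI) (simp add: loop_value_def algebra_simps)

text \<open>A second Reidemeister move: by \<open>hook_cup\<close>, three of the four terms are
  multiples of \<open>cup i\<close>, and their coefficients \<open>A^2\<close>,
  \<open>loop_value\<close> and \<open>A^(-2)\<close> add up to 0.\<close>

lemma cross_slide1: "cross i * (cross (Suc i) * cup i) = cup (Suc i)"
  unfolding cross_def cross_cross_aux hook_cup loop_value_cancel ..

lemma cross_slide2: "cross (Suc i) * (cross i * cup (Suc i)) = cup i"
  unfolding cross_def cross_cross_aux hook_cup loop_value_cancel ..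

lemma cross_commute: "i + 2 \<le> j \<Longrightarrow> cross i * cross j = cross j * cross i"
proof -
  assume "i + 2 \<le> j"
  then have h: "hook i * hook j = hook j * hook i" by (rule hook_commute)
  have aux: "(scalar A + scalar (inverse A) * X) * (scalar A + scalar (inverse A) * Y)
    = scalar (A\<^sup>2) + (Y + X) + scalar ((inverse A)\<^sup>2) * (X * Y)" for X Y :: "'a linop"
    using cross_cross_aux[of X Y 1] by simp
  show ?thesis unfolding cross_def aux h by (simp add: add.commute)
qed

lemma cross_word_cup_left: "(\<And>j. j \<in> set w \<Longrightarrow> j + 2 \<le> i) \<Longrightarrow> cross_word w * cup i = cup i * cross_word w"
proof (induction w)
  case (Cons j w)
  have "cross_word (j # w) * cup i = cross j * (cross_word w * cup i)" by (simp add: mult.assoc)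
  also have "\<dots> = (cross j * cup i) * cross_word w" using Cons by (simp add: mult.assoc)
  also have "\<dots> = (cup i * cross j) * cross_word w" using Cons.prems by (simp only: cross_cup_left list.set_intros)
  finally show ?case by (simp add: mult.assoc)
qed simp

lemma cross_word_cup_right:
  "(\<And>j. j \<in> set w \<Longrightarrow> i \<le> j) \<Longrightarrow> cross_word (map (\<lambda>j. Suc (Suc j)) w) * cup i = cup i * cross_word w"
proof (induction w)
  case (Cons j w)
  have "cross_word (map (\<lambda>j. Suc (Suc j)) (j # w)) * cup i
      = cross (Suc (Suc j)) * (cross_word (map (\<lambda>j. Suc (Suc j)) w) * cup i)" by (simp add: mult.assoc)
  also have "\<dots> = (cross (Suc (Suc j)) * cup i) * cross_word w" using Cons by (simp add: mult.assoc)
  also have "\<dots> = (cup i * cross j) * cross_word w" using Cons.prems by (simp only: cross_cup_right list.set_intros)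
  finally show ?case by (simp add: mult.assoc)
qed simp

lemma cross_word_cross: "(\<And>j. j \<in> set w \<Longrightarrow> j + 2 \<le> i) \<Longrightarrow> cross_word w * cross i = cross i * cross_word w"
proof (induction w)
  case (Cons j w)
  have "cross_word (j # w) * cross i = cross j * (cross_word w * cross i)" by (simp add: mult.assoc)
  also have "\<dots> = (cross j * cross i) * cross_word w" using Cons by (simp add: mult.assoc)
  also have "\<dots> = (cross i * cross j) * cross_word w" using Cons.prems by (simp only: cross_commute list.set_intros)
  finally show ?case by (simp add: mult.assoc)
qed simp

text \<open>The cup joins two of the strands that the moving strand crosses, so that the row becomes
  shorter by two crossings.\<close>

lemma row_slide_over:
  "b \<le> p \<Longrightarrow> cross_word (band_row a (Suc (Suc p))) * cup (a + b + 2) = cup (a + b + 1) * cross_word (band_row a p)"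
proof (induction p)
  case 0
  then show ?case using cross_slide2[of "Suc a"] by (simp add: mult.assoc)
next
  case (Suc p)
  show ?case
  proof (cases "b = Suc p")
    case True
    have "cross_word (band_row a (Suc p)) * cup (a + b + 2) = cup (a + b + 2) * cross_word (band_row a (Suc p))"
      using True by (intro cross_word_cup_left) (auto simp only: set_band_row greaterThanAtMost_iff)
    then have "cross_word (band_row a (Suc (Suc (Suc p)))) * cup (a + b + 2)
        = cross (Suc (a + b + 1)) * (cross (a + b + 1) * cup (Suc (a + b + 1))) * cross_word (band_row a (Suc p))"
      using True by (simp add: mult.assoc)
    then show ?thesis by (simp only: cross_slide2)
  next
    case False
    with Suc.prems have b: "b \<le> p" by simp
    have "cross_word (band_row a (Suc (Suc (Suc p)))) * cup (a + b + 2)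
        = cross (a + Suc (Suc (Suc p))) * (cross_word (band_row a (Suc (Suc p))) * cup (a + b + 2))"
      by (simp add: mult.assoc)
    also have "\<dots> = (cross (Suc (Suc (a + Suc p))) * cup (a + b + 1)) * cross_word (band_row a p)"
      unfolding Suc.IH[OF b] by (simp add: mult.assoc)
    also have "\<dots> = (cup (a + b + 1) * cross (a + Suc p)) * cross_word (band_row a p)"
      using b by (subst cross_cup_right) simp_all
    finally show ?thesis by (simp add: mult.assoc)
  qed
qed

text \<open>The cup joins two moving strands, so that both rows disappear.\<close>

lemma rows_slide_under:
  "cross_word (band_row a p) * (cross_word (band_row (Suc a) p) * cup (Suc a)) = cup (Suc a + p)"
proof (induction p)
  case (Suc p)
  have c: "cross_word (band_row a p) * cross (Suc (Suc (a + p))) = cross (Suc (Suc (a + p))) * cross_word (band_row a p)"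
    by (intro cross_word_cross) (auto simp: set_band_row)
  have "cross_word (band_row a (Suc p)) * (cross_word (band_row (Suc a) (Suc p)) * cup (Suc a))
      = cross (Suc (a + p)) * (cross_word (band_row a p) * cross (Suc (Suc (a + p)))) * (cross_word (band_row (Suc a) p) * cup (Suc a))"
    by (simp add: mult.assoc)
  also have "\<dots> = cross (Suc (a + p)) * (cross (Suc (Suc (a + p))) *
      (cross_word (band_row a p) * (cross_word (band_row (Suc a) p) * cup (Suc a))))"
    unfolding c by (simp only: mult.assoc)
  also have "\<dots> = cup (Suc a + Suc p)"
    unfolding Suc.IH using cross_slide1[of "Suc (a + p)"] by simp
  finally show ?case .
qed simp

lemma grid_slide_under:
  "b \<le> q \<Longrightarrow> cross_word (grid a p (Suc (Suc q))) * cup (a + b + 1) = cup (a + p + b + 1) * cross_word (grid a p q)"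
proof (induction b arbitrary: a q)
  case 0
  have "cross_word (grid (Suc (Suc a)) p q) * cup (Suc a) = cup (Suc a) * cross_word (grid a p q)"
    unfolding grid_shift using set_grid[of a p q] by (intro cross_word_cup_right) force
  then have "cross_word (grid a p (Suc (Suc q))) * cup (Suc a)
      = (cross_word (band_row a p) * (cross_word (band_row (Suc a) p) * cup (Suc a))) * cross_word (grid a p q)"
    by (simp add: mult.assoc)
  then show ?case by (simp add: rows_slide_under add.commute)
next
  case (Suc b)
  then obtain q' where q: "q = Suc q'" "b \<le> q'" by (cases q) auto
  have "cross_word (grid a p (Suc (Suc q))) * cup (a + Suc b + 1)
      = cross_word (band_row a p) * (cross_word (grid (Suc a) p (Suc (Suc q'))) * cup (Suc a + b + 1))"
    by (simp add: q mult.assoc)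
  also have "\<dots> = (cross_word (band_row a p) * cup (Suc a + p + b + 1)) * cross_word (grid (Suc a) p q')"
    unfolding Suc.IH[OF q(2)] by (simp only: mult.assoc)
  also have "cross_word (band_row a p) * cup (Suc a + p + b + 1) = cup (Suc a + p + b + 1) * cross_word (band_row a p)"
    by (intro cross_word_cup_left) (auto simp: set_band_row)
  finally show ?case by (simp add: q mult.assoc)
qed

lemma grid_slide_over:
  "b \<le> p \<Longrightarrow> cross_word (grid a (Suc (Suc p)) q) * cup (a + q + b + 1) = cup (a + b + 1) * cross_word (grid a p q)"
proof (induction q arbitrary: a)
  case (Suc q)
  have "cross_word (grid a (Suc (Suc p)) (Suc q)) * cup (a + Suc q + b + 1)
      = cross_word (band_row a (Suc (Suc p))) * (cross_word (grid (Suc a) (Suc (Suc p)) q) * cup (Suc a + q + b + 1))"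
    by (simp add: mult.assoc)
  also have "\<dots> = (cross_word (band_row a (Suc (Suc p))) * cup (a + b + 2)) * cross_word (grid (Suc a) p q)"
    unfolding Suc.IH[OF Suc.prems] by (simp add: mult.assoc)
  also have "\<dots> = cup (a + b + 1) * cross_word (grid a p (Suc q))"
    unfolding row_slide_over[OF Suc.prems] by (simp add: mult.assoc)
  finally show ?case .
qed simp

text \<open>The cup enters at the bottom of band \<open>b\<close> and leaves at the top of the same
  band, whose top position is \<open>perm js b\<close>. On its way this band loses two strands
  throughout, which is why the cable on the right has another size function.\<close>

lemma cable_slide:
  assumes "set js \<subseteq> {1..<m}" "b \<in> {1..m}" "r + 2 \<le> ns (perm js b)"
  shows "cross_word (cable ns js) * cup (offset (ns \<circ> perm js) b + r + 1)
    = cup (offset ns (perm js b) + r + 1) * cross_word (cable (ns(perm js b := ns (perm js b) - 2)) js)"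
  using assms(1,3)
proof (induction js arbitrary: ns)
  case (Cons j js)
  define ns1 where "ns1 = ns \<circ> transpose j (Suc j)"
  define c' where "c' = perm js b"
  define c where "c = transpose j (Suc j) c'"
  define ns' where "ns' = ns(c := ns c - 2)"
  have c: "perm (j # js) b = c" by (simp add: c_def c'_def)
  have nc: "ns1 c' = ns c" "r + 2 \<le> ns c" using Cons.prems(2) by (simp_all add: ns1_def c_def c'_def)
  have j: "1 \<le> j" using Cons.prems by simp
  have c'1: "1 \<le> c'"
    using permutes_in_image[OF perm_permutes[of js m], of b] Cons.prems(1) assms(2) by (simp add: c'_def)
  have ns1': "ns1(c' := ns1 c' - 2) = ns' \<circ> transpose j (Suc j)"
    by (auto simp: fun_eq_iff ns1_def ns'_def c_def) (metis transpose_involutory)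
  have grid: "cross_word (grid (offset ns j) (ns j) (ns (Suc j))) * cup (offset ns1 c' + r + 1)
      = cup (offset ns c + r + 1) * cross_word (grid (offset ns' j) (ns' j) (ns' (Suc j)))"
  proof -
    \<comment> \<open>The cup sits in the band that moves right or in the one that moves left as the
      crossing is passed upwards, or to the left or right of the crossing. To its left, the letters
      of the crossing drop by two.\<close>
    consider "c' = j" | "c' = Suc j" | "c' < j" | "Suc j < c'" by linarith
    then show ?thesis
    proof cases
      case 1
      then have cj: "c = Suc j" by (simp add: c_def)
      have q: "ns (Suc j) = Suc (Suc (ns (Suc j) - 2))" using nc cj by simp
      have "r \<le> ns (Suc j) - 2" using nc cj by simp
      from grid_slide_under[OF this, of "offset ns j" "ns j"] show ?thesis
        unfolding q[symmetric] using 1 cj j offset_transpose[of j j ns]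
        by (simp add: ns'_def ns1_def offset_update_above offset_Suc)
    next
      case 2
      then have cj: "c = j" by (simp add: c_def)
      have q: "ns j = Suc (Suc (ns j - 2))" using nc cj by simp
      have "r \<le> ns j - 2" using nc cj by simp
      from grid_slide_over[OF this, of "offset ns j" "ns (Suc j)"] show ?thesis
        unfolding q[symmetric] using 2 cj j offset_transpose[of j j ns]
        by (simp add: ns'_def ns1_def offset_update_above offset_Suc)
    next
      case 3
      then have cc: "c = c'" by (simp add: c_def transpose_def)
      have o: "offset ns j = Suc (Suc (offset ns' j))"
        using offset_update_below[of c j ns] 3 cc c'1 nc by (simp add: ns'_def)
      have "offset ns c + r + 2 \<le> offset ns j"
        using offset_less[of c j ns] 3 cc c'1 nc by simp
      then have "cross_word (grid (offset ns j) (ns j) (ns (Suc j))) * cup (offset ns c + r + 1)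
          = cup (offset ns c + r + 1) * cross_word (grid (offset ns' j) (ns j) (ns (Suc j)))"
        unfolding o grid_shift using set_grid[of "offset ns' j" "ns j" "ns (Suc j)"]
        by (intro cross_word_cup_right) force
      moreover have "offset ns1 c' = offset ns c" using 3 cc j by (simp add: ns1_def offset_transpose)
      moreover have "ns' j = ns j" "ns' (Suc j) = ns (Suc j)" using 3 cc by (auto simp: ns'_def)
      ultimately show ?thesis by simp
    next
      case 4
      then have cc: "c = c'" by (simp add: c_def transpose_def)
      have "offset ns j + ns j + ns (Suc j) \<le> offset ns c"
        using offset_less[of "Suc j" c ns] 4 cc j by (simp add: offset_Suc)
      then have "cross_word (grid (offset ns j) (ns j) (ns (Suc j))) * cup (offset ns c + r + 1)
          = cup (offset ns c + r + 1) * cross_word (grid (offset ns j) (ns j) (ns (Suc j)))"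
        using set_grid[of "offset ns j" "ns j" "ns (Suc j)"] by (intro cross_word_cup_left) force
      moreover have "offset ns1 c' = offset ns c" using 4 cc j by (simp add: ns1_def offset_transpose)
      moreover have "ns' j = ns j" "ns' (Suc j) = ns (Suc j)" "offset ns' j = offset ns j"
        using 4 cc by (auto simp: ns'_def offset_update_above)
      ultimately show ?thesis by simp
    qed
  qed
  have "cross_word (cable ns (j # js)) * cup (offset (ns \<circ> perm (j # js)) b + r + 1)
      = cross_word (grid (offset ns j) (ns j) (ns (Suc j))) *
        (cross_word (cable ns1 js) * cup (offset (ns1 \<circ> perm js) b + r + 1))"
    by (simp add: ns1_def mult.assoc o_assoc)
  also have "cross_word (cable ns1 js) * cup (offset (ns1 \<circ> perm js) b + r + 1)
      = cup (offset ns1 c' + r + 1) * cross_word (cable (ns' \<circ> transpose j (Suc j)) js)"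
    unfolding ns1'[symmetric] c'_def using Cons.prems(1) nc by (intro Cons.IH) (simp_all add: c'_def)
  also have "cross_word (grid (offset ns j) (ns j) (ns (Suc j))) * \<dots>
      = (cross_word (grid (offset ns j) (ns j) (ns (Suc j))) * cup (offset ns1 c' + r + 1))
        * cross_word (cable (ns' \<circ> transpose j (Suc j)) js)"
    by (simp only: mult.assoc)
  also have "\<dots> = cup (offset ns c + r + 1) * cross_word (cable ns' (j # js))"
    unfolding grid by (simp add: mult.assoc)
  finally show ?case unfolding c ns'_def .
qed simp

end

section \<open>Comparison with the blackboard parallel\<close>

lemma band_row_map: "band_row a p = map (\<lambda>b. a + p - b) [0..<p]"
proof (induction p)
  case (Suc p)
  have "map (\<lambda>b. a + Suc p - b) [0..<Suc p] = (a + Suc p) # map (\<lambda>b. a + Suc p - b) (map Suc [0..<p])"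
    by (simp add: upt_conv_Cons map_Suc_upt del: upt_Suc)
  then show ?case using Suc by (simp add: comp_def)
qed simp

lemma grid_map: "grid a p q = concat (map (\<lambda>r. band_row (a + r) p) [0..<q])"
proof (induction q arbitrary: a)
  case (Suc q)
  have "concat (map (\<lambda>r. band_row (a + r) p) [0..<Suc q])
      = band_row a p @ concat (map (\<lambda>r. band_row (a + r) p) (map Suc [0..<q]))"
    by (simp add: upt_conv_Cons map_Suc_upt del: upt_Suc)
  then show ?case using Suc by (simp add: comp_def)
qed simp

lemma offset_const: "offset (\<lambda>_. k) j = (j - 1) * k"
  by (simp add: offset_def)

lemma parallel_word_cable:
  "0 \<notin> set js \<Longrightarrow> parallel_word k (map Gen js) = map Gen (cable (\<lambda>_. k) js)"
proof (induction js)
  case (Cons j js)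
  then obtain i where j: "j = Suc i" by (cases j) auto
  have "band_crossing k j = grid (offset (\<lambda>_. k) j) k k"
    unfolding band_crossing_def grid_map band_row_map
    by (intro arg_cong[where f = concat] map_cong refl) (simp add: offset_const j algebra_simps)
  then show ?case using Cons by (simp add: parallel_word_def comp_def)
qed (simp add: parallel_word_def)

lemma set_cable:
  assumes "set js \<subseteq> {1..<m}"
  shows "set (cable ns js) \<subseteq> {1..<offset ns (Suc m)}"
  using assms
proof (induction js arbitrary: ns)
  case (Cons j js)
  have j: "1 \<le> j" "j < m" using Cons.prems by auto
  have "offset ns j + ns j + ns (Suc j) \<le> offset ns (Suc m)"
    using offset_less[of "Suc j" "Suc m" ns] j by (simp add: offset_Suc)
  then have "set (grid (offset ns j) (ns j) (ns (Suc j))) \<subseteq> {1..<offset ns (Suc m)}"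
    using set_grid[of "offset ns j" "ns j" "ns (Suc j)"] by force
  moreover have "set (cable (ns \<circ> transpose j (Suc j)) js) \<subseteq> {1..<offset (ns \<circ> transpose j (Suc j)) (Suc m)}"
    using Cons by simp
  moreover have "offset (ns \<circ> transpose j (Suc j)) (Suc m) = offset ns (Suc m)"
    using j by (intro offset_transpose) auto
  ultimately show ?case by simp
qed simp

text \<open>An operator that turns \<open>K\<close> strands into \<open>K'\<close> strands and lets cups further right pass.\<close>

definition (in tl_rep) tangle :: "nat \<Rightarrow> nat \<Rightarrow> 'a linop \<Rightarrow> bool" where
  "tangle K' K Y \<longleftrightarrow> (\<forall>r\<ge>1. Y * cup (K + r) = cup (K' + r) * Y)"

context tl_rep
begin

lemma tangle_one: "tangle K K 1"
  and tangle_diff: "tangle K' K Y \<Longrightarrow> tangle K' K Z \<Longrightarrow> tangle K' K (Y - Z)"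
  by (simp_all add: tangle_def left_diff_distrib right_diff_distrib)

lemma tangle_scalar: "tangle K' K Y \<Longrightarrow> tangle K' K (scalar c * Y)"
  unfolding tangle_def by (simp add: mult.assoc scalar_left_commute)

lemma tangle_mult:
  assumes "tangle K'' K' Y" "tangle K' K Z"
  shows "tangle K'' K (Y * Z)"
  unfolding tangle_def
proof (intro allI impI)
  fix r :: nat assume r: "1 \<le> r"
  have "Y * Z * cup (K + r) = Y * (Z * cup (K + r))" by (simp only: mult.assoc)
  also have "\<dots> = (Y * cup (K' + r)) * Z" using assms(2) r by (simp add: tangle_def mult.assoc)
  also have "\<dots> = cup (K'' + r) * (Y * Z)" using assms(1) r by (simp add: tangle_def mult.assoc)
  finally show "Y * Z * cup (K + r) = cup (K'' + r) * (Y * Z)" .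
qed

lemma tangle_cup: "i \<le> Suc K \<Longrightarrow> tangle (Suc (Suc K)) K (cup i)"
  using cup_cup[of i] by (simp add: tangle_def)

lemma tangle_cap: "i \<le> Suc K \<Longrightarrow> tangle K (Suc (Suc K)) (cap i)"
  using cap_cup_left[of i] by (simp add: tangle_def)

lemma tangle_hook: "Suc i \<le> K \<Longrightarrow> tangle K K (hook i)"
proof -
  assume i: "Suc i \<le> K"
  show "tangle K K (hook i)"
  proof (cases "2 \<le> K")
    case True
    then obtain K' where K: "K = Suc (Suc K')" by (metis add_2_eq_Suc le_Suc_ex)
    show ?thesis unfolding hook_def K by (rule tangle_mult[OF tangle_cup tangle_cap]) (use i K in auto)
  next
    case False
    then have K: "K = 1" "i = 0" using i by auto
    show ?thesis unfolding K tangle_def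
    proof (intro allI impI)
      fix r :: nat assume "1 \<le> r"
      then obtain r' where r: "r = Suc r'" by (cases r) auto
      have "hook 0 * cup (Suc (Suc r')) = cup 0 * (cap 0 * cup (Suc (Suc r')))" by (simp add: hook_def mult.assoc)
      also have "\<dots> = (cup 0 * cup r') * cap 0" by (simp add: cap_cup_left mult.assoc)
      also have "\<dots> = cup (Suc (Suc r')) * hook 0" by (simp add: cup_cup hook_def mult.assoc)
      finally show "hook 0 * cup (1 + r) = cup (1 + r) * hook 0" by (simp add: r)
    qed
  qed
qed

end

text \<open>The knot hypothesis in the form in which it is used: starting from 1, the permutation
  visits every band exactly once before it returns.\<close>

locale kauffman_knot = kauffman A for A :: "'a::field" +
  fixes m :: nat and js :: "nat list"
  assumes m: "1 \<le> m" and js: "set js \<subseteq> {1..<m}"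
    and orbit: "bij_betw (\<lambda>t. (perm js ^^ t) 1) {..<m} {1..m}"
    and cyclic: "(perm js ^^ m) 1 = 1"
begin

text \<open>\<open>Y\<close> stands below the whole cable; if it is a tangle on \<open>k\<close>
  strands, it fills the first band only.\<close>

definition cable_trace :: "nat \<Rightarrow> 'a linop \<Rightarrow> 'a" where
  "cable_trace k Y = trace 0 (m * k) (cross_word (cable (\<lambda>_. k) js) * Y)"

lemma cable_trace_simps:
  "cable_trace k (Y + Z) = cable_trace k Y + cable_trace k Z"
  "cable_trace k (Y - Z) = cable_trace k Y - cable_trace k Z"
  "cable_trace k (scalar c * Y) = c * cable_trace k Y"
  by (simp_all add: cable_trace_def distrib_left right_diff_distrib trace_add trace_diff
      trace_scalar scalar_left_commute)

text \<open>The cup is carried once around the knot, deleting two strands of each band that it passes.\<close>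

lemma cable_trace_cup:
  assumes "1 \<le> i" "i \<le> Suc k" and Y: "tangle k (Suc (Suc k)) Y"
  shows "cable_trace (Suc (Suc k)) (cup i * Y) = cable_trace k (Y * cup i)"
proof -
  define \<pi> where "\<pi> = perm js"
  define x where "x t = (\<pi> ^^ t) 1" for t
  have perm: "\<pi> permutes {1..m}" unfolding \<pi>_def by (rule perm_permutes[OF js])
  have x0: "x 0 = 1" and x_Suc: "x (Suc t) = \<pi> (x t)" for t by (simp_all add: x_def)
  have xm: "x m = 1" using cyclic by (simp add: x_def \<pi>_def)
  have x_in: "x t \<in> {1..m}" for t
  proof (induction t)
    case 0
    then show ?case using m by (simp add: x0)
  next
    case (Suc t)
    then show ?case unfolding x_Suc permutes_in_image[OF perm] .
  qed
  have inj: "inj_on x {..<m}" and img: "x ` {..<m} = {1..m}"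
    using orbit unfolding bij_betw_def x_def \<pi>_def by auto
  have inj': "x s \<noteq> x t" if "s < t" "t \<le> m" "0 < s" for s t
  proof (cases "t = m")
    case True
    then have "x s \<noteq> x 0" using inj_on_eq_iff[OF inj, of s 0] that m by simp
    then show ?thesis using True by (simp add: xm x0)
  next
    case False
    then show ?thesis using inj_on_eq_iff[OF inj, of s t] that by simp
  qed
  \<comment> \<open>Sizes at the top after \<open>t\<close> passages: the bands \<open>x 1\<close>,
    ..., \<open>x t\<close> have lost two strands. Band 1 is the last to do so, since
    \<open>x m = 1\<close>.\<close>
  define ns where "ns t b = (if b \<in> x ` {1..t} then k else Suc (Suc k))" for t b
  have ns_Suc: "ns (Suc t) = (ns t)(x (Suc t) := ns t (x (Suc t)) - 2)" "ns t (x (Suc t)) = Suc (Suc k)" if "t < m" for t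
  proof -
    have "x (Suc t) \<notin> x ` {1..t}"
    proof
      assume "x (Suc t) \<in> x ` {1..t}"
      then obtain s where "1 \<le> s" "s \<le> t" "x (Suc t) = x s" by auto
      then show False using inj'[of s "Suc t"] that by simp
    qed
    then show "ns t (x (Suc t)) = Suc (Suc k)" by (simp add: ns_def)
    have "{1..Suc t} = insert (Suc t) {1..t}" by auto
    then show "ns (Suc t) = (ns t)(x (Suc t) := ns t (x (Suc t)) - 2)"
      using \<open>ns t (x (Suc t)) = Suc (Suc k)\<close> by (auto simp: ns_def fun_eq_iff)
  qed
  define r where "r = i - 1"
  have r: "i = r + 1" "r \<le> k" using assms by (auto simp: r_def)
  \<comment> \<open>Stage \<open>t\<close>: the cup stands at the bottom of band \<open>x t\<close>,
    above \<open>Y\<close>, and is about to make passage \<open>t + 1\<close>.\<close>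
  define V where "V t = trace 0 (offset (ns t) (Suc m))
      (cross_word (cable (ns t) js) * cup (offset (ns t \<circ> \<pi>) (x t) + r + 1) * Y)" for t
  have bot: "ns (Suc t) \<circ> \<pi> = (ns t)(1 := k)" if "Suc t < m" for t
  proof
    fix b
    have "\<pi> b \<in> x ` {1..Suc t} \<longleftrightarrow> b \<in> x ` {0..t}"
    proof -
      have "x ` {1..Suc t} = \<pi> ` x ` {0..t}"
      proof -
        have "{1..Suc t} = Suc ` {0..t}" by (simp add: image_Suc_atLeastAtMost)
        then show ?thesis by (simp only: image_image x_Suc)
      qed
      then show ?thesis using permutes_inj[OF perm] by (simp add: inj_image_mem_iff)
    qed
    moreover have "{0..t} = insert 0 {1..t}" by auto
    ultimately show "(ns (Suc t) \<circ> \<pi>) b = ((ns t)(1 := k)) b" by (auto simp: ns_def x0)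
  qed
  \<comment> \<open>One passage: up through the cable by \<open>cable_slide\<close>, then from the
    top to the bottom of the closure by \<open>trace_cup\<close>.\<close>
  have step: "V t = trace 0 (offset (ns (Suc t)) (Suc m))
      (cross_word (cable (ns (Suc t)) js) * (Y * cup (offset (ns t) (x (Suc t)) + r + 1)))" if t: "t < m" for t
  proof -
    have c: "1 \<le> x (Suc t)" "x (Suc t) < Suc m" using x_in[of "Suc t"] by auto
    have off: "Suc (Suc (offset (ns (Suc t)) (Suc m))) = offset (ns t) (Suc m)"
      unfolding ns_Suc(1)[OF t] using c ns_Suc(2)[OF t] by (intro offset_update_below) auto
    have "cross_word (cable (ns t) js) * cup (offset (ns t \<circ> \<pi>) (x t) + r + 1)
        = cup (offset (ns t) (x (Suc t)) + r + 1) * cross_word (cable (ns (Suc t)) js)"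
      unfolding ns_Suc(1)[OF t] x_Suc \<pi>_def
      using r x_in[of t] ns_Suc(2)[OF t] by (intro cable_slide[OF js]) (simp_all add: x_Suc \<pi>_def)
    then have "V t = trace 0 (Suc (Suc (offset (ns (Suc t)) (Suc m))))
       (cup (offset (ns t) (x (Suc t)) + r + 1) * (cross_word (cable (ns (Suc t)) js) * Y))"
      unfolding V_def off by (simp only: mult.assoc)
    also have "\<dots> = trace 0 (offset (ns (Suc t)) (Suc m))
       (cross_word (cable (ns (Suc t)) js) * Y * cup (offset (ns t) (x (Suc t)) + r + 1))"
      using offset_less[OF c, of "ns t"] ns_Suc(2)[OF t] r off by (intro trace_cup) auto
    finally show ?thesis by (simp only: mult.assoc)
  qed
  have V_Suc: "V t = V (Suc t)" if t: "Suc t < m" for t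
  proof -
    have "x (Suc t) \<noteq> x m" using inj'[of "Suc t" m] t by simp
    then have c: "1 < x (Suc t)" using x_in[of "Suc t"] xm by force
    have "1 \<notin> x ` {1..t}"
    proof
      assume "1 \<in> x ` {1..t}"
      then obtain s where "1 \<le> s" "s \<le> t" "x s = 1" by auto
      then show False using inj'[of s m] t xm by simp
    qed
    then have n1: "ns t 1 = Suc (Suc k)" by (simp add: ns_def)
    have o: "Suc (Suc (offset (ns (Suc t) \<circ> \<pi>) (x (Suc t)))) = offset (ns t) (x (Suc t))"
      unfolding bot[OF t] using offset_update_below[of 1 "x (Suc t)" "ns t"] c n1 by simp
    define q where "q = offset (ns (Suc t) \<circ> \<pi>) (x (Suc t)) - k"
    have "k \<le> offset (ns (Suc t) \<circ> \<pi>) (x (Suc t))"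
      using offset_less[of 1 "x (Suc t)" "ns (Suc t) \<circ> \<pi>"] c by (simp add: bot[OF t])
    then have q: "offset (ns t) (x (Suc t)) + r + 1 = Suc (Suc k) + (q + r + 1)"
      "offset (ns (Suc t) \<circ> \<pi>) (x (Suc t)) + r + 1 = k + (q + r + 1)"
      using o by (auto simp: q_def)
    \<comment> \<open>The cup is now in a band other than the first, so that it can pass
      \<open>Y\<close>. Only after the last passage does it meet \<open>Y\<close> in the first
      band.\<close>
    have "Y * cup (offset (ns t) (x (Suc t)) + r + 1) = cup (offset (ns (Suc t) \<circ> \<pi>) (x (Suc t)) + r + 1) * Y"
      unfolding q by (rule Y[unfolded tangle_def, rule_format]) simp
    then show ?thesis unfolding step[OF Suc_lessD[OF t]] by (simp only: V_def mult.assoc)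
  qed
  have "V 0 = V (m - 1)"
  proof -
    have "t < m \<Longrightarrow> V 0 = V t" for t by (induction t) (auto simp: V_Suc)
    then show ?thesis using m by simp
  qed
  moreover have "V 0 = cable_trace (Suc (Suc k)) (cup i * Y)"
  proof -
    have "ns 0 = (\<lambda>_. Suc (Suc k))" by (auto simp: ns_def)
    then show ?thesis unfolding V_def cable_trace_def
      by (simp add: x0 r offset_const comp_def mult.assoc)
  qed
  moreover have "V (m - 1) = cable_trace k (Y * cup i)"
  proof -
    have m1: "Suc (m - 1) = m" using m by simp
    have nsm: "ns m b = k" if b: "b \<in> {1..m}" for b
    proof -
      obtain t where t: "t < m" "b = x t" using img b by force
      show ?thesis
      proof (cases "t = 0")
        case True
        then have "b = x m" using t by (simp add: x0 xm)
        then show ?thesis using m by (simp add: ns_def)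
      next
        case False
        then show ?thesis using t by (simp add: ns_def)
      qed
    qed
    have "cable (ns m) js = cable (\<lambda>_. k) js" by (rule cable_cong[OF js]) (simp add: nsm)
    moreover have "offset (ns m) (Suc m) = m * k"
      using offset_cong[of "Suc m" "ns m" "\<lambda>_. k"] nsm by (simp add: offset_const)
    ultimately show ?thesis
      using step[of "m - 1"] m by (simp add: m1 xm cable_trace_def r)
  qed
  ultimately show ?thesis by simp
qed

end

section \<open>Jones-Wenzl projectors\<close>

context kauffman
begin

text \<open>The quantum integer \<open>[k + 1]\<close> in the variable \<open>A^2\<close>, with sign
  \<open>(-1)^k\<close>; by \<open>trace_jw\<close> it is the value of the closed projector.\<close>

fun quantum :: "nat \<Rightarrow> 'a" where
  "quantum 0 = 1"
| "quantum (Suc 0) = loop_value"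
| "quantum (Suc (Suc k)) = loop_value * quantum (Suc k) - quantum k"

text \<open>Wenzl's recursion. Its coefficient is the inverse of the factor in
  \<open>jw_partial_trace\<close>, which is what makes the projector vanish on the newest cup and
  cap.\<close>

fun jw :: "nat \<Rightarrow> 'a linop" where
  "jw 0 = 1"
| "jw (Suc 0) = 1"
| "jw (Suc (Suc k)) = jw (Suc k) - scalar (quantum k / quantum (Suc k)) * (jw (Suc k) * hook (Suc k) * jw (Suc k))"

lemma local_op_jw: "local_op k (jw k)"
proof (induction k rule: jw.induct)
  case (3 k)
  have "local_op (Suc (Suc k)) (jw (Suc k))" using 3 local_op_mono by (metis lessI less_imp_le)
  then show ?case
    by (auto intro!: local_op_diff local_op_mult local_op_scalar local_op_hook_less)
qed (simp_all add: local_op_one)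

lemma tangle_jw: "k \<le> K \<Longrightarrow> tangle K K (jw k)"
proof (induction k rule: jw.induct)
  case (3 k)
  then show ?case
    by (auto intro!: tangle_diff tangle_scalar tangle_mult tangle_hook)
qed (simp_all add: tangle_one)

lemma jw_cup: "k < j \<Longrightarrow> jw k * cup j = cup j * jw k"
  using tangle_jw[of k k, unfolded tangle_def, rule_format, of "j - k"] by simp

lemma cap_hook: "i + 2 \<le> j \<Longrightarrow> cap j * hook i = hook i * cap j"
proof -
  assume "i + 2 \<le> j"
  then obtain j' where j: "j = Suc (Suc j')" "i \<le> j'" by (cases j rule: nat.exhaust; cases "j - 1"; force)
  have "cap j * hook i = (cap j * cup i) * cap i" by (simp add: hook_def mult.assoc)
  also have "\<dots> = cup i * (cap j' * cap i)" using j by (simp add: cap_cup_right mult.assoc)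
  also have "\<dots> = hook i * cap j" using j by (simp add: cap_cap[symmetric] hook_def mult.assoc)
  finally show ?thesis .
qed

lemma cap_jw: "k < j \<Longrightarrow> cap j * jw k = jw k * cap j"
proof (induction k rule: jw.induct)
  case (3 k)
  have f: "cap j * jw (Suc k) = jw (Suc k) * cap j" using 3 by simp
  have h: "cap j * hook (Suc k) = hook (Suc k) * cap j" using 3 by (intro cap_hook) simp
  have "cap j * (jw (Suc k) * hook (Suc k) * jw (Suc k)) = (cap j * jw (Suc k)) * hook (Suc k) * jw (Suc k)"
    by (simp only: mult.assoc)
  also have "\<dots> = jw (Suc k) * (cap j * hook (Suc k)) * jw (Suc k)" unfolding f by (simp only: mult.assoc)
  also have "\<dots> = jw (Suc k) * hook (Suc k) * (cap j * jw (Suc k))" unfolding h by (simp only: mult.assoc)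
  also have "\<dots> = (jw (Suc k) * hook (Suc k) * jw (Suc k)) * cap j" unfolding f by (simp only: mult.assoc)
  finally have fhf: "cap j * (jw (Suc k) * hook (Suc k) * jw (Suc k)) = (jw (Suc k) * hook (Suc k) * jw (Suc k)) * cap j" .
  show ?case
    unfolding jw.simps right_diff_distrib left_diff_distrib f scalar_left_commute fhf
    by (simp only: mult.assoc)
qed simp_all

end

locale kauffman_generic = kauffman +
  assumes quantum_nz: "quantum k \<noteq> 0"
begin

text \<open>Idempotence is an assumption here because the induction that proves it, in
  \<open>jw_properties\<close>, already uses this partial trace.\<close>

lemma jw_partial_trace_aux:
  assumes "jw k * jw k = jw k"
  shows "cap (Suc k) * jw (Suc k) * cup (Suc k) = scalar (quantum (Suc k) / quantum k) * jw k"
proof (cases k)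
  case 0
  then show ?thesis by (simp add: cap_cup)
next
  case (Suc k')
  define c where "c = quantum k' / quantum k"
  define f where "f = jw k"
  have comm: "cap (Suc k) * f = f * cap (Suc k)" "f * cup (Suc k) = cup (Suc k) * f"
    unfolding f_def by (auto intro: cap_jw jw_cup)
  have "cap (Suc k) * jw (Suc k) * cup (Suc k)
      = cap (Suc k) * f * cup (Suc k) - scalar c * ((cap (Suc k) * f) * hook k * (f * cup (Suc k)))"
    unfolding Suc jw.simps by (simp only: right_diff_distrib left_diff_distrib c_def f_def Suc mult.assoc scalar_left_commute)
  also have "\<dots> = f * (cap (Suc k) * cup (Suc k)) - scalar c * (f * ((cap (Suc k) * cup k) * (cap k * cup (Suc k))) * f)"
    unfolding comm hook_def by (simp only: mult.assoc)
  also have "\<dots> = scalar loop_value * f - scalar c * (f * f)"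
    unfolding cap_cup cap_cup_Suc cap_Suc_cup by (simp add: scalar_commute)
  also have "\<dots> = scalar (loop_value - c) * f"
    using assms by (simp add: f_def scalar_simps left_diff_distrib)
  also have "loop_value - c = quantum (Suc k) / quantum k"
    using quantum_nz[of k] unfolding Suc c_def by (simp add: field_simps)
  finally show ?thesis by (simp add: f_def)
qed

text \<open>The statements support each other. Absorption reduces the old cups and caps to the
  induction hypothesis, the partial trace cancels the new ones, and this in turn gives
  idempotence.\<close>

lemma jw_properties:
  "jw (Suc k) * jw (Suc k) = jw (Suc k) \<and> jw k * jw k = jw k \<and> jw k * jw (Suc k) = jw (Suc k) \<and> jw (Suc k) * jw k = jw (Suc k)
    \<and> (\<forall>i. 1 \<le> i \<longrightarrow> i < Suc k \<longrightarrow> cap i * jw (Suc k) = 0 \<and> jw (Suc k) * cup i = 0)"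
proof (induction k)
  case (Suc k)
  define n where "n = Suc k"
  define f f' F where "f = jw n" and "f' = jw k" and "F = jw (Suc n)"
  define c where "c = quantum k / quantum n"
  define C D where "C = cup n" and "D = cap n"
  have F: "F = f - scalar c * (f * (C * D) * f)"
    by (simp add: F_def f_def n_def c_def C_def D_def hook_def)
  have ff: "f * f = f" "f' * f = f" "f * f' = f" "f' * f' = f'" using Suc by (simp_all add: f_def f'_def n_def)
  have kills: "cap i * f = 0" "f * cup i = 0" if "1 \<le> i" "i < n" for i
    using Suc that by (simp_all add: f_def n_def)
  have comm: "D * f' = f' * D" "f' * C = C * f'"
    unfolding f'_def C_def D_def n_def by (auto intro: cap_jw jw_cup)
  have DfC: "D * f * C = scalar (inverse c) * f'"
    using jw_partial_trace_aux[of k] ff(4) by (simp add: f_def f'_def n_def C_def D_def c_def)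
  have "c \<noteq> 0" using quantum_nz by (simp add: c_def)
  then have cc: "scalar c * (scalar (inverse c) * X) = X" for X :: "'a linop"
    by (simp add: mult.assoc[symmetric] scalar_simps(6)[symmetric] scalar_simps(2))
  have "D * F = D * f - scalar c * ((D * f * C) * (D * f))"
    unfolding F by (simp only: right_diff_distrib scalar_left_commute mult.assoc)
  also have "\<dots> = D * f - scalar c * (scalar (inverse c) * (f' * D * f))"
    unfolding DfC by (simp only: mult.assoc)
  also have "\<dots> = D * f - f' * D * f"
    unfolding cc ..
  also have "\<dots> = 0" unfolding comm(1)[symmetric] mult.assoc ff by simp
  finally have DF: "D * F = 0" .
  have "F * C = f * C - scalar c * ((f * C) * (D * f * C))"
    unfolding F by (simp only: left_diff_distrib mult.assoc)
  also have "(f * C) * (D * f * C) = scalar (inverse c) * (f * (C * f'))"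
    unfolding DfC scalar_left_commute by (simp only: mult.assoc)
  also have "f * C - scalar c * (scalar (inverse c) * (f * (C * f'))) = f * C - (f * f') * C"
    unfolding cc comm(2)[symmetric] by (simp only: mult.assoc)
  also have "\<dots> = 0" unfolding ff by simp
  finally have FC: "F * C = 0" .
  have fF: "f * F = F"
    unfolding F right_diff_distrib scalar_left_commute by (simp only: mult.assoc[symmetric] ff)
  have Ff: "F * f = F"
    unfolding F left_diff_distrib mult.assoc ff ..
  have FF: "F * F = F"
  proof -
    have "F * F = F * f - scalar c * (F * f * (C * D) * f)"
      by (subst (2) F) (simp only: right_diff_distrib scalar_left_commute mult.assoc)
    also have "F * f * (C * D) * f = (F * C) * (D * f)" unfolding Ff by (simp only: mult.assoc)
    finally show ?thesis unfolding FC Ff by simp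
  qed
  have "cap i * F = 0" "F * cup i = 0" if i: "1 \<le> i" "i < Suc n" for i
  proof -
    show "cap i * F = 0"
    proof (cases "i = n")
      case False
      then have "(cap i * f) * F = 0" using kills i by simp
      then show ?thesis unfolding mult.assoc fF .
    qed (use DF in \<open>simp add: D_def\<close>)
    show "F * cup i = 0"
    proof (cases "i = n")
      case False
      then have "F * (f * cup i) = 0" using kills i by simp
      then show ?thesis unfolding mult.assoc[symmetric] Ff .
    qed (use FC in \<open>simp add: C_def\<close>)
  qed
  then show ?case using FF fF Ff ff(1) unfolding F_def f_def n_def by simp
qed simp

lemma jw_idempotent: "jw k * jw k = jw k"
  using jw_properties[of k] by simp

lemma jw_cup_zero: "1 \<le> i \<Longrightarrow> i < k \<Longrightarrow> jw k * cup i = 0"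
  and cap_jw_zero: "1 \<le> i \<Longrightarrow> i < k \<Longrightarrow> cap i * jw k = 0"
  using jw_properties[of "k - 1"] by (auto simp: Suc_diff_Suc[symmetric] split: nat_diff_split_asm)

lemma hook_jw_zero: "1 \<le> i \<Longrightarrow> i < k \<Longrightarrow> hook i * jw k = 0"
  by (simp add: hook_def mult.assoc cap_jw_zero)

lemma jw_partial_trace: "cap (Suc k) * jw (Suc k) * cup (Suc k) = scalar (quantum (Suc k) / quantum k) * jw k"
  by (rule jw_partial_trace_aux[OF jw_idempotent])

lemma trace_jw: "trace 0 k (jw k) = quantum k"
proof (induction k rule: jw.induct)
  case 1
  then show ?case by (simp add: trace_self delta_def)
next
  case 2
  have "trace 0 (Suc 0) 1 = loop_value * trace 0 0 1" by (rule trace_free) (simp_all add: local_op_one)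
  then show ?case by (simp add: trace_self delta_def)
next
  case (3 k)
  have l: "local_op (Suc k) (jw (Suc k))" by (rule local_op_jw)
  have "trace 0 (Suc (Suc k)) (jw (Suc k)) = loop_value * quantum (Suc k)"
    using trace_free[OF _ l, of 0] 3 by simp
  moreover have "trace 0 (Suc (Suc k)) (jw (Suc k) * hook (Suc k) * jw (Suc k)) = quantum (Suc k)"
    using trace_markov[OF _ l l, of 0] 3 by (simp add: jw_idempotent)
  ultimately show ?case using quantum_nz[of "Suc k"] by (simp add: trace_diff trace_scalar)
qed

end

locale kauffman_generic_knot = kauffman_generic A + kauffman_knot A m js for A :: "'a::field" and m js
begin

text \<open>The correction term of Wenzl's recursion contains \<open>cup n\<close>. The induction
  hypothesis strips the projector above it; then the cup travels around the knot, arrives below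
  \<open>Z\<close> and is annihilated there.\<close>

lemma cable_trace_jw_left:
  assumes "k \<le> K" "tangle K K Z" "\<And>j. 1 \<le> j \<Longrightarrow> j < k \<Longrightarrow> Z * cup j = 0"
  shows "cable_trace K (jw k * Z) = cable_trace K Z"
  using assms
proof (induction k arbitrary: Z rule: jw.induct)
  case (3 k)
  define n where "n = Suc k"
  define c where "c = quantum k / quantum n"
  obtain K' where K: "K = Suc (Suc K')" "n \<le> Suc K'" using "3.prems"(1) unfolding n_def
    by (metis Suc_le_D Suc_le_mono)
  define Y where "Y = cap n * (jw n * Z)"
  have Z: "Z * cup j = 0" if "1 \<le> j" "j \<le> n" for j using "3.prems"(3)[of j] that by (simp add: n_def)
  have tj: "tangle K K (jw n)" using K by (intro tangle_jw) simp
  have Y: "tangle K' K Y"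
    unfolding Y_def using K "3.prems"(2) tj by (auto intro!: tangle_mult[OF _ tangle_mult] tangle_cap)
  have "cable_trace K (jw n * (cup n * Y)) = cable_trace K (cup n * Y)"
  proof (rule "3.IH"(2)[folded n_def])
    show "n \<le> K" using K by simp
    have "tangle K K' (cup n)" unfolding K(1) using K(2) by (rule tangle_cup)
    then show "tangle K K (cup n * Y)" using Y by (rule tangle_mult)
    fix j assume "1 \<le> j" "j < n"
    then show "cup n * Y * cup j = 0" using Z[of j] by (simp add: Y_def mult.assoc)
  qed
  also have "\<dots> = cable_trace K' (Y * cup n)"
    unfolding K(1) using K Y by (intro cable_trace_cup) (auto simp: n_def)
  also have "\<dots> = 0" using Z[of n] by (simp add: Y_def mult.assoc n_def cable_trace_def trace_zero)
  finally have 0: "cable_trace K (jw n * (cup n * Y)) = 0" .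
  have "jw (Suc (Suc k)) * Z = jw n * Z - scalar c * (jw n * (cup n * Y))"
    by (simp add: n_def c_def Y_def hook_def left_diff_distrib mult.assoc)
  then have "cable_trace K (jw (Suc (Suc k)) * Z) = cable_trace K (jw n * Z)"
    by (simp add: cable_trace_simps 0)
  also have "\<dots> = cable_trace K Z" unfolding n_def
    using "3.prems" by (intro "3.IH"(1)) auto
  finally show ?case .
qed simp_all

text \<open>The upper projector of the correction term is stripped, the cup goes around the knot and
  closes the last strand of the lower projector, and the resulting factor cancels Wenzl's
  coefficient. What is left is the recursion of \<open>chebyshev_S\<close>.\<close>

lemma cable_trace_jw_rec:
  assumes "k \<le> K"
  shows "cable_trace (Suc (Suc K)) (jw (Suc (Suc k))) = cable_trace (Suc (Suc K)) (jw (Suc k)) - cable_trace K (jw k)"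
proof -
  define n where "n = Suc k"
  have tj: "tangle (Suc (Suc K)) (Suc (Suc K)) (jw n)" using assms by (intro tangle_jw) (simp add: n_def)
  have "cable_trace (Suc (Suc K)) (jw n * (hook n * jw n)) = cable_trace (Suc (Suc K)) (hook n * jw n)"
    using assms tj by (intro cable_trace_jw_left tangle_mult[OF tangle_hook]) (auto simp: n_def mult.assoc jw_cup_zero)
  also have "\<dots> = cable_trace (Suc (Suc K)) (cup n * (cap n * jw n))" by (simp add: hook_def mult.assoc)
  also have "\<dots> = cable_trace K (cap n * jw n * cup n)"
    using assms tj by (intro cable_trace_cup tangle_mult[OF tangle_cap]) (auto simp: n_def)
  also have "\<dots> = quantum n / quantum k * cable_trace K (jw k)"
    unfolding n_def jw_partial_trace by (simp only: cable_trace_simps)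
  finally show ?thesis
    using quantum_nz[of k] quantum_nz[of n] by (simp add: cable_trace_simps n_def mult.assoc)
qed

text \<open>The linear map that sends \<open>z^i\<close> to the closed \<open>(l + i)\<close>-cable.
  Multiplication by \<open>z\<close> becomes a shift of \<open>l\<close>, so that the Chebyshev
  recursion can be followed with \<open>l\<close> arbitrary.\<close>

definition cable_eval :: "nat \<Rightarrow> int poly \<Rightarrow> 'a" where
  "cable_eval l p = (\<Sum>i\<le>degree p. of_int (coeff p i) * cable_trace (l + i) 1)"

lemma cable_eval_bound: "degree p \<le> n \<Longrightarrow> cable_eval l p = (\<Sum>i\<le>n. of_int (coeff p i) * cable_trace (l + i) 1)"
  unfolding cable_eval_def by (intro sum.mono_neutral_left) (auto simp: coeff_eq_0 not_le)

lemma cable_eval_diff: "cable_eval l (p - q) = cable_eval l p - cable_eval l q"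
proof -
  define n where "n = max (degree p) (degree q)"
  have "degree (p - q) \<le> n" "degree p \<le> n" "degree q \<le> n" by (simp_all add: n_def degree_diff_le)
  then show ?thesis by (simp add: cable_eval_bound left_diff_distrib sum_subtractf)
qed

lemma cable_eval_pCons: "cable_eval l (pCons 0 p) = cable_eval (Suc l) p"
proof -
  have "cable_eval l (pCons 0 p) = (\<Sum>i\<le>Suc (degree p). of_int (coeff (pCons 0 p) i) * cable_trace (l + i) 1)"
    by (rule cable_eval_bound) (rule degree_pCons_le)
  also have "\<dots> = cable_eval (Suc l) p"
    by (subst sum.atMost_Suc_shift) (simp add: cable_eval_def)
  finally show ?thesis .
qed

lemma cable_eval_chebyshev: "cable_eval l (chebyshev_S k) = cable_trace (l + k) (jw k)"
proof (induction k arbitrary: l rule: chebyshev_S.induct)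
  case 1
  then show ?case by (simp add: cable_eval_def)
next
  case 2
  then show ?case by (simp add: cable_eval_def)
next
  case (3 k)
  have "cable_eval l (chebyshev_S (Suc (Suc k))) = cable_eval (Suc l) (chebyshev_S (Suc k)) - cable_eval l (chebyshev_S k)"
    by (simp add: cable_eval_diff cable_eval_pCons)
  also have "\<dots> = cable_trace (l + Suc (Suc k)) (jw (Suc (Suc k)))"
    using cable_trace_jw_rec[of k "l + k"] 3 by simp
  finally show ?case .
qed

lemma cable_trace_kauffman:
  "kauffman_bracket A (l * m) (parallel_word l (map Gen js)) = cable_trace l 1"
proof -
  have "0 \<notin> set js" using js by auto
  moreover have "set (cable (\<lambda>_. l) js) \<subseteq> {1..<l * m}"
    using set_cable[OF js, of "\<lambda>_. l"] by (simp add: offset_const mult.commute)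
  ultimately show ?thesis
    by (simp add: parallel_word_cable kauffman_bracket_trace cable_trace_def mult.commute)
qed

text \<open>On hook words both sides are Markov traces from \<open>k\<close> strands on. On
  \<open>k\<close> strands a nonempty word gives 0 on both sides and the empty word gives
  \<open>quantum k\<close>; linearity extends the equality to crossings.\<close>

lemma cable_trace_jw: "cable_trace k (jw k) = quantum k * trace k (m * k) (cross_word (cable (\<lambda>_. k) js))"
proof -
  define M where "M = m * k"
  have "k \<le> M" using m by (simp add: M_def)
  have hooks: "trace 0 M (hook_word u * jw k) = quantum k * trace k M (hook_word u)" if u: "set u \<subseteq> {1..<M}" for u
  proof (rule markov_trace_unique[where k = k and d = loop_value and F = "\<lambda>M u. trace 0 M (hook_word u * jw k)"
        and G = "\<lambda>M u. quantum k * trace k M (hook_word u)"])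
    show "markov_trace k loop_value (\<lambda>M u. trace 0 M (hook_word u * jw k))"
      by (rule markov_trace_hooks[OF local_op_jw]) simp
    have "markov_trace k loop_value (\<lambda>M u. trace k M (hook_word u * 1))"
      by (rule markov_trace_hooks[OF local_op_one]) simp
    then show "markov_trace k loop_value (\<lambda>M u. quantum k * trace k M (hook_word u))"
      unfolding markov_trace_def by simp
  next
    fix v assume v: "set v \<subseteq> {1..<k}"
    show "trace 0 k (hook_word v * jw k) = quantum k * trace k k (hook_word v)"
    proof (cases v rule: rev_cases)
      case Nil
      then show ?thesis by (simp add: trace_jw trace_self delta_def)
    next
      case (snoc w i)
      then have "hook i * jw k = 0" using v by (intro hook_jw_zero) auto
      \<comment> \<open>The row of the vacuum in the matrix of a hook is 0, since
        \<open>cup_weight\<close> vanishes on equal values.\<close>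
      moreover obtain i' w' where "v = i' # w'" unfolding snoc by (cases "w @ [i]") auto
      then have "trace k k (hook_word v) = 0"
        by (simp add: trace_self app_hook cup_weight_def)
      ultimately show ?thesis by (simp add: snoc mult.assoc trace_zero)
    qed
  qed (use u \<open>k \<le> M\<close> in auto)
  \<comment> \<open>The word \<open>u\<close> in front collects the crossings that have already been
    smoothed.\<close>
  have "trace 0 M (hook_word u * (cross_word w * jw k)) = quantum k * trace k M (hook_word u * cross_word w)"
    if "set u \<subseteq> {1..<M}" "set w \<subseteq> {1..<M}" for u w
    using that
  proof (induction w arbitrary: u)
    case Nil
    then show ?case by (simp add: hooks)
  next
    case (Cons i w)
    have e: "hook_word u * (cross_word (i # w) * X)
        = scalar A * (hook_word u * (cross_word w * X)) + scalar (inverse A) * (hook_word (u @ [i]) * (cross_word w * X))" for X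
      by (simp add: cross_def distrib_left distrib_right mult.assoc scalar_left_commute)
    have IH: "trace 0 M (hook_word v * (cross_word w * jw k)) = quantum k * trace k M (hook_word v * (cross_word w * 1))"
      if "set v \<subseteq> {1..<M}" for v
      using Cons.IH[OF that] Cons.prems by simp
    have "trace 0 M (hook_word u * (cross_word (i # w) * jw k)) = quantum k * trace k M (hook_word u * (cross_word (i # w) * 1))"
      unfolding e trace_add trace_scalar using Cons.prems by (subst (1 2) IH) (auto simp: algebra_simps)
    then show ?case by simp
  qed
  from this[of "[]" "cable (\<lambda>_. k) js"] show ?thesis
    using set_cable[OF js, of "\<lambda>_. k"] by (simp add: cable_trace_def M_def offset_const)
qed

theorem chebyshev_bracket_cable:
  "chebyshev_bracket A k m (map Gen js) = quantum k * trace k (m * k) (cross_word (cable (\<lambda>_. k) js))"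
proof -
  have "chebyshev_bracket A k m (map Gen js) = cable_eval 0 (chebyshev_S k)"
    by (simp add: chebyshev_bracket_def cable_eval_def cable_trace_kauffman)
  then show ?thesis by (simp add: cable_eval_chebyshev cable_trace_jw)
qed

end

section \<open>Particle paths and the head of the trace\<close>

text \<open>The subring generated by \<open>x\<close>, that is, integer polynomials evaluated at
  \<open>x\<close>, built in Horner form.\<close>

inductive integral :: "'a::comm_ring_1 \<Rightarrow> 'a \<Rightarrow> bool" for x where
  zero: "integral x 0"
| step: "integral x z \<Longrightarrow> integral x (of_int c + x * z)"

lemma integral_add: "integral x z \<Longrightarrow> integral x z' \<Longrightarrow> integral x (z + z')"
proof (induction arbitrary: z' rule: integral.induct)
  case (step z c)
  show ?case using step.prems
  proof cases
    case zero
    then show ?thesis using integral.step[OF step.hyps] by simp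
  next
    case (step z1 c1)
    then have "integral x (of_int (c + c1) + x * (z + z1))" using step.IH integral.step by blast
    then show ?thesis using step by (simp add: algebra_simps)
  qed
qed simp

lemma integral_mult_x: "integral x z \<Longrightarrow> integral x (x * z)"
  using integral.step[of x z 0] by simp

lemma integral_uminus: "integral x z \<Longrightarrow> integral x (- z)"
proof (induction rule: integral.induct)
  case (step z c)
  then show ?case using integral.step[of x "- z" "- c"] by (simp add: algebra_simps)
qed (simp add: integral.zero)

lemma integral_of_int: "integral x (of_int c)"
  using integral.step[OF integral.zero, of x c] by simp

lemma integral_sum: "(\<And>i. i \<in> I \<Longrightarrow> integral x (F i)) \<Longrightarrow> integral x (\<Sum>i\<in>I. F i)"
  by (induction I rule: infinite_finite_induct) (auto intro: integral.zero integral_add)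

lemma integral_expand:
  "integral x z \<Longrightarrow> \<exists>h :: nat \<Rightarrow> int. finite {i. h i \<noteq> 0} \<and> z = (\<Sum>i | h i \<noteq> 0. of_int (h i) * x ^ i)"
proof (induction rule: integral.induct)
  case zero
  then show ?case by (intro exI[of _ "\<lambda>_. 0"]) simp
next
  case (step z c)
  then obtain h :: "nat \<Rightarrow> int" where h: "finite {i. h i \<noteq> 0}" "z = (\<Sum>i | h i \<noteq> 0. of_int (h i) * x ^ i)" by blast
  define h' where "h' i = (case i of 0 \<Rightarrow> c | Suc j \<Rightarrow> h j)" for i
  have sub: "{i. h' i \<noteq> 0} \<subseteq> insert 0 (Suc ` {i. h i \<noteq> 0})"
  proof
    fix i assume "i \<in> {i. h' i \<noteq> 0}"
    then show "i \<in> insert 0 (Suc ` {i. h i \<noteq> 0})" by (cases i) (auto simp: h'_def)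
  qed
  have "(\<Sum>i | h' i \<noteq> 0. of_int (h' i) * x ^ i) = (\<Sum>i\<in>insert 0 (Suc ` {i. h i \<noteq> 0}). of_int (h' i) * x ^ i)"
    using h(1) sub by (intro sum.mono_neutral_left) auto
  also have "\<dots> = of_int c + (\<Sum>i\<in>Suc ` {i. h i \<noteq> 0}. of_int (h' i) * x ^ i)"
    using h(1) by (subst sum.insert) (auto simp: h'_def)
  also have "(\<Sum>i\<in>Suc ` {i. h i \<noteq> 0}. of_int (h' i) * x ^ i) = x * z"
    by (subst sum.reindex) (auto simp: h'_def h(2) sum_distrib_left mult.left_commute)
  finally show ?case using h(1) finite_subset[OF sub] by (intro exI[of _ h']) auto
qed

section \<open>Combinatorics of particle histories\<close>

text \<open>
  The histories of the particles, read from top to bottom, that have a non-zero weight; the last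
  argument counts the moves to the right.
\<close>

inductive path :: "nat list \<Rightarrow> config \<Rightarrow> config \<Rightarrow> nat \<Rightarrow> bool" where
  Nil: "path [] s s 0"
| stay: "s i \<or> \<not> s (Suc i) \<Longrightarrow> path w s s' r \<Longrightarrow> path (i # w) s s' r"
| right: "s i \<Longrightarrow> \<not> s (Suc i) \<Longrightarrow> path w (s(i := False, Suc i := True)) s' r \<Longrightarrow> path (i # w) s s' (Suc r)"
| left: "\<not> s i \<Longrightarrow> s (Suc i) \<Longrightarrow> path w (s(i := True, Suc i := False)) s' r \<Longrightarrow> path (i # w) s s' r"

inductive_cases path_Nil: "path [] s s' r"

lemma path_Cons [consumes 1, case_names stay right left]:
  assumes "path (i # w) s s' r"
  obtains "s i \<or> \<not> s (Suc i)" "path w s s' r"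
  | r0 where "s i" "\<not> s (Suc i)" "path w (s(i := False, Suc i := True)) s' r0" "r = Suc r0"
  | "\<not> s i" "s (Suc i)" "path w (s(i := True, Suc i := False)) s' r"
  using assms by cases auto

lemma path_append:
  "path (u @ v) s s' r \<Longrightarrow> \<exists>s1 r1 r2. path u s s1 r1 \<and> path v s1 s' r2 \<and> r = r1 + r2"
proof (induction u arbitrary: s r)
  case Nil
  then show ?case using path.Nil by force
next
  case (Cons i u)
  from Cons.prems have "path (i # (u @ v)) s s' r" by simp
  then show ?case
  proof (cases rule: path_Cons)
    case stay
    then show ?thesis using Cons.IH path.stay by metis
  next
    case (right r0)
    then obtain s1 r1 r2 where "path u (s(i := False, Suc i := True)) s1 r1" "path v s1 s' r2" "r0 = r1 + r2"
      using Cons.IH by blast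
    then show ?thesis using right path.right by (metis add_Suc)
  next
    case left
    then show ?thesis using Cons.IH path.left by metis
  qed
qed

lemma path_outside: "path w s s' r \<Longrightarrow> (\<And>i. i \<in> set w \<Longrightarrow> p \<noteq> i \<and> p \<noteq> Suc i) \<Longrightarrow> s' p = s p"
  by (induction rule: path.induct) auto

text \<open>Only a letter \<open>c\<close> can carry a particle across the border between positions
  \<open>c\<close> and \<open>c + 1\<close>.\<close>

lemma path_count:
  "path w s s' r \<Longrightarrow> finite (Collect s) \<Longrightarrow> c \<notin> set w \<Longrightarrow>
    finite (Collect s') \<and> card {p. c < p \<and> s' p} = card {p. c < p \<and> s p}"
proof (induction rule: path.induct)
  case (right s i w s' r)
  define s1 where "s1 = s(i := False, Suc i := True)"
  have "Collect s1 \<subseteq> insert (Suc i) (Collect s)" by (auto simp: s1_def split: if_splits)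
  then have "finite (Collect s1)" using right.prems(1) finite_subset by blast
  moreover have "card {p. c < p \<and> s1 p} = card {p. c < p \<and> s p}"
  proof (cases "c < i")
    case True
    then have "{p. c < p \<and> s1 p} = insert (Suc i) ({p. c < p \<and> s p} - {i})" by (auto simp: s1_def)
    moreover have "finite {p. c < p \<and> s p}" using right.prems(1) by (rule rev_finite_subset) auto
    ultimately show ?thesis using True right.hyps by (simp add: card_Suc_Diff1 del: card_Diff_insert)
  next
    case False
    with right.prems have "{p. c < p \<and> s1 p} = {p. c < p \<and> s p}" by (auto simp: s1_def)
    then show ?thesis by simp
  qed
  ultimately show ?case using right.IH[folded s1_def] right.prems(2) by simp
next
  case (left s i w s' r)
  define s1 where "s1 = s(i := True, Suc i := False)"
  have "Collect s1 \<subseteq> insert i (Collect s)" by (auto simp: s1_def split: if_splits)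
  then have "finite (Collect s1)" using left.prems(1) finite_subset by blast
  moreover have "card {p. c < p \<and> s1 p} = card {p. c < p \<and> s p}"
  proof (cases "c < i")
    case True
    then have "{p. c < p \<and> s1 p} = insert i ({p. c < p \<and> s p} - {Suc i})" using left.hyps by (auto simp: s1_def)
    moreover have "finite {p. c < p \<and> s p}" using left.prems(1) by (rule rev_finite_subset) auto
    ultimately show ?thesis using True left.hyps by (simp add: card_Suc_Diff1 del: card_Diff_insert)
  next
    case False
    with left.prems have "{p. c < p \<and> s1 p} = {p. c < p \<and> s p}" by (auto simp: s1_def)
    then show ?thesis by simp
  qed
  ultimately show ?case using left.IH[folded s1_def] left.prems(2) by simp
qed simp_all

text \<open>An occupied right-hand place cannot stay next to an empty one: either it meets a
  particle on its left or it moves left. So the moving strand of a row stays occupied at each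
  crossing.\<close>

lemma row_under: "path (band_row a p) s s' r \<Longrightarrow> s (Suc (a + p)) \<Longrightarrow> s' (Suc a)"
proof (induction p arbitrary: s r)
  case 0
  then show ?case by (auto elim: path_Nil)
next
  case (Suc p)
  from Suc.prems(1) have "path ((a + Suc p) # band_row a p) s s' r" by simp
  then show ?case by (cases rule: path_Cons) (use Suc in auto)
qed

text \<open>
  A strand that leaves the row occupied without a move to the right has met an occupied strand
  below it, and the latter stays occupied.
\<close>

lemma row_over:
  assumes "path (band_row a p) s s' r" "q \<in> {Suc (Suc a)..Suc (a + p)}" "s' q"
  shows "(s' (Suc a) \<or> 1 \<le> r) \<and> (\<exists>q\<in>{Suc a..a + p}. s q)"
  using assms
proof (induction p arbitrary: s r)
  case 0
  then show ?case by simp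
next
  case (Suc p)
  from Suc.prems(1) have path: "path ((a + Suc p) # band_row a p) s s' r" by simp
  show ?case
  proof (cases "q = Suc (Suc (a + p))")
    case True
    have out: "s' q = s1 q" if "path (band_row a p) s1 s' r1" for s1 r1
      by (rule path_outside[OF that]) (auto simp: set_band_row True)
    have un: "s' (Suc a)" if "path (band_row a p) s1 s' r1" "s1 (Suc (a + p))" for s1 r1
      using that row_under by blast
    from path show ?thesis
    proof (cases rule: path_Cons)
      case stay
      then have "s (Suc (a + p))" using out[OF stay(2)] Suc.prems(3) True by auto
      then show ?thesis using un stay by auto
    next
      case (right r0)
      then show ?thesis by auto
    next
      case left
      then show ?thesis using out[OF left(3)] Suc.prems(3) True by auto
    qed
  next
    case False
    then have q: "q \<in> {Suc (Suc a)..Suc (a + p)}" using Suc.prems(2) by auto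
    from path show ?thesis
    proof (cases rule: path_Cons)
      case stay
      then show ?thesis using Suc.IH[OF stay(2) q Suc.prems(3)] by fastforce
    next
      case (right r0)
      then show ?thesis by auto
    next
      case left
      then show ?thesis using Suc.IH[OF left(3) q Suc.prems(3)] by (fastforce split: if_splits)
    qed
  qed
qed

text \<open>As long as some crossed strand leaves a row occupied, the row pays one unit: a move to
  the right or a particle that leaves on the moving strand. The second claim hands this condition to
  the row above.\<close>

lemma grid_over:
  assumes "path (grid a p q) s s' r" "x \<in> {Suc (a + q)..a + q + p}" "s' x"
  shows "q \<le> card {y \<in> {Suc a..a + q}. s' y} + r \<and> (\<exists>y\<in>{Suc a..a + p}. s y)"
  using assms
proof (induction q arbitrary: a s r)
  case 0
  then show ?case by (auto elim: path_Nil)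
next
  case (Suc q)
  from Suc.prems(1) obtain s1 r1 r2 where p: "path (band_row a p) s s1 r1" "path (grid (Suc a) p q) s1 s' r2" "r = r1 + r2"
    using path_append by fastforce
  have IH: "q \<le> card {y \<in> {Suc (Suc a)..Suc a + q}. s' y} + r2" "\<exists>y\<in>{Suc (Suc a)..Suc a + p}. s1 y"
    using Suc.IH[OF p(2)] Suc.prems(2,3) by auto
  then obtain y where "y \<in> {Suc (Suc a)..Suc (a + p)}" "s1 y" by auto
  from row_over[OF p(1) this] have row: "s1 (Suc a) \<or> 1 \<le> r1" "\<exists>q\<in>{Suc a..a + p}. s q" by auto
  have "s' (Suc a) = s1 (Suc a)"
    by (rule path_outside[OF p(2)]) (use set_grid[of "Suc a" p q] in force)
  moreover have "card {y \<in> {Suc a..a + Suc q}. s' y} = (if s' (Suc a) then 1 else 0) + card {y \<in> {Suc (Suc a)..Suc a + q}. s' y}"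
  proof -
    define B where "B = {y \<in> {Suc (Suc a)..Suc a + q}. s' y}"
    have iv: "{Suc a..a + Suc q} = insert (Suc a) {Suc (Suc a)..Suc a + q}" by auto
    have "{y \<in> {Suc a..a + Suc q}. s' y} = (if s' (Suc a) then insert (Suc a) B else B)"
      unfolding iv B_def by auto
    moreover have "finite B" "Suc a \<notin> B" by (auto simp: B_def)
    ultimately show ?thesis unfolding B_def[symmetric] by simp
  qed
  ultimately have "Suc q \<le> card {y \<in> {Suc a..a + Suc q}. s' y} + r"
    using row(1) IH(1) p(3) by (cases "s' (Suc a)") simp_all
  then show ?case using row(2) by blast
qed

abbreviation beyond :: "nat \<Rightarrow> config \<Rightarrow> nat" where
  "beyond c s \<equiv> card {p. c < p \<and> s p}"

text \<open>With at most \<open>k\<close> units to spend, the right-hand band is empty below every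
  crossing of bands. So only the count at the border between the two bands can change, and it drops
  to the count beyond the right-hand one. If no count changes in total, none changes at any
  crossing.\<close>

lemma cable_path:
  assumes "path (cable (\<lambda>_. k) js) s s' r" "1 \<le> k" "0 \<notin> set js" "finite (Collect s)" "beyond 0 s + r \<le> k"
  shows "(\<forall>b. beyond (b * k) s' \<le> beyond (b * k) s) \<and>
    (\<forall>j\<in>set js. (\<forall>b. beyond (b * k) s' = beyond (b * k) s) \<longrightarrow> beyond (j * k) s = beyond (Suc j * k) s)"
  using assms
proof (induction js arbitrary: s r)
  case Nil
  then show ?case by (auto elim: path_Nil)
next
  case (Cons j js)
  define a where "a = (j - 1) * k"
  obtain i where j: "j = Suc i" using Cons.prems(3) by (cases j) auto
  have "path (grid a k k @ cable (\<lambda>_. k) js) s s' r"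
    using Cons.prems(1) by (simp add: offset_const a_def comp_def)
  then obtain s1 r1 r2 where p: "path (grid a k k) s s1 r1" "path (cable (\<lambda>_. k) js) s1 s' r2" "r = r1 + r2"
    using path_append by blast
  have letters: "set (grid a k k) \<subseteq> {a<..<a + k + k}" by (rule set_grid)
  have count: "finite (Collect s1)" "beyond 0 s1 = beyond 0 s"
    using path_count[OF p(1) Cons.prems(4), of 0] letters by force+
  \<comment> \<open>The \<open>k\<close> rows pay \<open>k\<close> units, and the particle at
    \<open>x\<close> is one more.\<close>
  have empty: "\<not> s1 x" if x: "x \<in> {Suc (a + k)..a + k + k}" for x
  proof
    assume "s1 x"
    from grid_over[OF p(1) x this] have "k \<le> card {y \<in> {Suc a..a + k}. s1 y} + r1" by blast
    moreover have "insert x {y \<in> {Suc a..a + k}. s1 y} \<subseteq> {p. 0 < p \<and> s1 p}" using x \<open>s1 x\<close> by auto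
    then have "card (insert x {y \<in> {Suc a..a + k}. s1 y}) \<le> beyond 0 s1"
      using count(1) by (intro card_mono) (auto intro: rev_finite_subset)
    moreover have "card (insert x {y \<in> {Suc a..a + k}. s1 y}) = Suc (card {y \<in> {Suc a..a + k}. s1 y})"
      using x by (intro card_insert_disjoint) auto
    ultimately show False using Cons.prems(5) count(2) p(3) by simp
  qed
  have ab: "a + k = j * k" "a + k + k = Suc j * k" by (simp_all add: a_def j)
  have jj: "beyond (j * k) s1 = beyond (Suc j * k) s1"
  proof -
    have "j * k < p \<and> s1 p \<longleftrightarrow> Suc j * k < p \<and> s1 p" for p
    proof
      assume p: "j * k < p \<and> s1 p"
      show "Suc j * k < p \<and> s1 p"
      proof (rule ccontr)
        assume "\<not> ?thesis"
        then have "p \<in> {Suc (a + k)..a + k + k}" unfolding ab using p by simp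
        then show False using empty p by blast
      qed
    qed simp
    then show ?thesis by simp
  qed
  have other: "beyond (b * k) s1 = beyond (b * k) s" if "b \<noteq> j" for b
  proof -
    have "b * k \<notin> set (grid a k k)"
    proof
      assume "b * k \<in> set (grid a k k)"
      then have "a < b * k" "b * k < a + k + k" using letters by auto
      then have "i * k < b * k" "b * k < Suc j * k" unfolding ab by (simp_all add: a_def j)
      then have "i < b" "b < Suc j" by (simp, metis mult_less_cancel2)
      then show False using that j by simp
    qed
    then show ?thesis using path_count[OF p(1) Cons.prems(4)] by blast
  qed
  have mono: "beyond (b * k) s1 \<le> beyond (b * k) s" for b
  proof (cases "b = j")
    case True
    have "beyond (Suc j * k) s \<le> beyond (j * k) s"
      using Cons.prems(4) by (intro card_mono) (auto intro: rev_finite_subset)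
    then show ?thesis using True jj other[of "Suc j"] by simp
  qed (simp add: other)
  have IH: "(\<forall>b. beyond (b * k) s' \<le> beyond (b * k) s1) \<and>
    (\<forall>j\<in>set js. (\<forall>b. beyond (b * k) s' = beyond (b * k) s1) \<longrightarrow> beyond (j * k) s1 = beyond (Suc j * k) s1)"
    using Cons.prems count p(3) by (intro Cons.IH[OF p(2)]) auto
  show ?case
  proof (intro conjI allI ballI impI)
    fix b show "beyond (b * k) s' \<le> beyond (b * k) s" using IH mono le_trans by blast
  next
    fix j' assume j': "j' \<in> set (j # js)" and eq: "\<forall>b. beyond (b * k) s' = beyond (b * k) s"
    have eq1: "beyond (b * k) s1 = beyond (b * k) s" for b
      using IH mono[of b] eq by (metis le_antisym)
    then have "\<forall>b. beyond (b * k) s' = beyond (b * k) s1" using eq by simp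
    then show "beyond (j' * k) s = beyond (Suc j' * k) s"
      using j' jj IH by (auto simp only: eq1[symmetric] set_ConsD insert_iff list.set)
  qed
qed

text \<open>All particles lie beyond the empty first band. Since every generator occurs, a cheaper
  history would have equal counts at all borders, but beyond the last band there is nothing.\<close>

lemma closed_path_cost:
  assumes "path (cable (\<lambda>_. k) js) s s r" "1 \<le> k" "set js = {1..<m}" "s \<in> configs k (m * k)" "Collect s \<noteq> {}"
  shows "k + 1 \<le> card (Collect s) + r"
proof (rule ccontr)
  assume neg: "\<not> ?thesis"
  have fin: "finite (Collect s)" by (rule finite_subset[of _ "{..m * k}"]) (use assms(4) in \<open>auto simp: configs_def\<close>)
  have k1: "{p. 1 * k < p \<and> s p} = Collect s" "{p. 0 < p \<and> s p} = Collect s"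
    using assms(4) by (auto simp: configs_def)
  have step: "beyond (j * k) s = beyond (Suc j * k) s" if "1 \<le> j" "j < m" for j
    using cable_path[OF assms(1,2) _ fin] assms(3) that neg k1 by auto
  have "j \<le> m \<Longrightarrow> 1 \<le> j \<Longrightarrow> beyond (1 * k) s = beyond (j * k) s" for j
  proof (induction j)
    case (Suc j)
    then show ?case using step[of j] by (cases "j = 0") auto
  qed simp
  from this[of m] have "beyond (1 * k) s = beyond (m * k) s"
    using assms(4,5) by (cases "m = 0") (auto simp: configs_def)
  also have "{p. m * k < p \<and> s p} = {}" using assms(4) by (auto simp: configs_def)
  finally have "card (Collect s) = 0" unfolding k1 by simp
  then show False using fin assms(5) by simp
qed

text \<open>A potential that rises by 1 with a move to the right and falls by 1 with a move to the
  left; it measures the excess of one kind over the other.\<close>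

definition position_sum :: "nat \<Rightarrow> config \<Rightarrow> int" where
  "position_sum M s = (\<Sum>p\<in>{1..M}. if s p then int p else 0)"

lemma position_sum_update:
  assumes "i \<in> {1..<M}"
  shows "position_sum M (s(i := b, Suc i := c)) = position_sum M s
    + ((if b then int i else 0) + (if c then int i + 1 else 0)) - ((if s i then int i else 0) + (if s (Suc i) then int i + 1 else 0))"
proof -
  have iv: "{1..M} = insert i (insert (Suc i) ({1..M} - {i, Suc i}))" using assms by auto
  have sp: "position_sum M s = (if s i then int i else 0) + (if s (Suc i) then int i + 1 else 0) +
      (\<Sum>p\<in>{1..M} - {i, Suc i}. if s p then int p else 0)" for s
    unfolding position_sum_def by (subst iv) simp
  have "(\<Sum>p\<in>{1..M} - {i, Suc i}. if (s(i := b, Suc i := c)) p then int p else 0)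
      = (\<Sum>p\<in>{1..M} - {i, Suc i}. if s p then int p else 0)" by (intro sum.cong) auto
  then show ?thesis unfolding sp[of s] sp[of "s(i := b, Suc i := c)"] by simp
qed

context kauffman
begin

abbreviation x :: 'a where "x \<equiv> inverse A ^ 4"

abbreviation y :: 'a where "y \<equiv> inverse A ^ 2"

lemma y_y: "y * y = x"
  by (simp add: power_add[symmetric])

text \<open>A factor \<open>A\<close> is taken out of every weight. In the third case the term for
  staying cancels, because \<open>A - inverse A * A^2 = 0\<close>; this is why \<open>path\<close>
  has no such step.\<close>

lemma app_cross:
  "s i = s (Suc i) \<Longrightarrow> app (cross i) \<phi> s = A * \<phi> s"
  "s i \<Longrightarrow> \<not> s (Suc i) \<Longrightarrow> app (cross i) \<phi> s = A * ((\<phi> s + - (x * \<phi> s)) + y * \<phi> (s(i := False, Suc i := True)))"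
  "\<not> s i \<Longrightarrow> s (Suc i) \<Longrightarrow> app (cross i) \<phi> s = A * (y * \<phi> (s(i := True, Suc i := False)))"
proof -
  have upd: "s(i := b, Suc i := c) = s" if "s i = b" "s (Suc i) = c" for b c
    using that by (auto simp: fun_eq_iff)
  have AA: "inverse A * (y * A\<^sup>2) = A * y" "inverse A * y = A * x" "inverse A * A\<^sup>2 = A" "inverse A = A * y"
    using A_nz by (simp_all add: power_inverse field_simps power2_eq_square power4_eq_xxxx)
  show "s i = s (Suc i) \<Longrightarrow> app (cross i) \<phi> s = A * \<phi> s"
    by (simp add: cross_def app_hook cup_weight_def)
  show "s i \<Longrightarrow> \<not> s (Suc i) \<Longrightarrow> app (cross i) \<phi> s = A * ((\<phi> s + - (x * \<phi> s)) + y * \<phi> (s(i := False, Suc i := True)))"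
  proof -
    assume "s i" "\<not> s (Suc i)"
    then have "app (cross i) \<phi> s = A * \<phi> s + inverse A * (y * (- \<phi> s + A\<^sup>2 * \<phi> (s(i := False, Suc i := True))))"
      by (simp add: cross_def app_hook cup_weight_def cap_weight_def sum_bool upd)
    also have "\<dots> = A * \<phi> s - (inverse A * y) * \<phi> s + (inverse A * (y * A\<^sup>2)) * \<phi> (s(i := False, Suc i := True))"
      by (simp add: algebra_simps)
    finally show ?thesis unfolding AA(1,2) by (simp add: algebra_simps)
  qed
  show "\<not> s i \<Longrightarrow> s (Suc i) \<Longrightarrow> app (cross i) \<phi> s = A * (y * \<phi> (s(i := True, Suc i := False)))"
  proof -
    assume "\<not> s i" "s (Suc i)"
    then have "app (cross i) \<phi> s = A * \<phi> s + inverse A * (- (- \<phi> (s(i := True, Suc i := False)) + A\<^sup>2 * \<phi> s))"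
      by (simp add: cross_def app_hook cup_weight_def cap_weight_def sum_bool upd)
    also have "\<dots> = A * \<phi> s - (inverse A * A\<^sup>2) * \<phi> s + inverse A * \<phi> (s(i := True, Suc i := False))"
      by (simp add: algebra_simps)
    also have "\<dots> = inverse A * \<phi> (s(i := True, Suc i := False))" unfolding AA(3) by simp
    also have "\<dots> = (A * y) * \<phi> (s(i := True, Suc i := False))" unfolding AA(4)[symmetric] ..
    finally show ?thesis by (simp only: mult.assoc)
  qed
qed

text \<open>Each move carries \<open>y\<close>, a square root of \<open>x\<close>. The power of
  \<open>y\<close> given by the potential absorbs this factor for a move to the left and completes
  it to \<open>x\<close> for a move to the right. The bound \<open>R\<close> on all histories spares
  an explicit sum over them.\<close>

lemma cross_word_divisible:
  assumes "set w \<subseteq> {1..<M}" "\<And>r. path w s s' r \<Longrightarrow> R \<le> r"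
  shows "\<exists>z. integral x z \<and> app (cross_word w) (delta s') s =
    A ^ length w * (y powi (position_sum M s - position_sum M s') * (x ^ R * z))"
  using assms
proof (induction w arbitrary: s R)
  case Nil
  show ?case
  proof (cases "s = s'")
    case True
    with Nil.prems(2)[of 0] have "R = 0" using path.Nil by auto
    with True show ?thesis using integral_of_int[of x 1] by (intro exI[of _ 1]) (simp add: delta_def)
  next
    case False
    then show ?thesis using integral.zero by (intro exI[of _ 0]) (simp add: delta_def)
  qed
next
  case (Cons i w)
  define P where "P t = y powi (position_sum M t - position_sum M s')" for t
  define \<phi> where "\<phi> = app (cross_word w) (delta s')"
  have i: "i \<in> {1..<M}" and w: "set w \<subseteq> {1..<M}" using Cons.prems(1) by auto
  have y_nz: "y \<noteq> 0" using A_nz by simp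
  have IH: "\<exists>z. integral x z \<and> \<phi> t = A ^ length w * (P t * (x ^ R' * z))"
    if "\<And>r. path w t s' r \<Longrightarrow> R' \<le> r" for t R'
    unfolding \<phi>_def P_def by (rule Cons.IH[OF w that])
  have goal: ?case if "\<exists>z. integral x z \<and> app (cross i) \<phi> s = A * (A ^ length w * (P s * (x ^ R * z)))"
    using that by (simp add: \<phi>_def P_def mult.assoc)
  consider "s i = s (Suc i)" | "s i" "\<not> s (Suc i)" | "\<not> s i" "s (Suc i)" by blast
  then show ?case
  proof cases
    case 1
    then have "\<And>r. path w s s' r \<Longrightarrow> R \<le> r" using Cons.prems(2) path.stay by blast
    from IH[OF this] show ?thesis using app_cross(1)[OF 1] by (intro goal) auto
  next
    case 2
    define t where "t = s(i := False, Suc i := True)"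
    have "\<And>r. path w s s' r \<Longrightarrow> R \<le> r" using Cons.prems(2) path.stay 2 by blast
    from IH[OF this] obtain z1 where z1: "integral x z1" "\<phi> s = A ^ length w * (P s * (x ^ R * z1))" by blast
    have "\<And>r. path w t s' r \<Longrightarrow> R - 1 \<le> r" using Cons.prems(2) path.right 2 unfolding t_def by fastforce
    from IH[OF this] obtain z2 where z2: "integral x z2" "\<phi> t = A ^ length w * (P t * (x ^ (R - 1) * z2))" by blast
    have "position_sum M t - position_sum M s' = (position_sum M s - position_sum M s') + 1"
      unfolding t_def position_sum_update[OF i] using 2 by simp
    then have "P t = P s * y" unfolding P_def using y_nz by (simp only: power_int_add_1 simp_thms)
    then have Pt: "y * P t = P s * x" using y_y by (metis mult.assoc mult.commute)
    \<comment> \<open>For \<open>R = 0\<close> the exponent \<open>R - 1\<close> is 0 too, and the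
      spare factor \<open>x\<close> is moved into \<open>z3\<close>.\<close>
    obtain z3 where z3: "integral x z3" "x * (x ^ (R - 1) * z2) = x ^ R * z3"
    proof (cases R)
      case 0
      then show ?thesis using that[of "x * z2"] integral_mult_x[OF z2(1)] by simp
    next
      case (Suc R')
      then show ?thesis using that[of z2] z2(1) by (simp add: mult.assoc)
    qed
    have "y * \<phi> t = A ^ length w * ((y * P t) * (x ^ (R - 1) * z2))" unfolding z2(2) by (simp only: ac_simps)
    also have "\<dots> = A ^ length w * (P s * (x * (x ^ (R - 1) * z2)))" unfolding Pt by (simp only: ac_simps)
    finally have yt: "y * \<phi> t = A ^ length w * (P s * (x ^ R * z3))" unfolding z3(2) .
    have "integral x (z1 + - (x * z1) + z3)" by (intro integral_add integral_uminus integral_mult_x z1 z3)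
    moreover have "app (cross i) \<phi> s = A * (A ^ length w * (P s * (x ^ R * (z1 + - (x * z1) + z3))))"
      unfolding app_cross(2)[OF 2] t_def[symmetric] yt z1(2)
      by (simp only: algebra_simps mult_minus_left mult_minus_right)
    ultimately show ?thesis by (intro goal) blast
  next
    case 3
    define t where "t = s(i := True, Suc i := False)"
    have "\<And>r. path w t s' r \<Longrightarrow> R \<le> r" using Cons.prems(2) path.left 3 unfolding t_def by fastforce
    from IH[OF this] obtain z where z: "integral x z" "\<phi> t = A ^ length w * (P t * (x ^ R * z))" by blast
    have "position_sum M t = position_sum M s - 1"
      unfolding t_def position_sum_update[OF i] using 3 by simp
    then have "y * P t = P s" unfolding P_def using y_nz
      by (simp add: power_int_add_1'[symmetric] del: power_inverse)
    then have "y * \<phi> t = A ^ length w * (P s * (x ^ R * z))" unfolding z(2) by (metis mult.left_commute mult.assoc)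
    then show ?thesis using z(1) app_cross(3)[OF 3, of \<phi>] by (intro goal) (auto simp: t_def)
  qed
qed

lemma length_cable: "length (cable (\<lambda>_. k) js) = length js * k\<^sup>2"
proof -
  have "length (band_row a p) = p" for a p by (induction p) auto
  then have "length (grid a p q) = q * p" for a p q by (induction q arbitrary: a) auto
  then show ?thesis by (induction js) (auto simp: comp_def power2_eq_square)
qed

lemma cross_word_vacuum: "app (cross_word w) (delta (\<lambda>p. False)) (\<lambda>p. False) = A ^ length w"
  by (induction w) (simp_all add: app_cross(1) delta_def)

text \<open>The vacuum contributes exactly the prefactor. For any other configuration the particles,
  through the closure weights, and the moves to the right together pay at least \<open>k + 1\<close>
  factors \<open>x\<close>.\<close>

theorem trace_cable_head:
  assumes "1 \<le> k" "set js = {1..<m}" "1 \<le> m"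
  shows "\<exists>z. integral x z \<and> trace k (m * k) (cross_word (cable (\<lambda>_. k) js))
    = A ^ (length js * k\<^sup>2) * (- A\<^sup>2) ^ (m * k - k) * (1 + x ^ (k + 1) * z)"
proof -
  define M where "M = m * k"
  define w where "w = cable (\<lambda>_. k) js"
  define \<alpha> where "\<alpha> = A ^ (length js * k\<^sup>2) * (- A\<^sup>2) ^ (m * k - k)"
  have w: "set w \<subseteq> {1..<M}" "length w = length js * k\<^sup>2"
    using set_cable[of js m "\<lambda>_. k"] assms(2) by (simp_all add: w_def M_def offset_const length_cable)
  have weight: "(\<Prod>p\<in>{k<..M}. closure_weight (s p)) = (- A\<^sup>2) ^ (m * k - k) * x ^ card (Collect s)"
    if s: "s \<in> configs k M" for s
  proof -
    have "closure_weight b = - A\<^sup>2 * (if b then x else 1)" for b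
      using A_nz by (simp add: closure_weight_def power_inverse field_simps power2_eq_square power4_eq_xxxx)
    then have "(\<Prod>p\<in>{k<..M}. closure_weight (s p)) = (- A\<^sup>2) ^ (m * k - k) * (\<Prod>p\<in>{k<..M}. if s p then x else 1)"
      by (simp only: prod.distrib prod_constant card_greaterThanAtMost M_def)
    also have "(\<Prod>p\<in>{k<..M}. if s p then x else 1) = x ^ card {p \<in> {k<..M}. s p}"
      by (subst prod.If_cases) (simp_all add: Int_def)
    also have "{p \<in> {k<..M}. s p} = Collect s" using s by (auto simp: configs_def)
    finally show ?thesis .
  qed
  have "\<exists>z. integral x z \<and> x ^ card (Collect s) * app (cross_word w) (delta s) s = A ^ length w * (x ^ (k + 1) * z)"
    if s: "s \<in> configs k M - {\<lambda>p. False}" for s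
  proof -
    \<comment> \<open>The subtraction is truncated: with more than \<open>k\<close> particles the
      bound on the moves is 0, and the surplus exponent \<open>e\<close> goes into the
      cofactor.\<close>
    define R where "R = k + 1 - card (Collect s)"
    have "Collect s \<noteq> {}" using s by auto
    then have cost: "R \<le> r" if "path w s s r" for r
      using closed_path_cost[of k js s r m] that assms(1,2) s by (simp add: R_def w_def M_def)
    obtain z where z: "integral x z" "app (cross_word w) (delta s) s = A ^ length w * (x ^ R * z)"
      using cross_word_divisible[OF w(1), of s s R] cost by auto
    have iter: "integral x (x ^ e * z)" for e
      by (induction e) (auto simp: mult.assoc z(1) intro: integral_mult_x)
    define e where "e = card (Collect s) + R - (k + 1)"
    have "card (Collect s) + R = (k + 1) + e" by (simp add: R_def e_def)
    then have e: "x ^ card (Collect s) * x ^ R = x ^ (k + 1) * x ^ e"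
      by (simp only: power_add[symmetric])
    have "x ^ card (Collect s) * app (cross_word w) (delta s) s
        = A ^ length w * ((x ^ card (Collect s) * x ^ R) * z)"
      unfolding z(2) by (simp only: ac_simps)
    also have "\<dots> = A ^ length w * (x ^ (k + 1) * (x ^ e * z))"
      unfolding e by (simp only: mult.assoc)
    finally have "x ^ card (Collect s) * app (cross_word w) (delta s) s
        = A ^ length w * (x ^ (k + 1) * (x ^ e * z))" .
    then show ?thesis using iter by blast
  qed
  then obtain Z where Z: "\<And>s. s \<in> configs k M - {\<lambda>p. False} \<Longrightarrow> integral x (Z s)"
    "\<And>s. s \<in> configs k M - {\<lambda>p. False} \<Longrightarrow>
      x ^ card (Collect s) * app (cross_word w) (delta s) s = A ^ length w * (x ^ (k + 1) * Z s)"
    by metis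
  define z where "z = (\<Sum>s\<in>configs k M - {\<lambda>p. False}. Z s)"
  have v: "(\<lambda>p. False) \<in> configs k M" by (simp add: configs_def)
  have "trace k M (cross_word w) = (\<Sum>s\<in>configs k M. (- A\<^sup>2) ^ (m * k - k) * (x ^ card (Collect s) * app (cross_word w) (delta s) s))"
    unfolding trace_def by (intro sum.cong refl) (simp add: weight mult.assoc)
  also have "\<dots> = \<alpha> + (\<Sum>s\<in>configs k M - {\<lambda>p. False}. (- A\<^sup>2) ^ (m * k - k) * (x ^ card (Collect s) * app (cross_word w) (delta s) s))"
    using v finite_configs by (subst sum.remove[of _ "\<lambda>p. False"]) (auto simp: cross_word_vacuum \<alpha>_def w(2) mult.commute)
  also have "(\<Sum>s\<in>configs k M - {\<lambda>p. False}. (- A\<^sup>2) ^ (m * k - k) * (x ^ card (Collect s) * app (cross_word w) (delta s) s))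
      = (\<Sum>s\<in>configs k M - {\<lambda>p. False}. \<alpha> * (x ^ (k + 1) * Z s))"
  proof (rule sum.cong[OF refl])
    fix s assume s: "s \<in> configs k M - {\<lambda>p. False}"
    show "(- A\<^sup>2) ^ (m * k - k) * (x ^ card (Collect s) * app (cross_word w) (delta s) s) = \<alpha> * (x ^ (k + 1) * Z s)"
      unfolding Z(2)[OF s] \<alpha>_def w(2) by (simp only: ac_simps)
  qed
  also have "\<alpha> + \<dots> = \<alpha> * (1 + x ^ (k + 1) * z)"
    by (simp add: z_def distrib_left sum_distrib_left)
  finally have "trace k M (cross_word w) = \<alpha> * (1 + x ^ (k + 1) * z)" .
  moreover have "integral x z" unfolding z_def by (intro integral_sum Z)
  ultimately show ?thesis unfolding M_def w_def \<alpha>_def by blast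
qed

end

section \<open>The permutation of a braid whose closure is a knot\<close>

text \<open>A transposition fixes the positions beside its crossing, so that all arcs of one level
  can be written in the same form.\<close>

lemma closure_arc_cases:
  assumes "(u, v) \<in> closure_arcs m (map Gen js)"
  obtains p t where "t < length js" "u = (transpose (js ! t) (Suc (js ! t)) p, t)" "v = (p, Suc t)"
  | p where "p \<in> {1..m}" "u = (p, length js)" "v = (p, 0)"
proof -
  consider p t where "t < length js" "p \<notin> {js ! t, Suc (js ! t)}" "u = (p, t)" "v = (p, Suc t)"
    | p where "p \<in> {1..m}" "u = (p, length js)" "v = (p, 0)"
    | t where "t < length js" "(u, v) \<in> crossed_arcs (js ! t) t"
    using assms by (auto simp: closure_arcs_def outer_arcs_def)
  then show ?thesis
  proof cases
    case (1 p t)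
    then show ?thesis using that(1)[of t p] by (simp add: transpose_apply_other)
  next
    case (2 p)
    then show ?thesis using that(2) by blast
  next
    case (3 t)
    then have "(u, v) = ((js ! t, t), (Suc (js ! t), Suc t)) \<or> (u, v) = ((Suc (js ! t), t), (js ! t, Suc t))"
      by (auto simp: crossed_arcs_def)
    then show ?thesis using that(1)[of t "Suc (js ! t)"] that(1)[of t "js ! t"] 3(1) by auto
  qed
qed

lemma perm_drop: "t < length js \<Longrightarrow> perm (drop t js) b = transpose (js ! t) (Suc (js ! t)) (perm (drop (Suc t) js) b)"
  by (simp add: Cons_nth_drop_Suc[symmetric])

text \<open>The points whose strand, followed downwards to the bottom, ends in the orbit of 1 form a
  set that no arc leaves; the diagram being connected, this set is everything.\<close>

lemma knot_orbit:
  assumes "1 \<le> m" "set js \<subseteq> {1..<m}" "closure_is_knot m (map Gen js)" "b \<in> {1..m}"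
  shows "\<exists>t. b = (perm js ^^ t) 1"
proof -
  define n where "n = length js"
  define V where "V = points m (map Gen js)"
  define E where "E = closure_arcs m (map Gen js)"
  define R where "R = (E \<union> E\<inverse>)\<^sup>*"
  define Orb where "Orb = range (\<lambda>t. (perm js ^^ t) 1)"
  have perm: "permutation (perm js)"
    using perm_permutes[OF assms(2)] permutation_permutes by blast
  have Orb_iff: "perm js c \<in> Orb \<longleftrightarrow> c \<in> Orb" for c
  proof
    assume "c \<in> Orb"
    then obtain t where "c = (perm js ^^ t) 1" by (auto simp: Orb_def)
    then have "perm js c = (perm js ^^ Suc t) 1" by simp
    then show "perm js c \<in> Orb" unfolding Orb_def by blast
  next
    assume "perm js c \<in> Orb"
    then obtain t where t: "perm js c = (perm js ^^ t) 1" by (auto simp: Orb_def)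
    \<comment> \<open>Since 1 is periodic, going back one step in the orbit is going forward
      \<open>r - 1\<close> steps.\<close>
    obtain r where r: "(perm js ^^ r) 1 = 1" "0 < r" using least_power_of_permutation[OF perm] by blast
    have "perm js c = (perm js ^^ (t + r)) 1" using r(1) t by (simp add: funpow_add)
    also have "\<dots> = perm js ((perm js ^^ (t + r - 1)) 1)"
      using r(2) by (metis Suc_diff_1 add_gr_0 comp_apply funpow.simps(2))
    finally have "c = (perm js ^^ (t + r - 1)) 1"
      using perm by (simp add: permutation bij_is_inj inj_eq)
    then show "c \<in> Orb" unfolding Orb_def by blast
  qed
  define Q where "Q = {(p, t). t \<le> n \<and> (\<exists>c\<in>Orb. p = perm (drop t js) c)}"
  have arc: "u \<in> Q \<longleftrightarrow> v \<in> Q" if "(u, v) \<in> E" for u v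
    using that unfolding E_def
  proof (cases rule: closure_arc_cases)
    case (1 p t)
    then have "transpose (js ! t) (Suc (js ! t)) p = perm (drop t js) c \<longleftrightarrow> p = perm (drop (Suc t) js) c" for c
      unfolding perm_drop[OF 1(1)] by (metis transpose_involutory)
    then show ?thesis using 1 by (auto simp: Q_def n_def)
  next
    case (2 p)
    have "p \<in> Orb \<longleftrightarrow> (\<exists>c\<in>Orb. p = perm js c)"
    proof
      assume "p \<in> Orb"
      obtain c where "p = perm js c" using perm by (metis permutation bij_pointE)
      then show "\<exists>c\<in>Orb. p = perm js c" using Orb_iff \<open>p \<in> Orb\<close> by blast
    qed (use Orb_iff in blast)
    then show ?thesis using 2 by (auto simp: Q_def n_def)
  qed
  have step: "v \<in> Q" if "(u, v) \<in> R" "u \<in> Q" for u v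
    using that unfolding R_def by (induction rule: rtrancl_induct) (use arc in auto)
  have "card (V // R) = 1"
    using assms(3) unfolding closure_is_knot_def num_components_def V_def E_def R_def by simp
  then obtain X where X: "V // R = {X}" by (auto simp: card_1_singleton_iff)
  have "(1, n) \<in> V" "(b, n) \<in> V" using assms(1,4) by (auto simp: V_def points_def n_def)
  then have "R `` {(1, n)} = X" "R `` {(b, n)} = X" using X by (auto simp: quotient_def)
  moreover have "(b, n) \<in> R `` {(b, n)}" by (simp add: R_def)
  ultimately have "((1, n), (b, n)) \<in> R" by blast
  moreover have "1 \<in> Orb" unfolding Orb_def by (rule range_eqI[of _ _ 0]) simp
  then have "(1, n) \<in> Q" by (auto simp: Q_def n_def)
  ultimately have "(b, n) \<in> Q" using step by blast
  then show ?thesis by (auto simp: Q_def n_def Orb_def)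
qed

lemma sign_cycle: "distinct cs \<Longrightarrow> sign (cycle_of_list cs) = (-1) ^ (length cs - 1)"
proof (induction cs rule: cycle_of_list.induct)
  case (1 i j cs)
  then show ?case
    by (simp add: sign_compose permutation_swap_id permutation_of_cycle sign_swap_id del: o_apply)
qed (simp_all add: sign_id del: id_apply)

lemma sign_perm: "sign (perm js) = (-1) ^ length js"
proof (induction js)
  case (Cons j js)
  have "permutation (perm js)"
    by (induction js) (simp_all add: permutation_compose permutation_swap_id del: o_apply id_apply)
  then show ?case using Cons by (simp add: sign_compose permutation_swap_id sign_swap_id del: o_apply)
qed (simp add: sign_id del: id_apply)

text \<open>As the orbit of 1 is all of \<open>{1..m}\<close>, the permutation is an
  \<open>m\<close>-cycle, and comparing its sign with the number of transpositions gives the parity.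
  If a generator \<open>i\<close> were missing, the orbit could not leave the positions up to
  \<open>i\<close>.\<close>

lemma knot_cycle:
  assumes "1 \<le> m" "set js \<subseteq> {1..<m}" "closure_is_knot m (map Gen js)"
  shows "bij_betw (\<lambda>t. (perm js ^^ t) 1) {..<m} {1..m}" "(perm js ^^ m) 1 = 1"
    "(-1 :: int) ^ length js = (-1) ^ (m - 1)" "set js = {1..<m}"
proof -
  have permutes: "perm js permutes {1..m}" by (rule perm_permutes[OF assms(2)])
  then have perm: "permutation (perm js)" using permutation_permutes by blast
  define r where "r = least_power (perm js) 1"
  define cs where "cs = support (perm js) 1"
  have "(perm js ^^ t) 1 \<in> {1..m}" for t
    using assms(1) by (induction t) (simp, simp only: funpow.simps o_apply permutes_in_image[OF permutes])
  then have "range (\<lambda>t. (perm js ^^ t) 1) = {1..m}" using knot_orbit[OF assms] by blast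
  then have set: "set cs = {1..m}" unfolding cs_def support_set[OF perm] .
  have dist: "distinct cs" unfolding cs_def by (rule cycle_of_permutation[OF perm])
  have len: "length cs = m" using distinct_card[OF dist] set by simp
  have r: "r = m" using len by (simp add: cs_def r_def)
  have inj: "inj_on (\<lambda>t. (perm js ^^ t) 1) {..<m}"
    using dist unfolding cs_def distinct_map r_def[symmetric] r by (simp add: atLeast0LessThan)
  have img: "(\<lambda>t. (perm js ^^ t) 1) ` {..<m} = {1..m}"
    using set unfolding cs_def r_def[symmetric] r by (simp add: atLeast0LessThan)
  show "bij_betw (\<lambda>t. (perm js ^^ t) 1) {..<m} {1..m}" using inj img by (simp add: bij_betw_def)
  show "(perm js ^^ m) 1 = 1" using least_power_of_permutation(1)[OF perm, of 1] r by (simp add: r_def)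
  have "perm js = cycle_of_list cs"
  proof
    fix b
    show "perm js b = cycle_of_list cs b"
    proof (cases "b \<in> {1..m}")
      case True
      then show ?thesis using cycle_restrict[OF perm, of b 1] set unfolding cs_def by blast
    next
      case False
      then show ?thesis using permutes_not_in[OF permutes] id_outside_supp[of b cs] set by simp
    qed
  qed
  then show "(-1 :: int) ^ length js = (-1) ^ (m - 1)"
    using sign_perm[of js] sign_cycle[OF dist] len by simp
  show "set js = {1..<m}"
  proof (rule ccontr)
    assume "set js \<noteq> {1..<m}"
    then obtain i where "i \<in> {1..<m}" and i: "i \<notin> set js" using assms(2) by blast
    then have i: "1 \<le> i" "i < m" "i \<notin> set js" by auto
    have below: "b \<le> i \<Longrightarrow> perm us b \<le> i" if "i \<notin> set us" for us b
      using that
    proof (induction us)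
      case (Cons j us)
      then have "perm us b \<le> i" "j \<noteq> i" by auto
      then show ?case by (auto simp: transpose_def)
    qed simp
    have "(perm js ^^ t) 1 \<le> i" for t
      using i(1) below[OF i(3)] by (induction t) auto
    moreover obtain t where "m = (perm js ^^ t) 1" using knot_orbit[OF assms, of m] assms(1) by auto
    ultimately show False using i(2) by (metis not_le)
  qed
qed

section \<open>The colored Jones polynomial\<close>

lemma A_var_to_fract: "A_var = to_fract [:0, 1:]"
  by (simp add: A_var_def to_fract_def)

interpretation generic: kauffman A_var
  by unfold_locales (simp add: A_var_to_fract)

text \<open>Multiplied by \<open>A^(2k)\<close>, the value becomes a polynomial in \<open>A\<close>
  with constant coefficient \<open>(-1)^k\<close>.\<close>

lemma generic_quantum_nz: "generic.quantum k \<noteq> 0"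
proof -
  define X :: "int poly" where "X = [:0, 1:]"
  have X: "A_var = to_fract X" "coeff X 0 = 0" by (simp_all add: A_var_to_fract X_def)
  have A: "A_var \<noteq> 0" by (rule generic.A_nz)
  have loop: "A_var\<^sup>2 * generic.loop_value = - (A_var ^ 4 + 1)"
    using A by (simp add: generic.loop_value_def field_simps power2_eq_square power4_eq_xxxx)
  have "\<exists>p. A_var ^ (2 * k) * generic.quantum k = to_fract p \<and> coeff p 0 = (-1) ^ k"
  proof (induction k rule: generic.quantum.induct)
    case 1
    then show ?case by (intro exI[of _ 1]) simp
  next
    case 2
    have "A_var\<^sup>2 * generic.loop_value = to_fract (- (X ^ 4 + 1))"
      unfolding loop by (simp add: X(1) power4_eq_xxxx)
    then show ?case
      by (intro exI[of _ "- (X ^ 4 + 1)"]) (simp add: coeff_0_power X(2))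
  next
    case (3 k)
    then obtain p p' where p: "A_var ^ (2 * Suc k) * generic.quantum (Suc k) = to_fract p" "coeff p 0 = (-1) ^ Suc k"
      and p': "A_var ^ (2 * k) * generic.quantum k = to_fract p'" "coeff p' 0 = (-1) ^ k" by blast
    have "A_var ^ (2 * Suc (Suc k)) * generic.quantum (Suc (Suc k))
        = (A_var\<^sup>2 * generic.loop_value) * (A_var ^ (2 * Suc k) * generic.quantum (Suc k))
          - A_var ^ 4 * (A_var ^ (2 * k) * generic.quantum k)"
      by (simp add: algebra_simps power2_eq_square power4_eq_xxxx)
    also have "\<dots> = to_fract (- (X ^ 4 + 1) * p - X ^ 4 * p')"
      unfolding p p' loop by (simp add: X(1) power4_eq_xxxx algebra_simps)
    finally show ?case
      using p(2) p'(2) by (intro exI[of _ "- (X ^ 4 + 1) * p - X ^ 4 * p'"]) (simp add: coeff_mult_0 coeff_0_power X(2))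
  qed
  then obtain p where "A_var ^ (2 * k) * generic.quantum k = to_fract p" "coeff p 0 = (-1) ^ k" by blast
  then show ?thesis by (metis coeff_0 mult_zero_right power_eq_0_iff to_fract_eq_0_iff zero_neq_neg_one)
qed

interpretation generic: kauffman_generic A_var
  by unfold_locales (rule generic_quantum_nz)

lemma generic_knot:
  assumes "1 \<le> m" "set js \<subseteq> {1..<m}" "closure_is_knot m (map Gen js)"
  shows "kauffman_generic_knot A_var m js"
  using assms knot_cycle[OF assms] by unfold_locales

text \<open>The denominator in the definition is evaluated by the same theorem as the numerator;
  both contain the factor \<open>quantum k\<close>, which cancels.\<close>

lemma generic_unknot: "kauffman_generic_knot A_var 1 []"
  by unfold_locales (simp_all add: bij_betw_def lessThan_Suc)

text \<open>The parity makes the division by 2 exact and the two signs cancel. The remaining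
  exponent is \<open>- (k^2 + 2 k) n + k^2 n + 2 (m - 1) k = - 2 k (n - m + 1)\<close>.\<close>

lemma prefactor:
  fixes A :: "'a::field" and m n k :: nat and L :: int
  assumes "A \<noteq> 0" "1 \<le> m" "(-1 :: int) ^ n = (-1) ^ (m - 1)" "L = int k * (int n - int m + 1) div 2"
  shows "((-1) ^ k * A ^ ((k + 1)\<^sup>2 - 1)) powi (- int n) * (A ^ (n * k\<^sup>2) * (- A\<^sup>2) ^ (m * k - k)) = A powi (-4 * L)"
proof -
  obtain m' where m: "m = Suc m'" using assms(2) by (cases m) auto
  have par: "even n \<longleftrightarrow> even m'" using assms(3) by (simp add: m uminus_power_if split: if_splits)
  then have "even (int k * (int n - int m'))" by simp
  then have L: "2 * L = int k * (int n - int m')" using assms(4) by (simp add: m)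
  have sq: "(k + 1)\<^sup>2 - 1 = k\<^sup>2 + 2 * k" by (simp add: power2_eq_square)
  have "even (k * n + m' * k)" using par by auto
  then have sign: "(-1 :: 'a) ^ (k * n) * (-1) ^ (m' * k) = 1"
    by (simp add: power_add[symmetric])
  have inv: "inverse ((-1 :: 'a) ^ j) = (-1) ^ j" for j by (cases "even j") simp_all
  have "((-1) ^ k * A ^ ((k + 1)\<^sup>2 - 1)) powi (- int n) = inverse ((-1) ^ (k * n) * A ^ ((k\<^sup>2 + 2 * k) * n))"
    unfolding sq by (simp add: power_int_minus power_mult_distrib power_mult)
  also have "\<dots> = (-1) ^ (k * n) * A powi (- int ((k\<^sup>2 + 2 * k) * n))"
    unfolding inverse_mult_distrib inv power_int_minus power_int_of_nat ..
  finally have 1: "((-1) ^ k * A ^ ((k + 1)\<^sup>2 - 1)) powi (- int n) = (-1) ^ (k * n) * A powi (- int ((k\<^sup>2 + 2 * k) * n))" .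
  have "m * k - k = m' * k" by (simp add: m)
  then have "(- A\<^sup>2) ^ (m * k - k) = (-1) ^ (m' * k) * A ^ (2 * (m' * k))"
    by (simp add: power_minus[of "A\<^sup>2"] power_mult power_mult_distrib)
  then have 2: "A ^ (n * k\<^sup>2) * (- A\<^sup>2) ^ (m * k - k) = (-1) ^ (m' * k) * A powi (int (n * k\<^sup>2 + 2 * (m' * k)))"
    by (simp only: power_int_of_nat power_add ac_simps)
  have "((-1) ^ k * A ^ ((k + 1)\<^sup>2 - 1)) powi (- int n) * (A ^ (n * k\<^sup>2) * (- A\<^sup>2) ^ (m * k - k))
    = ((-1) ^ (k * n) * (-1) ^ (m' * k)) * (A powi (- int ((k\<^sup>2 + 2 * k) * n)) * A powi (int (n * k\<^sup>2 + 2 * (m' * k))))"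
    unfolding 1 2 by (simp only: ac_simps)
  also have "\<dots> = A powi (- int ((k\<^sup>2 + 2 * k) * n) + int (n * k\<^sup>2 + 2 * (m' * k)))"
    unfolding sign using assms(1) by (simp only: power_int_add simp_thms mult_1_left)
  also have "- int ((k\<^sup>2 + 2 * k) * n) + int (n * k\<^sup>2 + 2 * (m' * k)) = -4 * L"
    using L by (simp add: algebra_simps)
  finally show ?thesis .
qed

lemma colored_jones_head:
  assumes "1 \<le> m" "set js \<subseteq> {1..<m}" "closure_is_knot m (map Gen js)" "2 \<le> N"
    and L: "L = (int N - 1) * (int (length js) - int m + 1) div 2"
  shows "\<exists>z. integral q_var z \<and> colored_jones m (map Gen js) N = q_var powi L * (1 + q_var ^ N * z)"
proof -
  define k where "k = N - 1"
  have N: "N = k + 1" "1 \<le> k" using assms(4) by (auto simp: k_def)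
  have q: "q_var = inverse A_var ^ 4" by (simp add: q_var_def power_int_minus power_inverse)
  have Aq: "A_var powi (-4 * L) = q_var powi L"
    unfolding q_var_def by (simp only: power_int_mult)
  obtain z where z: "integral q_var z" "generic.trace k (m * k) (generic.cross_word (cable (\<lambda>_. k) js))
    = A_var ^ (length js * k\<^sup>2) * (- A_var\<^sup>2) ^ (m * k - k) * (1 + q_var ^ (k + 1) * z)"
    using generic.trace_cable_head[OF N(2) knot_cycle(4)[OF assms(1-3)] assms(1)] unfolding q by blast
  have top: "chebyshev_bracket A_var k m (map Gen js) = generic.quantum k * generic.trace k (m * k) (generic.cross_word (cable (\<lambda>_. k) js))"
    by (rule kauffman_generic_knot.chebyshev_bracket_cable[OF generic_knot[OF assms(1-3)]])
  have "chebyshev_bracket A_var k 1 (map Gen []) = generic.quantum k * generic.trace k (1 * k) (generic.cross_word (cable (\<lambda>_. k) []))"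
    by (rule kauffman_generic_knot.chebyshev_bracket_cable[OF generic_unknot])
  then have bottom: "chebyshev_bracket A_var k 1 [] = generic.quantum k"
    by (simp add: generic.trace_self delta_def)
  have writhe: "writhe (map Gen js) = int (length js)"
    by (induction js) (auto simp: writhe_def)
  have k: "N - 1 = k" "N\<^sup>2 - 1 = (k + 1)\<^sup>2 - 1" by (simp_all add: N)
  have "colored_jones m (map Gen js) N = ((-1) ^ k * A_var ^ ((k + 1)\<^sup>2 - 1)) powi (- int (length js)) *
      (A_var ^ (length js * k\<^sup>2) * (- A_var\<^sup>2) ^ (m * k - k) * (1 + q_var ^ (k + 1) * z))"
    unfolding colored_jones_def writhe k top bottom z(2) using generic_quantum_nz[of k] by simp
  also have "\<dots> = A_var powi (-4 * L) * (1 + q_var ^ N * z)"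
    using prefactor[OF generic.A_nz assms(1) knot_cycle(3)[OF assms(1-3)], of L k] L
    by (simp add: N mult.assoc[symmetric])
  finally show ?thesis using z(1) unfolding Aq by blast
qed

theorem theorem1:
  fixes m N :: nat and js :: "nat list"
  assumes "m \<ge> 1"
    and "set js \<subseteq> {1..m - 1}"
    and "closure_is_knot m (map Gen js)"
    and "N \<ge> 2"
  shows "let n = length js;
             L = (int N - 1) * (int n - int m + 1) div 2
         in \<exists>(a :: nat \<Rightarrow> int) (h :: int \<Rightarrow> int).
              colored_jones m (map Gen js) N =
                (\<Sum>i=1..N. of_int (a i) * q_var powi (L + int i - 1))
                + (\<Sum>d | h d \<noteq> 0. of_int (h d) * q_var powi d)
              \<and> a 1 = 1 \<and> (\<forall>i\<in>{2..N}. a i = 0)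
              \<and> finite {d. h d \<noteq> 0} \<and> (\<forall>d. h d \<noteq> 0 \<longrightarrow> d \<ge> L + int N)"
proof -
  define L where "L = (int N - 1) * (int (length js) - int m + 1) div 2"
  have "{1..m - 1} = {1..<m}" using assms(1) by auto
  then have "set js \<subseteq> {1..<m}" using assms(2) by simp
  from colored_jones_head[OF assms(1) this assms(3,4) L_def] obtain z where
    z: "integral q_var z" "colored_jones m (map Gen js) N = q_var powi L * (1 + q_var ^ N * z)" by blast
  from integral_expand[OF z(1)] obtain c :: "nat \<Rightarrow> int" where
    c: "finite {i. c i \<noteq> 0}" "z = (\<Sum>i | c i \<noteq> 0. of_int (c i) * q_var ^ i)" by blast
  define a :: "nat \<Rightarrow> int" where "a i = (if i = 1 then 1 else 0)" for i
  \<comment> \<open>The coefficients of \<open>z\<close>, moved up by \<open>L + N\<close>; the test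
    keeps \<open>nat\<close> away from negative arguments.\<close>
  define h where "h d = (if L + int N \<le> d then c (nat (d - L - int N)) else 0)" for d
  define sh where "sh i = L + int N + int i" for i
  have h_sh: "h (sh i) = c i" for i by (simp add: h_def sh_def)
  have supp: "{d. h d \<noteq> 0} = sh ` {i. c i \<noteq> 0}"
  proof (intro subset_antisym subsetI)
    fix d assume "d \<in> {d. h d \<noteq> 0}"
    then have d: "L + int N \<le> d" "c (nat (d - L - int N)) \<noteq> 0" by (auto simp: h_def split: if_splits)
    then have "d = sh (nat (d - L - int N))" by (simp add: sh_def)
    then show "d \<in> sh ` {i. c i \<noteq> 0}" using d(2) by blast
  qed (auto simp: h_sh)
  have q_nz: "q_var \<noteq> 0" using generic.A_nz by (simp add: q_var_def)
  have "(\<Sum>i=1..N. of_int (a i) * q_var powi (L + int i - 1)) = (\<Sum>i\<in>{1}. of_int (a i) * q_var powi (L + int i - 1))"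
    using assms(4) by (intro sum.mono_neutral_right) (auto simp: a_def)
  then have low: "(\<Sum>i=1..N. of_int (a i) * q_var powi (L + int i - 1)) = q_var powi L" by (simp add: a_def)
  have inj: "inj_on sh {i. c i \<noteq> 0}" by (simp add: inj_on_def sh_def)
  have "(\<Sum>d | h d \<noteq> 0. of_int (h d) * q_var powi d) = (\<Sum>i | c i \<noteq> 0. of_int (c i) * q_var powi (sh i))"
    unfolding supp sum.reindex[OF inj] comp_def h_sh ..
  also have "\<dots> = q_var powi L * (q_var ^ N * z)"
    unfolding c(2) sum_distrib_left using q_nz
    by (intro sum.cong refl) (simp add: sh_def power_int_add mult_ac)
  finally have "colored_jones m (map Gen js) N = (\<Sum>i=1..N. of_int (a i) * q_var powi (L + int i - 1))
                + (\<Sum>d | h d \<noteq> 0. of_int (h d) * q_var powi d)"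
    unfolding z(2) low by (simp add: distrib_left)
  moreover have "a 1 = 1" "\<forall>i\<in>{2..N}. a i = 0" by (auto simp: a_def)
  moreover have "finite {d. h d \<noteq> 0}" unfolding supp using c(1) by simp
  moreover have "\<forall>d. h d \<noteq> 0 \<longrightarrow> d \<ge> L + int N" by (simp add: h_def)
  ultimately show ?thesis unfolding Let_def L_def by blast
qed

end
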